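(* Let $X$ be a spectrally negative Lévy process drifting to infinity, let $g=\sup\{t\ge0:X_t\le0\}$, and let $d:\mathbb R_+\times\mathbb R_+\to\mathbb R_+$ be a convex function such that $\mathbb E(d(0,g))<\infty$. Then for each stopping time $\tau\in\mathcal T$, $$\mathbb E(d(\tau,g))=\mathbb E\Big(\int_0^\tau G_d(g_s,s,X_s)\,ds+d(0,g)\Big),$$ where $$G_d(\gamma,s,x)=\frac{\partial}{\partial x}d_+(s,\gamma)\,\psi'(0+)W(x)+\mathbb E_x\Big(\frac{\partial}{\partial x}d_+(s,g+s)\,\mathbb I_{\{g>0\}}\Big)$$ and $\frac{\partial}{\partial x}d_+$ denotes the right derivative of $d$ with respect to its first argument.
   Context: $X$ is a spectrally negative Lévy process (càdlàg, stationary independent increments, no positive jumps, paths not monotone), $X_0=0$ under $\mathbb P$; $\mathbb P_x$ is its law started at $x$. $\psi(\beta)=\log\mathbb E(e^{\beta X_1})$, $\beta\ge0$; drifting to infinity means $\lim_{t\to\infty}X_t=\infty$ a.s., equivalently $\psi'(0+)>0$. $W=W^{(0)}$ is the $0$-scale function: $W(x)=0$ for $x<0$, and on $[0,\infty)$ it is the strictly increasing continuous function with $\int_0^\infty e^{-\beta x}W(x)dx=1/\psi(\beta)$ for $\beta>\Phi(0)=\sup\{\beta\ge0:\psi(\beta)=0\}$. $g_t=\sup\{0\le s\le t:X_s\le0\}$, with $\sup\emptyset=0$ (also in the definition of $g$). $\mathcal T$ is the set of all stopping times of $X$.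
   Formalization: The formal statement also assumes that d is right-continuous in its first argument at 0; without this the identity fails, e.g. for the convex function d(t,γ)=1 if t=0 and 0 otherwise, with τ=1. *)

theory Defs
  imports "HOL-Probability.Probability"
begin

locale levy_process = prob_space M
  for M :: "'a measure" and X :: "real \<Rightarrow> 'a \<Rightarrow> real" +
  assumes random_variable_X: "\<And>t. 0 \<le> t \<Longrightarrow> random_variable borel (X t)"
    and start_zero: "AE \<omega> in M. X 0 \<omega> = 0"
    and right_continuous_paths:
      "AE \<omega> in M. \<forall>t\<ge>0. ((\<lambda>s. X s \<omega>) \<longlongrightarrow> X t \<omega>) (at_right t)"
    and left_limits:
      "AE \<omega> in M. \<forall>t>0. \<exists>l. ((\<lambda>s. X s \<omega>) \<longlongrightarrow> l) (at_left t)"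
    and stationary_increments:
      "\<And>s t. 0 \<le> s \<Longrightarrow> s \<le> t \<Longrightarrow>
         distr M borel (\<lambda>\<omega>. X t \<omega> - X s \<omega>) = distr M borel (X (t - s))"
    and independent_increments:
      "\<And>(t :: nat \<Rightarrow> real) n. 0 \<le> t 0 \<Longrightarrow> mono t \<Longrightarrow>
         indep_vars (\<lambda>_. borel) (\<lambda>i \<omega>. X (t (Suc i)) \<omega> - X (t i) \<omega>) {..<n}"

locale spectrally_negative_levy_process = levy_process +
  assumes no_positive_jumps:
      "AE \<omega> in M. \<forall>t>0. X t \<omega> \<le> Lim (at_left t) (\<lambda>s. X s \<omega>)"
    and paths_not_increasing: "\<not> (AE \<omega> in M. monotone_on {0..} (\<le>) (\<le>) (\<lambda>t. X t \<omega>))"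
    and paths_not_decreasing: "\<not> (AE \<omega> in M. monotone_on {0..} (\<le>) (\<ge>) (\<lambda>t. X t \<omega>))"

definition drifts_to_infinity :: "'a measure \<Rightarrow> (real \<Rightarrow> 'a \<Rightarrow> real) \<Rightarrow> bool" where
  "drifts_to_infinity M X \<longleftrightarrow> (AE \<omega> in M. filterlim (\<lambda>t. X t \<omega>) at_top at_top)"

definition laplace_exponent :: "'a measure \<Rightarrow> (real \<Rightarrow> 'a \<Rightarrow> real) \<Rightarrow> real \<Rightarrow> real" where
  "laplace_exponent M X \<beta> = ln (\<integral>\<omega>. exp (\<beta> * X 1 \<omega>) \<partial>M)"

definition is_scale_function :: "(real \<Rightarrow> real) \<Rightarrow> (real \<Rightarrow> real) \<Rightarrow> bool" where
  "is_scale_function \<psi> W \<longleftrightarrow>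
     (\<forall>x<0. W x = 0) \<and> strict_mono_on {0..} W \<and> continuous_on {0..} W \<and>
     (\<forall>\<beta>. \<beta> > Sup {\<beta>. 0 \<le> \<beta> \<and> \<psi> \<beta> = 0} \<longrightarrow>
        ((\<lambda>x. exp (- \<beta> * x) * W x) has_integral 1 / \<psi> \<beta>) {0..})"

definition right_deriv :: "(real \<Rightarrow> real) \<Rightarrow> real \<Rightarrow> real" where
  "right_deriv f x = vector_derivative f (at_right x)"

text \<open>
  In \<^typ>\<open>ennreal\<close> the supremum of the empty set is 0. A path with arbitrarily late
  visits to the lower half-line is sent to 0 by \<^const>\<open>enn2real\<close>; for a process drifting to
  infinity such paths form a null set.
\<close>

definition last_zero :: "(real \<Rightarrow> real) \<Rightarrow> real" where
  "last_zero p = enn2real (SUP t\<in>{t. 0 \<le> t \<and> p t \<le> 0}. ennreal t)"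

definition last_zero_before :: "real \<Rightarrow> (real \<Rightarrow> real) \<Rightarrow> real" where
  "last_zero_before t p = enn2real (SUP s\<in>{s. 0 \<le> s \<and> s \<le> t \<and> p s \<le> 0}. ennreal s)"

text \<open>
  The natural filtration of the process, made right-continuous and augmented by the null sets.
\<close>

definition augmented_filtration ::
    "'a measure \<Rightarrow> (real \<Rightarrow> 'a \<Rightarrow> real) \<Rightarrow> real \<Rightarrow> 'a set set" where
  "augmented_filtration M X t =
     (\<Inter>u\<in>{t<..}. sigma_sets (space M)
        ({X s -` B \<inter> space M | s B. 0 \<le> s \<and> s \<le> u \<and> B \<in> sets borel} \<union> null_sets M))"

text \<open>
  Stopping times may be infinite, whereas the library predicate \<^const>\<open>stopping_time\<close> takes
  values in the index type of the filtration, here the reals.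
\<close>

definition levy_stopping_time ::
    "'a measure \<Rightarrow> (real \<Rightarrow> 'a \<Rightarrow> real) \<Rightarrow> ('a \<Rightarrow> ennreal) \<Rightarrow> bool" where
  "levy_stopping_time M X \<tau> \<longleftrightarrow>
     (\<forall>t\<ge>0. {\<omega> \<in> space M. \<tau> \<omega> \<le> ennreal t} \<in> augmented_filtration M X t)"

text \<open>
  The integral with values in the extended reals, defined as soon as the positive or the negative
  part has a finite integral. (The library integral would return 0 for functions that are not
  integrable.)
\<close>

definition ext_integral :: "'a measure \<Rightarrow> ('a \<Rightarrow> ereal) \<Rightarrow> ereal" where
  "ext_integral M f =
     enn2ereal (\<integral>\<^sup>+x. e2ennreal (f x) \<partial>M) - enn2ereal (\<integral>\<^sup>+x. e2ennreal (- f x) \<partial>M)"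

text \<open>
  The value of d at a possibly infinite first argument: the limit, which exists in
  \<open>[0, \<infinity>]\<close> by convexity, is used at \<open>\<infinity>\<close>.
\<close>

definition stopped_value :: "(real \<Rightarrow> real \<Rightarrow> real) \<Rightarrow> ennreal \<Rightarrow> real \<Rightarrow> ereal" where
  "stopped_value d T \<gamma> =
     (if T = \<top> then Lim at_top (\<lambda>t. ereal (d t \<gamma>)) else ereal (d (enn2real T) \<gamma>))"

text \<open>
  The expectation under the law started at x is that of the shifted process \<open>x + X\<close>. The
  (unspecified) value of the right derivative of d at s = 0, where it may diverge, only affects
  the kernel at the single time s = 0.
\<close>

definition G_kernel ::
    "'a measure \<Rightarrow> (real \<Rightarrow> 'a \<Rightarrow> real) \<Rightarrow> (real \<Rightarrow> real) \<Rightarrow> (real \<Rightarrow> real \<Rightarrow> real) \<Rightarrow>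
     real \<Rightarrow> real \<Rightarrow> real \<Rightarrow> ereal" where
  "G_kernel M X W d \<gamma> s x =
     ereal (right_deriv (\<lambda>t. d t \<gamma>) s * right_deriv (laplace_exponent M X) 0 * W x) +
     ext_integral M (\<lambda>\<omega>.
       let g = last_zero (\<lambda>t. x + X t \<omega>)
       in ereal (right_deriv (\<lambda>t. d t (g + s)) s * of_bool (g > 0)))"

end

theory Submission
  imports Defs
begin

text \<open>
  Integrating the right derivative gives \<open>d(\<tau>, g) = d(0, g) + \<integral>\<^sub>0\<^sup>\<tau> d'(s, g) ds\<close>, and the negative part of
  the integral is at most \<open>d(0, g)\<close>, so expectation and integral may be interchanged. Since \<open>s \<le> \<tau>\<close> is an
  event of the past of \<open>s\<close>, the integrand may be replaced by its conditional expectation given that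
  past. After time \<open>s\<close> the path either never visits the lower half-line again, so that \<open>g = g\<^sub>s\<close>, or
  \<open>g = s + g'\<close> with \<open>g' > 0\<close> the last zero of the shifted path; this is the kernel, provided that the
  process started at \<open>x\<close> stays positive with probability \<open>\<psi>'(0+) W(x)\<close>.

  For the latter, let \<open>I\<close> be the infimum of the path. A discretization with small steps shows that
  \<open>\<psi>(\<beta>) E (exp (\<beta> I)) / \<beta>\<close> does not depend on \<open>\<beta>\<close>; letting \<open>\<beta>\<close> tend to 0, it equals \<open>\<psi>'(0+)\<close>. Thus
  \<open>P (I > - x)\<close> and \<open>\<psi>'(0+) W(x)\<close> have the same Laplace transform. At \<open>x = 0\<close> the equality follows by time
  reversal, because 0 is regular for the upper half-line.
\<close>

section \<open>Cadlag paths without positive jumps\<close>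

text \<open>No moment of \<open>X\<close> and no integrability of the stopped payoff is assumed, so
  infinite values have to be carried along. Every signed quantity is kept as two
  \<open>ennreal\<close> integrals, selected by a sign. The identities are proved for each part
  separately, where Tonelli and the Markov property need no integrability; the parts are subtracted
  only once the one with sign \<open>- 1\<close> is known to be finite. That one is controlled
  because a nonnegative convex function cannot descend by more than its initial value. Finiteness of
  the Laplace exponent is a consequence of the absence of positive jumps: passing a high level means
  passing several low ones in succession with small overshoots, which gives geometric tails. The
  other obstacle is measurability. Infima and last zeros refer to uncountably many times, so the
  future enters the Markov property as a path sampled at nonnegative rationals. Since jumps go down
  only, the times spent at or below a level form a closed set; together with right-continuity this
  turns a visit into a condition on near-visits at rational times.\<close>

definition good_path :: "(real \<Rightarrow> real) \<Rightarrow> bool" where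
  "good_path p \<longleftrightarrow> p 0 = 0 \<and> (\<forall>t\<ge>0. (p \<longlongrightarrow> p t) (at_right t)) \<and>
     (\<forall>t>0. \<exists>l\<ge>p t. (p \<longlongrightarrow> l) (at_left t)) \<and> filterlim p at_top at_top"

lemma good_path_shift:
  assumes "good_path p" "0 \<le> s"
  shows "good_path (\<lambda>t. p (s + t) - p s)"
proof -
  have R: "((\<lambda>t. p (s + t) - p s) \<longlongrightarrow> p (s + t) - p s) (at_right t)" if "0 \<le> t" for t
  proof -
    have "(p \<longlongrightarrow> p (s + t)) (at_right (s + t))"
      using assms that by (auto simp: good_path_def)
    then have "((\<lambda>t. p (s + t)) \<longlongrightarrow> p (s + t)) (at_right t)"
      by (subst (asm) at_right_to_0, subst at_right_to_0)
         (simp add: filterlim_filtermap o_def add_ac)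
    then show ?thesis by (intro tendsto_intros)
  qed
  have L: "\<exists>l\<ge>p (s + t) - p s. ((\<lambda>t. p (s + t) - p s) \<longlongrightarrow> l) (at_left t)" if "0 < t" for t
  proof -
    have "s + t > 0" using assms that by auto
    then obtain l where l: "l \<ge> p (s + t)" "(p \<longlongrightarrow> l) (at_left (s + t))"
      using assms unfolding good_path_def by blast
    then have "((\<lambda>t. p (s + t)) \<longlongrightarrow> l) (at_left t)"
    proof -
      have "filterlim (\<lambda>t. s + t) (at_left (s + t)) (at_left t)"
        unfolding filterlim_at
        by (auto intro!: tendsto_intros simp: eventually_at_left_field)
           (metis lt_ex)
      then show ?thesis using l(2) filterlim_compose[of p] by blast
    qed
    then have "((\<lambda>t. p (s + t) - p s) \<longlongrightarrow> l - p s) (at_left t)" by (intro tendsto_intros)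
    then show ?thesis using l by (intro exI[of _ "l - p s"]) auto
  qed
  have "filterlim (\<lambda>t. s + t) at_top at_top"
    by (rule filterlim_tendsto_add_at_top[OF tendsto_const filterlim_ident])
  then have "filterlim (\<lambda>t. p (s + t)) at_top at_top"
    using assms by (auto simp: good_path_def intro: filterlim_compose)
  then have "filterlim (\<lambda>t. - p s + p (s + t)) at_top at_top"
    by (rule filterlim_tendsto_add_at_top[OF tendsto_const])
  then show ?thesis using R L by (auto simp: good_path_def)
qed

text \<open>Downward jumps leave the left limit at or above the value, so a strict lower bound at
  \<open>t\<close> persists on both sides. This lower semicontinuity is the form in which the
  absence of positive jumps is used most often.\<close>

lemma good_path_lsc:
  assumes "good_path p" "0 \<le> t" "a < p t"
  shows "\<exists>\<eta>>0. \<forall>r\<ge>0. \<bar>r - t\<bar> < \<eta> \<longrightarrow> a < p r"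
proof -
  have "eventually (\<lambda>r. a < p r) (at_right t)"
    using assms by (auto simp: good_path_def intro: order_tendstoD)
  then obtain b where b: "b > t" "\<forall>y>t. y < b \<longrightarrow> a < p y"
    unfolding eventually_at_right_field by blast
  show ?thesis
  proof (cases "t = 0")
    case True
    have "r = 0 \<or> r > 0" if "r \<ge> 0" for r::real using that by auto
    then show ?thesis using b True assms(3) by (intro exI[of _ b]) fastforce
  next
    case False
    then have "t > 0" using assms by auto
    then obtain l where l: "l \<ge> p t" "(p \<longlongrightarrow> l) (at_left t)"
      using assms unfolding good_path_def by blast
    have "eventually (\<lambda>r. a < p r) (at_left t)"
      using l assms(3) by (intro order_tendstoD(1)[of p l]) auto
    then obtain c where c: "c < t" "\<forall>y>c. y < t \<longrightarrow> a < p y"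
      unfolding eventually_at_left_field by blast
    show ?thesis
    proof (intro exI[of _ "min (b - t) (t - c)"] conjI allI impI)
      fix r assume "0 \<le> r" "\<bar>r - t\<bar> < min (b - t) (t - c)"
      then show "a < p r" using b c assms(3) by (cases "r = t"; cases "r < t") (auto simp: abs_if split: if_splits)
    qed (use b c in auto)
  qed
qed

text \<open>Near-visits in a compact interval accumulate at some \<open>l\<close>, and lower
  semicontinuity rules out \<open>p l > a\<close>.\<close>

lemma good_path_visit_closed:
  assumes p: "good_path p" and u: "0 \<le> u" and q: "\<forall>n::nat. \<exists>q\<in>{u..v}. p q < a + 1 / real (Suc n)"
  shows "\<exists>t\<in>{u..v}. p t \<le> a"
proof -
  obtain q where q: "\<And>n. q n \<in> {u..v}" "\<And>n. p (q n) < a + 1 / real (Suc n)"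
    using q by metis
  have "seq_compact {u..v}" by (rule compact_imp_seq_compact) simp
  then obtain l r where l: "l \<in> {u..v}" "strict_mono (r :: nat \<Rightarrow> nat)" "(q \<circ> r) \<longlonglongrightarrow> l"
    using q(1) unfolding seq_compact_def by metis
  have "p l \<le> a"
  proof (rule ccontr)
    assume "\<not> p l \<le> a"
    then have "(a + p l) / 2 < p l" by auto
    from good_path_lsc[OF p _ this] l u obtain \<eta>
      where e: "\<eta> > 0" "\<forall>r\<ge>0. \<bar>r - l\<bar> < \<eta> \<longrightarrow> (a + p l) / 2 < p r" by auto
    have 1: "eventually (\<lambda>n. \<bar>q (r n) - l\<bar> < \<eta>) sequentially"
      using l(3) e(1) by (auto simp: tendsto_iff dist_real_def)
    have "((\<lambda>n. 1 / real (Suc n)) \<circ> r) \<longlonglongrightarrow> 0"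
      by (intro LIMSEQ_subseq_LIMSEQ l) (use LIMSEQ_inverse_real_of_nat in \<open>simp add: inverse_eq_divide\<close>)
    then have 2: "eventually (\<lambda>n. 1 / real (Suc (r n)) < (p l - a) / 2) sequentially"
      using \<open>\<not> p l \<le> a\<close> by (intro order_tendstoD(2)[of _ 0]) (auto simp: o_def)
    obtain n where n: "\<bar>q (r n) - l\<bar> < \<eta>" "1 / real (Suc (r n)) < (p l - a) / 2"
      using eventually_happens[OF eventually_conj[OF 1 2]] by auto
    have "q (r n) \<ge> 0" using q(1)[of "r n"] u by auto
    with e n have "(a + p l) / 2 < p (q (r n))" by auto
    moreover have "p (q (r n)) < a + (p l - a)/2" using q(2)[of "r n"] n(2) by linarith
    ultimately show False by (auto simp: field_simps)
  qed
  then show ?thesis using l by auto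
qed

text \<open>This makes visit events countable. From left to right it is right-continuity at the
  visit; conversely, near-visits stay in a compact interval because the path tends to
  infinity.\<close>

lemma good_path_visit_iff:
  assumes p: "good_path p" and u: "0 \<le> u"
  shows "(\<exists>t\<ge>u. p t \<le> a) \<longleftrightarrow> (\<forall>n::nat. \<exists>q\<in>\<rat>. u \<le> q \<and> p q < a + 1 / real (Suc n))"
proof
  assume "\<exists>t\<ge>u. p t \<le> a"
  then obtain t where t: "t \<ge> u" "p t \<le> a" by auto
  show "\<forall>n::nat. \<exists>q\<in>\<rat>. u \<le> q \<and> p q < a + 1 / real (Suc n)"
  proof
    fix n :: nat
    have "eventually (\<lambda>r. p r < a + 1 / real (Suc n)) (at_right t)"
      using p t u by (intro order_tendstoD(2)[of p "p t"]) (auto simp: good_path_def intro: le_less_trans)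
    then obtain b where "b > t" "\<forall>y>t. y < b \<longrightarrow> p y < a + 1 / real (Suc n)"
      unfolding eventually_at_right_field by blast
    moreover obtain q where "q \<in> \<rat>" "t < q" "q < b" using Rats_dense_in_real[OF \<open>b > t\<close>] by auto
    ultimately show "\<exists>q\<in>\<rat>. u \<le> q \<and> p q < a + 1 / real (Suc n)" using t by (intro bexI[of _ q]) auto
  qed
next
  assume q: "\<forall>n::nat. \<exists>q\<in>\<rat>. u \<le> q \<and> p q < a + 1 / real (Suc n)"
  \<comment> \<open>The level \<open>a + 1\<close> dominates all
    \<open>a + 1 / real (Suc n)\<close>, so one \<open>T\<close> bounds every near-visit.\<close>
  have "eventually (\<lambda>t. p t > a + 1) at_top"
    using p by (auto simp: good_path_def filterlim_at_top_dense)
  then obtain T where T: "\<And>t. t \<ge> T \<Longrightarrow> p t > a + 1" by (auto simp: eventually_at_top_linorder)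
  have "\<forall>n::nat. \<exists>q\<in>{u..T}. p q < a + 1 / real (Suc n)"
  proof
    fix n :: nat
    obtain q where q: "u \<le> q" "p q < a + 1 / real (Suc n)" using q by blast
    moreover have "1 / real (Suc n) \<le> 1" by auto
    ultimately have "p q < a + 1" by linarith
    then have "q \<le> T" using T[of q] by linarith
    then show "\<exists>q\<in>{u..T}. p q < a + 1 / real (Suc n)" using q by auto
  qed
  from good_path_visit_closed[OF p u this] show "\<exists>t\<ge>u. p t \<le> a" by auto
qed

text \<open>Times are parametrized by rational fractions of the interval so that
  \<open>q = 1\<close> yields the endpoint \<open>v\<close>, which right-continuity could not reach
  from inside. No sampled time exceeds \<open>v\<close>, which later gives adaptedness.\<close>

lemma good_path_visit_iff_bounded:
  assumes p: "good_path p" and u: "0 \<le> u" "u \<le> v"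
  shows "(\<exists>t\<in>{u..v}. p t \<le> a) \<longleftrightarrow> (\<forall>n::nat. \<exists>q\<in>\<rat> \<inter> {0..1}. p (u + q * (v - u)) < a + 1 / real (Suc n))"
proof
  assume "\<exists>t\<in>{u..v}. p t \<le> a"
  then obtain t where t: "t \<ge> u" "t \<le> v" "p t \<le> a" by auto
  show "\<forall>n::nat. \<exists>q\<in>\<rat> \<inter> {0..1}. p (u + q * (v - u)) < a + 1 / real (Suc n)"
  proof
    fix n :: nat
    have less: "p t < a + 1 / real (Suc n)" using t by (auto intro: le_less_trans)
    have "eventually (\<lambda>r. p r < a + 1 / real (Suc n)) (at_right t)"
      using p t u less by (intro order_tendstoD(2)[of p "p t"]) (auto simp: good_path_def)
    then obtain b where b: "b > t" "\<forall>y>t. y < b \<longrightarrow> p y < a + 1 / real (Suc n)"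
      unfolding eventually_at_right_field by blast
    show "\<exists>q\<in>\<rat> \<inter> {0..1}. p (u + q * (v - u)) < a + 1 / real (Suc n)"
    proof (cases "t = v")
      case True
      then show ?thesis using less by (intro bexI[of _ 1]) auto
    next
      case False
      then have tv: "t < v" "v > u" using t by auto
      have "(t - u) / (v - u) < (min b v - u) / (v - u)"
        using tv b by (intro divide_strict_right_mono) auto
      then obtain q where q: "q \<in> \<rat>" "(t - u) / (v - u) < q" "q < (min b v - u) / (v - u)"
        using Rats_dense_in_real by blast
      then have q': "t < u + q * (v - u)" "u + q * (v - u) < min b v" using tv
        by (auto simp: field_simps)
      have "0 \<le> (t - u) / (v - u)" "(min b v - u) / (v - u) \<le> 1" using tv t by auto
      then have "q \<in> {0..1}" using q by auto
      then show ?thesis using b q q' by (intro bexI[of _ q]) auto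
    qed
  qed
next
  assume q: "\<forall>n::nat. \<exists>q\<in>\<rat> \<inter> {0..1}. p (u + q * (v - u)) < a + 1 / real (Suc n)"
  have "\<forall>n::nat. \<exists>q\<in>{u..v}. p q < a + 1 / real (Suc n)"
  proof
    fix n :: nat
    obtain q where q: "q \<in> {0..1}" "p (u + q * (v - u)) < a + 1 / real (Suc n)" using q by blast
    moreover have "u + q * (v - u) \<in> {u..v}"
      using q(1) u mult_right_mono[of q 1 "v - u"] by auto
    ultimately show "\<exists>q\<in>{u..v}. p q < a + 1 / real (Suc n)" by blast
  qed
  from good_path_visit_closed[OF p u(1) this] show "\<exists>t\<in>{u..v}. p t \<le> a" .
qed

text \<open>Compactness: if ever shorter steps rose by more than \<open>\<epsilon>\<close>, both
  ends would converge to some \<open>l\<close>. Near \<open>l\<close> the path is close to its left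
  limit \<open>m\<close> before and to \<open>p l\<close> from then on, and crossing
  \<open>l\<close> means going from \<open>m\<close> down to \<open>p l\<close>.\<close>

lemma good_path_small_increments:
  assumes p: "good_path p" and e: "0 < \<epsilon>"
  shows "\<exists>\<eta>>0. \<forall>r r'. 0 \<le> r \<and> r < r' \<and> r' < r + \<eta> \<and> r' \<le> \<delta> \<longrightarrow> p r' - p r \<le> \<epsilon>"
proof (rule ccontr)
  assume neg: "\<not> ?thesis"
  have "\<exists>r r'. 0 \<le> r \<and> r < r' \<and> r' < r + 1 / real (Suc n) \<and> r' \<le> \<delta> \<and> p r' - p r > \<epsilon>" for n
  proof -
    have "1 / real (Suc n) > 0" by simp
    then show ?thesis using neg by (meson not_le)
  qed
  then obtain r r' where r: "\<And>n. 0 \<le> r n" "\<And>n. r n < r' n" "\<And>n. r' n < r n + 1 / real (Suc n)"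
    "\<And>n. r' n \<le> \<delta>" "\<And>n. p (r' n) - p (r n) > \<epsilon>" by metis
  have "seq_compact {0..\<delta>}" by (rule compact_imp_seq_compact) simp
  moreover have "\<forall>n. r n \<in> {0..\<delta>}" using r(1,2,4) by (meson atLeastAtMost_iff less_imp_le order_trans)
  ultimately obtain l f where l: "l \<in> {0..\<delta>}" "strict_mono (f :: nat \<Rightarrow> nat)" "(r \<circ> f) \<longlonglongrightarrow> l"
    unfolding seq_compact_def by metis
  have "(\<lambda>n. r' n - r n) \<longlonglongrightarrow> 0"
  proof (rule tendsto_sandwich[of "\<lambda>_. 0" _ _ "\<lambda>n. 1 / real (Suc n)"])
    show "(\<lambda>n. 1 / real (Suc n)) \<longlonglongrightarrow> 0"
      using LIMSEQ_inverse_real_of_nat by (simp add: inverse_eq_divide)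
    show "eventually (\<lambda>n. 0 \<le> r' n - r n) sequentially" using r(2) by (intro always_eventually allI) (simp add: less_imp_le)
    show "eventually (\<lambda>n. r' n - r n \<le> 1 / real (Suc n)) sequentially"
      using r(3) by (intro always_eventually allI) (simp add: less_imp_le diff_le_eq add.commute)
  qed simp
  then have "((\<lambda>n. r' n - r n) \<circ> f) \<longlonglongrightarrow> 0" by (intro LIMSEQ_subseq_LIMSEQ l)
  from tendsto_add[OF l(3) this] have l': "(\<lambda>n. r' (f n)) \<longlonglongrightarrow> l" by (simp add: o_def)
  have "eventually (\<lambda>x. dist (p x) (p l) < \<epsilon>/2) (at_right l)"
    by (rule tendstoD) (use p l e in \<open>auto simp: good_path_def\<close>)
  then obtain b where b: "b > l" "\<forall>y>l. y < b \<longrightarrow> \<bar>p y - p l\<bar> < \<epsilon>/2"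
    unfolding eventually_at_right_field dist_real_def by blast
  have "\<exists>c<l. \<exists>m\<ge>p l. \<forall>y>c. 0 \<le> y \<longrightarrow> y < l \<longrightarrow> \<bar>p y - m\<bar> < \<epsilon>/2"
  proof (cases "l = 0")
    case True
    then show ?thesis by (intro exI[of _ "-1"]) auto
  next
    case False
    then have "l > 0" using l by auto
    then obtain m where m: "m \<ge> p l" "(p \<longlongrightarrow> m) (at_left l)"
      using p unfolding good_path_def by blast
    then have "eventually (\<lambda>x. dist (p x) m < \<epsilon>/2) (at_left l)"
      by (intro tendstoD) (use e in auto)
    then show ?thesis using m(1)
      unfolding eventually_at_left_field dist_real_def by blast
  qed
  then obtain c m where c: "c < l" "m \<ge> p l" "\<forall>y>c. 0 \<le> y \<longrightarrow> y < l \<longrightarrow> \<bar>p y - m\<bar> < \<epsilon>/2" by blast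
  have 1: "eventually (\<lambda>n. r (f n) > c) sequentially"
    using order_tendstoD(1)[OF l(3) c(1)] by (simp add: o_def)
  have 2: "eventually (\<lambda>n. r' (f n) < b) sequentially"
    using order_tendstoD(2)[OF l' b(1)] by simp
  obtain n where n: "r (f n) > c" "r' (f n) < b"
    using eventually_happens[OF eventually_conj[OF 1 2]] by auto
  let ?x = "r (f n)" and ?y = "r' (f n)"
  have xy: "0 \<le> ?x" "?x < ?y" "p ?y - p ?x > \<epsilon>" using r by auto
  show False
  proof (cases "?x < l")
    case False
    then have "\<bar>p ?y - p l\<bar> < \<epsilon>/2" using b xy n by auto
    moreover have "\<bar>p ?x - p l\<bar> < \<epsilon>/2" using b xy n False e by (cases "?x = l") auto
    ultimately show False using xy by linarith
  next
    case True
    then have "\<bar>p ?x - m\<bar> < \<epsilon>/2" using c xy n by auto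
    moreover have "p ?y \<le> m + \<epsilon>/2"
    proof (cases "?y < l")
      case True
      then have "\<bar>p ?y - m\<bar> < \<epsilon>/2" using c xy n by auto
      then show ?thesis by linarith
    next
      case False
      then have "\<bar>p ?y - p l\<bar> < \<epsilon>/2" using b xy n e by (cases "?y = l") auto
      then show ?thesis using c by linarith
    qed
    ultimately show False using xy by linarith
  qed
qed

section \<open>Last zeros as functionals of a path\<close>

lemma enn2real_SUP_ge_iff:
  assumes S: "S \<subseteq> {0..T}" and u: "0 < u"
    and cl: "u \<notin> S \<Longrightarrow> \<exists>\<eta>>0. \<forall>t\<in>S. t < u \<longrightarrow> t \<le> u - \<eta>"
  shows "u \<le> enn2real (SUP t\<in>S. ennreal t) \<longleftrightarrow> (\<exists>t\<in>S. u \<le> t)"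
proof -
  have le: "(SUP t\<in>S. ennreal t) \<le> ennreal T" using S by (intro SUP_least ennreal_leI) auto
  then have fin: "(SUP t\<in>S. ennreal t) < \<top>" by (rule order.strict_trans1) simp
  show ?thesis
  proof
    assume "\<exists>t\<in>S. u \<le> t"
    then obtain t where t: "t \<in> S" "u \<le> t" by auto
    have "ennreal t \<le> (SUP t\<in>S. ennreal t)" using t by (intro SUP_upper)
    then have "enn2real (ennreal t) \<le> enn2real (SUP t\<in>S. ennreal t)" using fin by (intro enn2real_mono)
    then show "u \<le> enn2real (SUP t\<in>S. ennreal t)" using t S by auto
  next
    assume a: "u \<le> enn2real (SUP t\<in>S. ennreal t)"
    show "\<exists>t\<in>S. u \<le> t"
    proof (rule ccontr)
      assume n: "\<not> (\<exists>t\<in>S. u \<le> t)"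
      then have "u \<notin> S" by auto
      then obtain \<eta> where "\<eta> > 0" "\<forall>t\<in>S. t < u \<longrightarrow> t \<le> u - \<eta>" using cl by auto
      then have "(SUP t\<in>S. ennreal t) \<le> ennreal (u - \<eta>)" using n by (intro SUP_least ennreal_leI) auto
      then have "enn2real (SUP t\<in>S. ennreal t) \<le> enn2real (ennreal (u - \<eta>))" by (intro enn2real_mono) auto
      also have "\<dots> < u" using \<open>\<eta> > 0\<close> u by (cases "u - \<eta> \<ge> 0") (auto simp: ennreal_neg)
      finally show False using a by simp
    qed
  qed
qed

text \<open>The set of zeros is bounded since the path tends to infinity, so \<open>enn2real\<close>
  loses nothing, and it is closed by lower semicontinuity, so the supremum is attained. Thresholds
  \<open>u > 0\<close> keep clear of the value 0 given to the empty set; by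
  \<open>eq_if_pos_ge_iff\<close> they determine the last zero.\<close>

lemma last_zero_ge_iff:
  assumes p: "good_path p" and u: "0 < u"
  shows "u \<le> last_zero (\<lambda>t. x + p t) \<longleftrightarrow> (\<exists>t\<ge>u. x + p t \<le> 0)"
proof -
  have "eventually (\<lambda>t. p t > - x) at_top"
    using p by (auto simp: good_path_def filterlim_at_top_dense)
  then obtain T where T: "\<And>t. t \<ge> T \<Longrightarrow> p t > - x" by (auto simp: eventually_at_top_linorder)
  have "u \<le> last_zero (\<lambda>t. x + p t) \<longleftrightarrow> (\<exists>t\<in>{t. 0 \<le> t \<and> x + p t \<le> 0}. u \<le> t)"
    unfolding last_zero_def
  proof (rule enn2real_SUP_ge_iff[where T = T, OF _ u])
    show "{t. 0 \<le> t \<and> x + p t \<le> 0} \<subseteq> {0..T}"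
    proof
      fix t assume "t \<in> {t. 0 \<le> t \<and> x + p t \<le> 0}"
      then show "t \<in> {0..T}" using T[of t] by (cases "t \<le> T") auto
    qed
    assume "u \<notin> {t. 0 \<le> t \<and> x + p t \<le> 0}"
    then have "- x < p u" using u by auto
    from good_path_lsc[OF p _ this] u obtain \<eta> where "\<eta> > 0" "\<forall>r\<ge>0. \<bar>r - u\<bar> < \<eta> \<longrightarrow> - x < p r" by auto
    then show "\<exists>\<eta>>0. \<forall>t\<in>{t. 0 \<le> t \<and> x + p t \<le> 0}. t < u \<longrightarrow> t \<le> u - \<eta>"
      by (intro exI[of _ \<eta>]) (force simp: abs_if)
  qed
  also have "\<dots> \<longleftrightarrow> (\<exists>t\<ge>u. x + p t \<le> 0)" using u by (auto intro: less_imp_le less_le_trans)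
  finally show ?thesis .
qed

lemma last_zero_before_ge_iff:
  assumes p: "good_path p" and u: "0 < u"
  shows "u \<le> last_zero_before s p \<longleftrightarrow> u \<le> s \<and> (\<exists>t\<in>{u..s}. p t \<le> 0)"
proof -
  have "u \<le> last_zero_before s p \<longleftrightarrow> (\<exists>t\<in>{t. 0 \<le> t \<and> t \<le> s \<and> p t \<le> 0}. u \<le> t)"
    unfolding last_zero_before_def
  proof (rule enn2real_SUP_ge_iff[where T = s, OF _ u])
    show "{t. 0 \<le> t \<and> t \<le> s \<and> p t \<le> 0} \<subseteq> {0..s}" by auto
    assume *: "u \<notin> {t. 0 \<le> t \<and> t \<le> s \<and> p t \<le> 0}"
    show "\<exists>\<eta>>0. \<forall>t\<in>{t. 0 \<le> t \<and> t \<le> s \<and> p t \<le> 0}. t < u \<longrightarrow> t \<le> u - \<eta>"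
    proof (cases "u \<le> s")
      case True
      then have "0 < p u" using u * by auto
      from good_path_lsc[OF p _ this] u obtain \<eta> where "\<eta> > 0" "\<forall>r\<ge>0. \<bar>r - u\<bar> < \<eta> \<longrightarrow> 0 < p r" by auto
      then show ?thesis
        by (intro exI[of _ \<eta>]) (force simp: abs_if)
    next
      case False
      then show ?thesis by (intro exI[of _ "u - s"]) auto
    qed
  qed
  also have "\<dots> \<longleftrightarrow> u \<le> s \<and> (\<exists>t\<in>{u..s}. p t \<le> 0)"
  proof
    assume "u \<le> s \<and> (\<exists>t\<in>{u..s}. p t \<le> 0)"
    then obtain t where "u \<le> t" "t \<le> s" "p t \<le> 0" by auto
    then show "\<exists>t\<in>{t. 0 \<le> t \<and> t \<le> s \<and> p t \<le> 0}. u \<le> t" using u by (intro bexI[of _ t]) auto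
  qed auto
  finally show ?thesis .
qed

lemma last_zero_nonneg: "0 \<le> last_zero p" by (simp add: last_zero_def)
lemma last_zero_before_nonneg: "0 \<le> last_zero_before s p" by (simp add: last_zero_before_def)

lemma eq_if_pos_ge_iff:
  fixes a b :: real
  assumes "0 \<le> a" "0 \<le> b" "\<And>u. 0 < u \<Longrightarrow> u \<le> a \<longleftrightarrow> u \<le> b"
  shows "a = b"
  using assms(1,2) assms(3)[of a] assms(3)[of b] by (cases "a = 0"; cases "b = 0") auto

lemma last_zero_pos_iff:
  assumes "good_path p"
  shows "0 < last_zero (\<lambda>t. x + p t) \<longleftrightarrow> (\<exists>t>0. x + p t \<le> 0)"
  using last_zero_ge_iff[OF assms, of "last_zero (\<lambda>t. x + p t)" x] last_zero_ge_iff[OF assms, of _ x]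
  by (metis less_le_trans order_refl)

text \<open>A visit strictly after \<open>s\<close> makes \<open>z\<close> positive, and the last
  one occurs at \<open>s + z\<close>. A visit at \<open>s\<close> itself has shifted time 0; it
  leaves \<open>z = 0\<close> and is counted by \<open>last_zero_before s p\<close>.\<close>

lemma last_zero_decompose:
  assumes p: "good_path p" and s: "0 \<le> s"
  shows "last_zero p = (let z = last_zero (\<lambda>t. p s + (p (s + t) - p s)) in
     if z > 0 then s + z else last_zero_before s p)"
proof -
  define z where "z = last_zero (\<lambda>t. p s + (p (s + t) - p s))"
  note sh = good_path_shift[OF p s]
  have z0: "z \<ge> 0" by (simp add: z_def last_zero_nonneg)
  have zge: "u \<le> z \<longleftrightarrow> (\<exists>t\<ge>u. p (s + t) \<le> 0)" if "u > 0" for u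
    unfolding z_def by (subst last_zero_ge_iff[OF sh that]) auto
  have zpos: "0 < z \<longleftrightarrow> (\<exists>t>0. p (s + t) \<le> 0)"
    unfolding z_def by (subst last_zero_pos_iff[OF sh]) auto
  have pge: "u \<le> last_zero p \<longleftrightarrow> (\<exists>t\<ge>u. p t \<le> 0)" if "u > 0" for u
    using last_zero_ge_iff[OF p that, of 0] by simp
  have "last_zero p = (if z > 0 then s + z else last_zero_before s p)"
  proof (rule eq_if_pos_ge_iff)
    show "0 \<le> (if z > 0 then s + z else last_zero_before s p)"
      using s last_zero_before_nonneg by auto
    fix u :: real assume u: "0 < u"
    show "u \<le> last_zero p \<longleftrightarrow> u \<le> (if z > 0 then s + z else last_zero_before s p)"
    proof (cases "z > 0")
      case True
      show ?thesis
      proof (cases "u \<le> s")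
        case True
        obtain t where "t > 0" "p (s + t) \<le> 0" using zpos \<open>z > 0\<close> by auto
        then have "\<exists>t\<ge>u. p t \<le> 0" using True by (intro exI[of _ "s + t"]) auto
        then show ?thesis using pge[OF u] True \<open>z > 0\<close> by auto
      next
        case False
        then have "u \<le> s + z \<longleftrightarrow> (\<exists>t\<ge>u - s. p (s + t) \<le> 0)" using zge[of "u - s"] by (auto simp: algebra_simps)
        also have "\<dots> \<longleftrightarrow> (\<exists>t\<ge>u. p t \<le> 0)"
        proof
          assume "\<exists>t\<ge>u. p t \<le> 0"
          then obtain t where "t \<ge> u" "p t \<le> 0" by auto
          then show "\<exists>t\<ge>u - s. p (s + t) \<le> 0" by (intro exI[of _ "t - s"]) auto
        next
          assume "\<exists>t\<ge>u - s. p (s + t) \<le> 0"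
          then obtain t where "t \<ge> u - s" "p (s + t) \<le> 0" by auto
          then show "\<exists>t\<ge>u. p t \<le> 0" by (intro exI[of _ "s + t"]) auto
        qed
        finally show ?thesis using pge[OF u] \<open>z > 0\<close> by auto
      qed
    next
      case False
      have no: "p t > 0" if "t > s" for t
      proof (rule ccontr)
        assume "\<not> p t > 0"
        then have "\<exists>t>0. p (s + t) \<le> 0" using that by (intro exI[of _ "t - s"]) auto
        then show False using zpos \<open>\<not> 0 < z\<close> by simp
      qed
      have "(\<exists>t\<ge>u. p t \<le> 0) \<longleftrightarrow> u \<le> s \<and> (\<exists>t\<in>{u..s}. p t \<le> 0)"
        using no by (force simp: not_less[symmetric])
      then show ?thesis using False pge[OF u] last_zero_before_ge_iff[OF p u, of s] by simp
    qed
  qed (simp add: last_zero_nonneg)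
  then show ?thesis by (simp add: z_def Let_def)
qed

section \<open>The Markov property at a fixed time\<close>

text \<open>Independence is available for increments along monotone sequences indexed by
  \<open>nat\<close>, so a finite set of times has to be threaded on one that starts at 0 and
  reaches \<open>s\<close>. Beyond the sorted list the sequence stays at \<open>s\<close>.\<close>

lemma finite_subset_mono_sequence:
  fixes s :: real
  assumes J: "finite J" "J \<subseteq> {0..s}" and s: "0 \<le> s"
  shows "\<exists>(t :: nat \<Rightarrow> real) N. mono t \<and> t 0 = 0 \<and> t N = s \<and> J \<subseteq> t ` {..N}"
proof -
  define J' where "J' = J \<union> {0, s}"
  have fin: "finite J'" using J by (simp add: J'_def)
  have J': "0 \<in> J'" "s \<in> J'" "J \<subseteq> J'" "J' \<subseteq> {0..s}" using J s by (auto simp: J'_def)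
  define xs where "xs = sorted_list_of_set J'"
  have set_xs: "set xs = J'" and sorted_xs: "sorted xs"
    using fin by (simp_all add: xs_def)
  define t where "t i = (if i < length xs then xs ! i else s)" for i
  have t_in: "t i \<in> {0..s}" for i
  proof (cases "i < length xs")
    case True
    then have "xs ! i \<in> J'" using nth_mem[OF True] set_xs by simp
    then show ?thesis using True J'(4) by (auto simp: t_def)
  qed (use s in \<open>simp add: t_def\<close>)
  have ex: "\<exists>i<length xs. t i = x" if "x \<in> J'" for x
    using that set_xs in_set_conv_nth[of x xs] by (auto simp: t_def)
  have mono: "mono t"
  proof (rule monoI)
    fix i j :: nat assume ij: "i \<le> j"
    show "t i \<le> t j"
    proof (cases "j < length xs")
      case True
      then show ?thesis using ij sorted_nth_mono[OF sorted_xs ij True] by (simp add: t_def)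
    next
      case False
      then show ?thesis using t_in[of i] by (simp add: t_def)
    qed
  qed
  obtain j where j: "j < length xs" "t j = 0" using ex[OF J'(1)] by blast
  obtain k where k: "k < length xs" "t k = s" using ex[OF J'(2)] by blast
  let ?N = "length xs - 1"
  have "t 0 \<le> 0" using monoD[OF mono, of 0 j] j by simp
  then have "t 0 = 0" using t_in[of 0] by simp
  moreover have "s \<le> t ?N" using monoD[OF mono, of k ?N] k by simp
  then have "t ?N = s" using t_in[of ?N] by simp
  moreover have "J \<subseteq> t ` {..?N}"
  proof
    fix x assume "x \<in> J"
    then obtain i where "i < length xs" "t i = x" using ex J'(3) by blast
    then show "x \<in> t ` {..?N}" by (intro image_eqI[of _ _ i]) auto
  qed
  ultimately show ?thesis using mono by blast
qed

text \<open>The path properties hold for every point of the space, so that last zeros and infima can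
  be manipulated pathwise. \<open>regular_version\<close> provides such a process from the given
  one.\<close>

locale regular_process = prob_space M
  for M :: "'a measure" and X :: "real \<Rightarrow> 'a \<Rightarrow> real" +
  assumes rv: "\<And>t. 0 \<le> t \<Longrightarrow> X t \<in> borel_measurable M"
    and good: "\<And>\<omega>. \<omega> \<in> space M \<Longrightarrow> good_path (\<lambda>t. X t \<omega>)"
    and stationary:
      "\<And>s t. 0 \<le> s \<Longrightarrow> s \<le> t \<Longrightarrow>
         distr M borel (\<lambda>\<omega>. X t \<omega> - X s \<omega>) = distr M borel (X (t - s))"
    and independent:
      "\<And>(t :: nat \<Rightarrow> real) n. 0 \<le> t 0 \<Longrightarrow> mono t \<Longrightarrow>
         indep_vars (\<lambda>_. borel) (\<lambda>i \<omega>. X (t (Suc i)) \<omega> - X (t i) \<omega>) {..<n}"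
begin

lemma X0: "\<omega> \<in> space M \<Longrightarrow> X 0 \<omega> = 0"
  using good by (auto simp: good_path_def)

text \<open>The null sets are adjoined so that the augmented right-continuous filtration at every
  time before \<open>s\<close> is contained in \<open>past s\<close>.\<close>

definition past :: "real \<Rightarrow> 'a measure" where
  "past s = sigma (space M)
     ({X r -` B \<inter> space M | r B. 0 \<le> r \<and> r \<le> s \<and> B \<in> sets borel} \<union> null_sets M)"

definition rat_times :: "real set" where "rat_times = \<rat> \<inter> {0..}"

lemma times_nonneg: "q \<in> rat_times \<Longrightarrow> 0 \<le> q"
  by (simp add: rat_times_def)

abbreviation paths :: "(real \<Rightarrow> real) measure" where "paths \<equiv> PiM rat_times (\<lambda>_. borel)"

text \<open>Increments after \<open>s\<close>, sampled at rational times only: the path space is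
  then a countable product, on which infima and last zeros are measurable.\<close>

definition future :: "real \<Rightarrow> 'a \<Rightarrow> real \<Rightarrow> real" where
  "future s \<omega> = (\<lambda>q\<in>rat_times. X (s + q) \<omega> - X s \<omega>)"

lemma future_measurable [measurable]: "0 \<le> s \<Longrightarrow> future s \<in> measurable M paths"
  unfolding future_def using rv by (intro measurable_restrict borel_measurable_diff) (auto simp: rat_times_def)

lemma past_gen_subset:
  "{X r -` B \<inter> space M | r B. 0 \<le> r \<and> r \<le> s \<and> B \<in> sets borel} \<union> null_sets M \<subseteq> events"
  using rv by (auto intro: measurable_sets)

lemma space_past [simp]: "space (past s) = space M"
  unfolding past_def by (intro space_measure_of order_trans[OF past_gen_subset sets.space_closed])

lemma sets_past: "sets (past s) = sigma_sets (space M)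
   ({X r -` B \<inter> space M | r B. 0 \<le> r \<and> r \<le> s \<and> B \<in> sets borel} \<union> null_sets M)"
  unfolding past_def by (intro sets_measure_of order_trans[OF past_gen_subset sets.space_closed])

lemma sets_past_subset: "sets (past s) \<subseteq> events"
  unfolding sets_past by (rule sets.sigma_sets_subset) (rule past_gen_subset)

lemma subalgebra_past: "subalgebra M (past s)"
  using sets_past_subset by (auto simp: subalgebra_def)

lemma X_past: "0 \<le> r \<Longrightarrow> r \<le> s \<Longrightarrow> X r \<in> borel_measurable (past s)"
  by (rule measurableI) (auto simp: sets_past intro!: sigma_sets.Basic)

lemma increments_law:
  assumes s: "0 \<le> s" and q: "mono q" "q 0 = 0" and m: "0 < (m::nat)"
  shows "distr M (\<Pi>\<^sub>M k\<in>{..<m}. borel) (\<lambda>\<omega>. \<lambda>k\<in>{..<m}. X (s + q (Suc k)) \<omega> - X (s + q k) \<omega>) =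
    (\<Pi>\<^sub>M k\<in>{..<m}. distr M borel (X (q (Suc k) - q k)))"
proof -
  have q0: "0 \<le> q k" for k using q monoD[of q 0 k] by simp
  have iv: "indep_vars (\<lambda>_. borel) (\<lambda>k \<omega>. X (s + q (Suc k)) \<omega> - X (s + q k) \<omega>) {..<m}"
    by (rule independent) (use s q q0 in \<open>auto simp: mono_def\<close>)
  have "distr M (\<Pi>\<^sub>M k\<in>{..<m}. borel) (\<lambda>\<omega>. \<lambda>k\<in>{..<m}. X (s + q (Suc k)) \<omega> - X (s + q k) \<omega>) =
    (\<Pi>\<^sub>M k\<in>{..<m}. distr M borel (\<lambda>\<omega>. X (s + q (Suc k)) \<omega> - X (s + q k) \<omega>))"
    using iv by (subst indep_vars_iff_distr_eq_PiM'[symmetric])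
      (use m s q0 in \<open>auto intro!: borel_measurable_diff rv add_nonneg_nonneg\<close>)
  also have "\<dots> = (\<Pi>\<^sub>M k\<in>{..<m}. distr M borel (X (q (Suc k) - q k)))"
  proof (rule PiM_cong[OF refl])
    fix k
    show "distr M borel (\<lambda>\<omega>. X (s + q (Suc k)) \<omega> - X (s + q k) \<omega>) = distr M borel (X (q (Suc k) - q k))"
      using stationary[of "s + q k" "s + q (Suc k)"] s q0[of k] monoD[OF q(1), of k "Suc k"] by simp
  qed
  finally show ?thesis .
qed

lemma X_telescope:
  "(\<Sum>j<k. X (s + q (Suc j)) \<omega> - X (s + q j) \<omega>) = X (s + q k) \<omega> - X (s + q 0) \<omega>"
  by (rule sum_lessThan_telescope)

text \<open>The event is the preimage, under the vector of increments along \<open>q\<close>, of a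
  set that does not depend on \<open>s\<close>; by stationarity neither does the law of that vector.
  Comparing with \<open>s = 0\<close> gives the claim.\<close>

lemma finite_future_law:
  assumes s: "0 \<le> s" and K: "finite K" "K \<subseteq> {0..}" and C: "\<And>q. q \<in> K \<Longrightarrow> C q \<in> sets borel"
  shows "prob {\<omega>\<in>space M. \<forall>q\<in>K. X (s + q) \<omega> - X s \<omega> \<in> C q} = prob {\<omega>\<in>space M. \<forall>q\<in>K. X q \<omega> \<in> C q}"
proof -
  define v where "v = Max (insert 0 K)"
  have v: "0 \<le> v" "K \<subseteq> {0..v}" using K by (auto simp: v_def)
  from finite_subset_mono_sequence[OF K(1) v(2,1)] obtain q :: "nat \<Rightarrow> real" and N
    where q: "mono q" "q 0 = 0" "q N = v" "K \<subseteq> q ` {..N}" by blast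
  let ?m = "Suc N"
  let ?P = "\<Pi>\<^sub>M k\<in>{..<?m}. (borel :: real measure)"
  let ?S = "{x\<in>space ?P. \<forall>i\<in>{..N}. q i \<in> K \<longrightarrow> (\<Sum>j<i. x j) \<in> C (q i)}"
  have S: "?S \<in> sets ?P"
  proof (rule sets.sets_Collect_finite_All')
    fix i assume i: "i \<in> {..N}"
    have "(\<lambda>x. \<Sum>j<i. x j) \<in> borel_measurable ?P"
      using i by (intro borel_measurable_sum measurable_component_singleton) auto
    then show "{x \<in> space ?P. q i \<in> K \<longrightarrow> (\<Sum>j<i. x j) \<in> C (q i)} \<in> sets ?P"
      using C[of "q i"] by (cases "q i \<in> K") auto
  qed auto
  have E: "prob {\<omega>\<in>space M. \<forall>q\<in>K. X (s + q) \<omega> - X s \<omega> \<in> C q} =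
      measure (\<Pi>\<^sub>M k\<in>{..<?m}. distr M borel (X (q (Suc k) - q k))) ?S" if s: "0 \<le> s" for s
  proof -
    have q0: "0 \<le> q k" for k using q monoD[of q 0 k] by simp
    let ?D = "\<lambda>\<omega>. \<lambda>k\<in>{..<?m}. X (s + q (Suc k)) \<omega> - X (s + q k) \<omega>"
    have D: "?D \<in> measurable M ?P"
      by (intro measurable_restrict borel_measurable_diff rv add_nonneg_nonneg s q0)
    have "{\<omega>\<in>space M. \<forall>q\<in>K. X (s + q) \<omega> - X s \<omega> \<in> C q} = ?D -` ?S \<inter> space M"
    proof -
      have "(\<Sum>j<i. ?D \<omega> j) = X (s + q i) \<omega> - X s \<omega>" if "i \<le> N" for i \<omega>
      proof -
        have "(\<Sum>j<i. ?D \<omega> j) = (\<Sum>j<i. X (s + q (Suc j)) \<omega> - X (s + q j) \<omega>)"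
          using that by (intro sum.cong) auto
        also have "\<dots> = X (s + q i) \<omega> - X s \<omega>" using X_telescope[where s = s and q = q and k = i and \<omega> = \<omega>] q(2) by simp
        finally show ?thesis .
      qed
      then show ?thesis using q(4) measurable_space[OF D] by auto
    qed
    then have "prob {\<omega>\<in>space M. \<forall>q\<in>K. X (s + q) \<omega> - X s \<omega> \<in> C q} = measure (distr M ?P ?D) ?S"
      using S D by (simp add: measure_distr)
    then show ?thesis using increments_law[OF s q(1,2), of ?m] by simp
  qed
  have "prob {\<omega>\<in>space M. \<forall>q\<in>K. X (0 + q) \<omega> - X 0 \<omega> \<in> C q} = prob {\<omega>\<in>space M. \<forall>q\<in>K. X q \<omega> \<in> C q}"
    by (rule arg_cong[where f = prob]) (auto simp: X0)
  then show ?thesis using E[OF s] E[of 0] by simp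
qed

lemma future_law:
  assumes s: "0 \<le> s"
  shows "distr M paths (future s) = distr M paths (future 0)"
proof (rule measure_eqI_PiM_infinite)
  fix A :: "real \<Rightarrow> real set" and J
  assume J: "finite J" "J \<subseteq> rat_times" and A: "\<And>i. i \<in> J \<Longrightarrow> A i \<in> sets borel"
  have E: "emeasure (distr M paths (future s)) (prod_emb rat_times (\<lambda>_. borel) J (Pi\<^sub>E J A)) =
     prob {\<omega>\<in>space M. \<forall>q\<in>J. X q \<omega> \<in> A q}" if s: "0 \<le> s" for s
  proof -
    have "emeasure (distr M paths (future s)) (prod_emb rat_times (\<lambda>_. borel) J (Pi\<^sub>E J A)) =
      emeasure M (future s -` (prod_emb rat_times (\<lambda>_. borel) J (Pi\<^sub>E J A)) \<inter> space M)"
      using A J s by (intro emeasure_distr sets_PiM_I) auto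
    also have "future s -` (prod_emb rat_times (\<lambda>_. borel) J (Pi\<^sub>E J A)) \<inter> space M =
        {\<omega>\<in>space M. \<forall>q\<in>J. X (s + q) \<omega> - X s \<omega> \<in> A q}"
      using J unfolding prod_emb_def by (auto simp: future_def space_PiM PiE_iff extensional_def Pi_iff subset_eq)
    also have "emeasure M \<dots> = prob {\<omega>\<in>space M. \<forall>q\<in>J. X q \<omega> \<in> A q}"
      using finite_future_law[OF s J(1), of A] J A by (auto simp: emeasure_eq_measure rat_times_def)
    finally show ?thesis .
  qed
  show "emeasure (distr M paths (future s)) (prod_emb rat_times (\<lambda>_. borel) J (Pi\<^sub>E J A)) =
    emeasure (distr M paths (future 0)) (prod_emb rat_times (\<lambda>_. borel) J (Pi\<^sub>E J A))"
    using E[OF s] E[of 0] by simp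
next
  show "finite_measure (distr M paths (future s))"
    using s by (intro prob_space.finite_measure prob_space_distr) simp
qed simp_all

lemma finite_past_future_indep:
  assumes s: "0 \<le> s" and J: "finite J" "J \<subseteq> {0..s}" and B: "\<And>q. q \<in> J \<Longrightarrow> B q \<in> sets borel"
    and K: "finite K" "K \<subseteq> {0..}" and C: "\<And>q. q \<in> K \<Longrightarrow> C q \<in> sets borel"
  shows "prob ({\<omega>\<in>space M. \<forall>r\<in>J. X r \<omega> \<in> B r} \<inter> {\<omega>\<in>space M. \<forall>q\<in>K. X (s + q) \<omega> - X s \<omega> \<in> C q}) =
    prob {\<omega>\<in>space M. \<forall>r\<in>J. X r \<omega> \<in> B r} * prob {\<omega>\<in>space M. \<forall>q\<in>K. X (s + q) \<omega> - X s \<omega> \<in> C q}"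
proof -
  define v where "v = Max (insert 0 K)"
  have v: "0 \<le> v" "K \<subseteq> {0..v}" using K by (auto simp: v_def)
  from finite_subset_mono_sequence[OF K(1) v(2,1)] obtain q :: "nat \<Rightarrow> real" and m
    where q: "mono q" "q 0 = 0" "q m = v" "K \<subseteq> q ` {..m}" by blast
  from finite_subset_mono_sequence[OF J s] obtain t :: "nat \<Rightarrow> real" and N
    where t: "mono t" "t 0 = 0" "t N = s" "J \<subseteq> t ` {..N}" by blast
  have q0: "0 \<le> q k" for k using q monoD[of q 0 k] by simp
  have t0: "0 \<le> t k" for k using t monoD[of t 0 k] by simp
  \<comment> \<open>The grids for the past and for the future are glued at index \<open>N\<close>,
    where \<open>t N = s\<close> and \<open>s + q 0 = s\<close> agree. Increments with index below
    \<open>N\<close> then generate the past events, the others the future events.\<close>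
  define w where "w i = (if i \<le> N then t i else s + q (i - N))" for i
  have w: "w i = t i" if "i \<le> N" for i using that by (simp add: w_def)
  have w': "w (N + i) = s + q i" for i using t(3) q(2) by (cases "i = 0") (auto simp: w_def)
  have w0: "0 \<le> w i" for i using t0 q0 s by (auto simp: w_def)
  have "mono w"
  proof (rule monoI)
    fix i j :: nat assume ij: "i \<le> j"
    show "w i \<le> w j"
    proof (cases "j \<le> N")
      case True
      then show ?thesis using ij t(1) by (auto simp: w_def mono_def)
    next
      case False
      have "t i \<le> s" if "i \<le> N" using monoD[OF t(1) that] t(3) by simp
      then show ?thesis using False ij q(1) q0[of "j - N"] by (auto simp: w_def mono_def intro: diff_le_mono order_trans)
    qed
  qed
  let ?D = "\<lambda>i \<omega>. X (w (Suc i)) \<omega> - X (w i) \<omega>"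
  let ?A1 = "{..<N}" and ?A2 = "{N..<N + m}"
  let ?P1 = "\<Pi>\<^sub>M k\<in>?A1. (borel :: real measure)" and ?P2 = "\<Pi>\<^sub>M k\<in>?A2. (borel :: real measure)"
  let ?R1 = "\<lambda>\<omega>. restrict (\<lambda>i. ?D i \<omega>) ?A1" and ?R2 = "\<lambda>\<omega>. restrict (\<lambda>i. ?D i \<omega>) ?A2"
  have "indep_vars (\<lambda>_. borel) ?D {..<N + m}"
    by (rule independent) (use t \<open>mono w\<close> w0 in auto)
  then have iv: "indep_var ?P1 ?R1 ?P2 ?R2"
    by (rule indep_var_restrict) auto
  then have R: "?R1 \<in> measurable M ?P1" "?R2 \<in> measurable M ?P2"
    by (auto simp: indep_var_eq)
  let ?S1 = "{x\<in>space ?P1. \<forall>i\<in>{..N}. t i \<in> J \<longrightarrow> (\<Sum>j<i. x j) \<in> B (t i)}"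
  let ?S2 = "{x\<in>space ?P2. \<forall>i\<in>{..m}. q i \<in> K \<longrightarrow> (\<Sum>j<i. x (N + j)) \<in> C (q i)}"
  have S1: "?S1 \<in> sets ?P1"
  proof (rule sets.sets_Collect_finite_All')
    fix i assume i: "i \<in> {..N}"
    have "(\<lambda>x. \<Sum>j<i. x j) \<in> borel_measurable ?P1"
      using i by (intro borel_measurable_sum measurable_component_singleton) auto
    then show "{x \<in> space ?P1. t i \<in> J \<longrightarrow> (\<Sum>j<i. x j) \<in> B (t i)} \<in> sets ?P1"
      using B[of "t i"] by (cases "t i \<in> J") auto
  qed auto
  have S2: "?S2 \<in> sets ?P2"
  proof (rule sets.sets_Collect_finite_All')
    fix i assume i: "i \<in> {..m}"
    have "(\<lambda>x. \<Sum>j<i. x (N + j)) \<in> borel_measurable ?P2"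
      using i by (intro borel_measurable_sum measurable_component_singleton) auto
    then show "{x \<in> space ?P2. q i \<in> K \<longrightarrow> (\<Sum>j<i. x (N + j)) \<in> C (q i)} \<in> sets ?P2"
      using C[of "q i"] by (cases "q i \<in> K") auto
  qed auto
  have E1: "{\<omega>\<in>space M. \<forall>r\<in>J. X r \<omega> \<in> B r} = ?R1 -` ?S1 \<inter> space M"
  proof -
    have "(\<Sum>j<i. ?R1 \<omega> j) = X (t i) \<omega>" if "i \<le> N" "\<omega> \<in> space M" for i \<omega>
    proof -
      have "(\<Sum>j<i. ?R1 \<omega> j) = (\<Sum>j<i. X (t (Suc j)) \<omega> - X (t j) \<omega>)"
        using that by (intro sum.cong) (auto simp: w)
      also have "\<dots> = X (t i) \<omega>" using that by (subst sum_lessThan_telescope) (simp add: t X0)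
      finally show ?thesis .
    qed
    then show ?thesis using t(4) measurable_space[OF R(1)] by auto
  qed
  have E2: "{\<omega>\<in>space M. \<forall>q\<in>K. X (s + q) \<omega> - X s \<omega> \<in> C q} = ?R2 -` ?S2 \<inter> space M"
  proof -
    have "(\<Sum>j<i. ?R2 \<omega> (N + j)) = X (s + q i) \<omega> - X s \<omega>" if "i \<le> m" for i \<omega>
    proof -
      have "(\<Sum>j<i. ?R2 \<omega> (N + j)) = (\<Sum>j<i. X (s + q (Suc j)) \<omega> - X (s + q j) \<omega>)"
        using that w' by (intro sum.cong) (auto simp flip: add_Suc_right)
      also have "\<dots> = X (s + q i) \<omega> - X s \<omega>" using X_telescope[where s = s and q = q and k = i and \<omega> = \<omega>] q(2) by simp
      finally show ?thesis .
    qed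
    then show ?thesis using q(4) measurable_space[OF R(2)] by auto
  qed
  have "prob ((\<lambda>x. (?R1 x, ?R2 x)) -` (?S1 \<times> ?S2) \<inter> space M) =
    prob (?R1 -` ?S1 \<inter> space M) * prob (?R2 -` ?S2 \<inter> space M)"
    by (rule indep_varD[OF iv S1 S2])
  also have "(\<lambda>x. (?R1 x, ?R2 x)) -` (?S1 \<times> ?S2) \<inter> space M = (?R1 -` ?S1 \<inter> space M) \<inter> (?R2 -` ?S2 \<inter> space M)"
    by blast
  finally show ?thesis unfolding E1 E2 .
qed

text \<open>Independence extends from intersection-stable generators. The null sets in
  \<open>past s\<close> are not cylinder events, so the generator \<open>G\<close> consists of the
  events that differ from a cylinder \<open>a0\<close> by a null set; it is still stable under
  intersection, and probabilities may be computed with \<open>a0\<close>.\<close>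

lemma past_future_indep:
  assumes s: "0 \<le> s"
  shows "indep_set (sets (past s)) {future s -` B \<inter> space M | B. B \<in> sets paths}"
proof -
  define R where "R = {{\<omega>\<in>space M. \<forall>r\<in>J. X r \<omega> \<in> B r} | J B.
    finite J \<and> J \<subseteq> {0..s} \<and> (\<forall>r. B r \<in> sets (borel :: real measure))}"
  define G where "G = {A\<in>events. \<exists>A0\<in>R. (A - A0) \<union> (A0 - A) \<in> null_sets M}"
  define E where "E = {{\<omega>\<in>space M. \<forall>q\<in>K. X (s + q) \<omega> - X s \<omega> \<in> C q} | K C.
    finite K \<and> K \<subseteq> rat_times \<and> (\<forall>r. C r \<in> sets (borel :: real measure))}"
  have RI: "a \<inter> b \<in> R" if ab: "a \<in> R" "b \<in> R" for a b
  proof -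
    obtain J B J' B' where *: "a = {\<omega>\<in>space M. \<forall>r\<in>J. X r \<omega> \<in> B r}" "finite J" "J \<subseteq> {0..s}" "\<forall>r. B r \<in> sets borel"
       "b = {\<omega>\<in>space M. \<forall>r\<in>J'. X r \<omega> \<in> B' r}" "finite J'" "J' \<subseteq> {0..s}" "\<forall>r. B' r \<in> sets borel"
      using ab unfolding R_def mem_Collect_eq by (elim exE conjE) (rule that)
    show ?thesis unfolding R_def
    proof (intro CollectI exI[of _ "J \<union> J'"] exI[of _ "\<lambda>r. (if r \<in> J then B r else UNIV) \<inter> (if r \<in> J' then B' r else UNIV)"] conjI)
      show "a \<inter> b = {\<omega>\<in>space M. \<forall>r\<in>J \<union> J'. X r \<omega> \<in> (if r \<in> J then B r else UNIV) \<inter> (if r \<in> J' then B' r else UNIV)}"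
        unfolding *(1) *(5) by (simp only: Un_iff Int_iff set_eq_iff mem_Collect_eq ball_Un) auto
    qed (use * in simp_all)
  qed
  have EI: "a \<inter> b \<in> E" if ab: "a \<in> E" "b \<in> E" for a b
  proof -
    obtain J B J' B' where *: "a = {\<omega>\<in>space M. \<forall>r\<in>J. X (s + r) \<omega> - X s \<omega> \<in> B r}" "finite J" "J \<subseteq> rat_times" "\<forall>r. B r \<in> sets borel"
       "b = {\<omega>\<in>space M. \<forall>r\<in>J'. X (s + r) \<omega> - X s \<omega> \<in> B' r}" "finite J'" "J' \<subseteq> rat_times" "\<forall>r. B' r \<in> sets borel"
      using ab unfolding E_def mem_Collect_eq by (elim exE conjE) (rule that)
    show ?thesis unfolding E_def
    proof (intro CollectI exI[of _ "J \<union> J'"] exI[of _ "\<lambda>r. (if r \<in> J then B r else UNIV) \<inter> (if r \<in> J' then B' r else UNIV)"] conjI)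
      show "a \<inter> b = {\<omega>\<in>space M. \<forall>r\<in>J \<union> J'. X (s + r) \<omega> - X s \<omega> \<in> (if r \<in> J then B r else UNIV) \<inter> (if r \<in> J' then B' r else UNIV)}"
        unfolding *(1) *(5) by (simp only: Un_iff Int_iff set_eq_iff mem_Collect_eq ball_Un) auto
    qed (use * in simp_all)
  qed
  have Rev: "a \<in> events" if aR: "a \<in> R" for a
  proof -
    obtain J B where *: "a = {\<omega>\<in>space M. \<forall>r\<in>J. X r \<omega> \<in> B r}" "finite J" "J \<subseteq> {0..s}" "\<forall>r. B r \<in> sets borel"
      using aR unfolding R_def mem_Collect_eq by (elim exE conjE) (rule that)
    have "{\<omega>\<in>space M. X r \<omega> \<in> B r} \<in> events" if "r \<in> J" for r
      using measurable_sets[OF rv, of r "B r"] * that by (auto simp: vimage_def Int_def conj_commute)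
    then show ?thesis unfolding *(1) by (rule sets.sets_Collect_finite_All[OF _ *(2)])
  qed
  have Eev: "a \<in> events" if aE: "a \<in> E" for a
  proof -
    obtain J B where *: "a = {\<omega>\<in>space M. \<forall>r\<in>J. X (s + r) \<omega> - X s \<omega> \<in> B r}" "finite J" "J \<subseteq> rat_times" "\<forall>r. B r \<in> sets borel"
      using aE unfolding E_def mem_Collect_eq by (elim exE conjE) (rule that)
    have "{\<omega>\<in>space M. X (s + r) \<omega> - X s \<omega> \<in> B r} \<in> events" if "r \<in> J" for r
      using measurable_sets[OF borel_measurable_diff[OF rv rv], of "s + r" s "B r"] s * that times_nonneg[of r]
      by (auto simp: vimage_def Int_def conj_commute)
    then show ?thesis unfolding *(1) by (rule sets.sets_Collect_finite_All[OF _ *(2)])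
  qed
  have GE: "indep_set G E"
  proof (rule indep_setI)
    fix a b assume ab: "a \<in> G" "b \<in> E"
    then obtain a0 where a0: "a0 \<in> R" "(a - a0) \<union> (a0 - a) \<in> null_sets M" "a \<in> events"
      unfolding G_def by blast
    have AE: "AE x in M. x \<in> a \<longleftrightarrow> x \<in> a0"
      using AE_not_in[OF a0(2)] by eventually_elim auto
    have "prob (a \<inter> b) = prob (a0 \<inter> b)"
      using AE a0 Rev Eev[OF ab(2)] by (intro finite_measure_eq_AE) auto
    also have "\<dots> = prob a0 * prob b"
    proof -
      obtain J B where 1: "a0 = {\<omega>\<in>space M. \<forall>r\<in>J. X r \<omega> \<in> B r}" "finite J" "J \<subseteq> {0..s}" "\<forall>r. B r \<in> sets borel"
        using a0(1) unfolding R_def mem_Collect_eq by (elim exE conjE) (rule that)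
      obtain K C where 2: "b = {\<omega>\<in>space M. \<forall>r\<in>K. X (s + r) \<omega> - X s \<omega> \<in> C r}" "finite K" "K \<subseteq> rat_times" "\<forall>r. C r \<in> sets borel"
        using ab(2) unfolding E_def mem_Collect_eq by (elim exE conjE) (rule that)
      have "K \<subseteq> {0..}" using 2(3) times_nonneg by auto
      then show ?thesis unfolding 1(1) 2(1)
        by (intro finite_past_future_indep[OF s 1(2,3) _ 2(2)]) (use 1 2 in simp_all)
    qed
    also have "prob a0 = prob a"
      using AE a0 Rev by (intro finite_measure_eq_AE) auto
    finally show "prob (a \<inter> b) = prob a * prob b" .
  next
    show "G \<subseteq> events" by (auto simp: G_def)
    show "E \<subseteq> events" using Eev by blast
  qed
  have RG: "R \<subseteq> G"
  proof
    fix a assume a: "a \<in> R"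
    show "a \<in> G" unfolding G_def mem_Collect_eq using Rev[OF a] by (intro conjI bexI[OF _ a]) simp_all
  qed
  have I: "indep_set (sigma_sets (space M) G) (sigma_sets (space M) E)"
  proof (rule indep_set_sigma_sets[OF GE])
    show "Int_stable E" using EI by (auto simp: Int_stable_def)
    show "Int_stable G"
    proof (rule Int_stableI)
      fix a b assume "a \<in> G" "b \<in> G"
      then obtain a0 b0 where *: "a0 \<in> R" "(a - a0) \<union> (a0 - a) \<in> null_sets M" "a \<in> events"
        "b0 \<in> R" "(b - b0) \<union> (b0 - b) \<in> null_sets M" "b \<in> events"
        unfolding G_def by blast
      have "((a \<inter> b) - (a0 \<inter> b0)) \<union> ((a0 \<inter> b0) - (a \<inter> b)) \<in> null_sets M"
        by (rule null_sets_subset[OF null_sets.Un[OF *(2,5)]]) (use * Rev in auto)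
      then show "a \<inter> b \<in> G" using * RI[OF *(1,4)] by (auto simp: G_def)
    qed
  qed
  have sG: "sets (past s) \<subseteq> sigma_sets (space M) G"
    unfolding sets_past
  proof (rule sigma_sets_mono')
    have 1: "X r -` B \<inter> space M \<in> R" if "0 \<le> r" "r \<le> s" "B \<in> sets borel" for r B
      unfolding R_def by (intro CollectI exI[of _ "{r}"] exI[of _ "\<lambda>_. B"] conjI) (use that in \<open>simp_all add: vimage_def Int_def conj_commute\<close>)
    have "{} \<in> R" using 1[of 0 "{}"] s by simp
    then have 2: "N \<in> G" if "N \<in> null_sets M" for N
      unfolding G_def mem_Collect_eq using that \<open>{} \<in> R\<close> by (intro conjI bexI[of _ "{}"]) (simp_all add: null_setsD2)
    show "{X r -` B \<inter> space M |r B. 0 \<le> r \<and> r \<le> s \<and> B \<in> sets borel} \<union> null_sets M \<subseteq> G"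
      using 1 2 RG by blast
  qed
  have sE: "{future s -` B \<inter> space M | B. B \<in> sets paths} \<subseteq> sigma_sets (space M) E"
  proof -
    have Epow: "E \<subseteq> Pow (space M)" by (auto simp: E_def)
    have "future s \<in> measurable (sigma (space M) E) paths"
      unfolding future_def
    proof (rule measurable_restrict)
      fix q assume q: "q \<in> rat_times"
      show "(\<lambda>\<omega>. X (s + q) \<omega> - X s \<omega>) \<in> measurable (sigma (space M) E) borel"
      proof (rule measurableI)
        fix B :: "real set" assume B: "B \<in> sets borel"
        have "(\<lambda>\<omega>. X (s + q) \<omega> - X s \<omega>) -` B \<inter> space M \<in> E"
          unfolding E_def by (intro CollectI exI[of _ "{q}"] exI[of _ "\<lambda>_. B"] conjI) (use q B in \<open>simp_all add: vimage_def Int_def conj_commute\<close>)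
        then show "(\<lambda>\<omega>. X (s + q) \<omega> - X s \<omega>) -` B \<inter> space (sigma (space M) E) \<in> sets (sigma (space M) E)"
          using Epow by (simp add: space_measure_of sets_measure_of)
      qed simp
    qed
    note m = measurable_sets[OF this, unfolded space_measure_of[OF Epow] sets_measure_of[OF Epow]]
    show ?thesis
    proof
      fix a assume "a \<in> {future s -` B \<inter> space M | B. B \<in> sets paths}"
      then obtain B where "a = future s -` B \<inter> space M" "B \<in> sets paths"
        unfolding mem_Collect_eq by (elim exE conjE) (rule that)
      then show "a \<in> sigma_sets (space M) E" using m[of B] by simp
    qed
  qed
  show ?thesis
  proof (rule indep_setI)
    show "sets (past s) \<subseteq> events" by (rule sets_past_subset)
    show "{future s -` B \<inter> space M | B. B \<in> sets paths} \<subseteq> events"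
      by (rule order_trans[OF sE sets.sigma_sets_subset]) (use Eev in auto)
    fix a b assume "a \<in> sets (past s)" "b \<in> {future s -` B \<inter> space M | B. B \<in> sets paths}"
    then show "prob (a \<inter> b) = prob a * prob b"
      by (rule indep_setD[OF I subsetD[OF sG] subsetD[OF sE]])
  qed
qed

lemma markov_prob:
  assumes s: "0 \<le> s" and A: "A \<in> sets (past s)" and B: "B \<in> sets paths"
  shows "prob (A \<inter> {\<omega>\<in>space M. future s \<omega> \<in> B}) = prob A * prob {\<omega>\<in>space M. future 0 \<omega> \<in> B}"
proof -
  have eq: "{\<omega>\<in>space M. future s \<omega> \<in> B} = future s -` B \<inter> space M" for s by auto
  have "prob (A \<inter> (future s -` B \<inter> space M)) = prob A * prob (future s -` B \<inter> space M)"
    by (rule indep_setD[OF past_future_indep[OF s] A]) (use B in blast)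
  also have "prob (future s -` B \<inter> space M) = measure (distr M paths (future s)) B"
    using B s by (simp add: measure_distr)
  also have "\<dots> = prob (future 0 -` B \<inter> space M)"
    unfolding future_law[OF s] using B by (simp add: measure_distr)
  finally show ?thesis unfolding eq .
qed

lemma id_past: "(\<lambda>\<omega>. \<omega>) \<in> measurable M (past s)"
  by (rule measurable_from_subalg[OF subalgebra_past measurable_ident[unfolded id_def]])

text \<open>By \<open>markov_prob\<close>, the identity on \<open>past s\<close> and
  \<open>future s\<close> have as joint law the product of \<open>M\<close> restricted to
  \<open>past s\<close> with the law of \<open>future 0\<close>; Tonelli gives the iterated
  integral. Taking the identity as first coordinate lets \<open>H\<close> use anything known at time
  \<open>s\<close>.\<close>

lemma markov_nn_integral:
  assumes s: "0 \<le> s" and H: "H \<in> borel_measurable (past s \<Otimes>\<^sub>M paths)"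
  shows "(\<integral>\<^sup>+\<omega>. H (\<omega>, future s \<omega>) \<partial>M) = (\<integral>\<^sup>+\<omega>. (\<integral>\<^sup>+\<omega>'. H (\<omega>, future 0 \<omega>') \<partial>M) \<partial>M)"
proof -
  let ?Mp = "restr_to_subalg M (past s)" and ?Q = "distr M paths (future 0)"
  interpret Mp: prob_space ?Mp by (rule prob_space_restr_to_subalg[OF subalgebra_past]) unfold_locales
  interpret Q: prob_space ?Q by (rule prob_space_distr) simp
  have sMp: "sets ?Mp = sets (past s)" by (rule sets_restr_to_subalg[OF subalgebra_past])
  have sets: "sets (?Mp \<Otimes>\<^sub>M ?Q) = sets (past s \<Otimes>\<^sub>M paths)"
    by (rule sets_pair_measure_cong) (simp_all add: sMp)
  have meas: "(\<lambda>\<omega>. (\<omega>, future s \<omega>)) \<in> measurable M (past s \<Otimes>\<^sub>M paths)"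
    by (intro measurable_Pair id_past future_measurable s)
  have eq: "?Mp \<Otimes>\<^sub>M ?Q = distr M (past s \<Otimes>\<^sub>M paths) (\<lambda>\<omega>. (\<omega>, future s \<omega>))"
  proof (rule pair_measure_eqI)
    fix A B assume A: "A \<in> sets ?Mp" and B: "B \<in> sets ?Q"
    have A': "A \<in> sets (past s)" using A sMp by simp
    have Asub: "A \<subseteq> space M" using sets.sets_into_space[OF A'] by simp
    have "emeasure ?Mp A * emeasure ?Q B = ennreal (prob A) * ennreal (prob {\<omega>\<in>space M. future 0 \<omega> \<in> B})"
      using A' B by (simp add: emeasure_restr_to_subalg[OF subalgebra_past] emeasure_distr emeasure_eq_measure
          vimage_def Int_def conj_commute)
    also have "\<dots> = ennreal (prob (A \<inter> {\<omega>\<in>space M. future s \<omega> \<in> B}))"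
      using B markov_prob[OF s A', of B] by (simp add: ennreal_mult)
    also have "A \<inter> {\<omega>\<in>space M. future s \<omega> \<in> B} = (\<lambda>\<omega>. (\<omega>, future s \<omega>)) -` (A \<times> B) \<inter> space M"
      using Asub by auto
    also have "ennreal (prob \<dots>) = emeasure (distr M (past s \<Otimes>\<^sub>M paths) (\<lambda>\<omega>. (\<omega>, future s \<omega>))) (A \<times> B)"
      using A' B meas by (subst emeasure_distr) (auto simp: emeasure_eq_measure)
    finally show "emeasure ?Mp A * emeasure ?Q B = \<dots>" .
  next
    show "sets (?Mp \<Otimes>\<^sub>M ?Q) = sets (distr M (past s \<Otimes>\<^sub>M paths) (\<lambda>\<omega>. (\<omega>, future s \<omega>)))"
      unfolding sets_distr by (rule sets)
  qed (rule Mp.sigma_finite_measure_axioms Q.sigma_finite_measure_axioms)+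
  have H1: "(\<lambda>x. H (\<omega>, x)) \<in> borel_measurable paths" if "\<omega> \<in> space M" for \<omega>
    by (rule measurable_compose[OF measurable_Pair1' H]) (use that in simp)
  have H': "H \<in> borel_measurable (?Mp \<Otimes>\<^sub>M ?Q)"
    using H by (subst measurable_cong_sets[OF sets refl])
  have "(\<integral>\<^sup>+\<omega>. H (\<omega>, future s \<omega>) \<partial>M) = (\<integral>\<^sup>+x. H x \<partial>distr M (past s \<Otimes>\<^sub>M paths) (\<lambda>\<omega>. (\<omega>, future s \<omega>)))"
    by (subst nn_integral_distr[OF meas]) (simp_all add: H)
  also have "\<dots> = (\<integral>\<^sup>+x. H x \<partial>(?Mp \<Otimes>\<^sub>M ?Q))" by (simp add: eq)
  also have "\<dots> = (\<integral>\<^sup>+\<omega>. (\<integral>\<^sup>+x. H (\<omega>, x) \<partial>?Q) \<partial>?Mp)"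
    by (rule Q.nn_integral_fst[symmetric, OF H'])
  also have "\<dots> = (\<integral>\<^sup>+\<omega>. (\<integral>\<^sup>+x. H (\<omega>, x) \<partial>?Q) \<partial>M)"
  proof (rule nn_integral_subalgebra2[OF subalgebra_past])
    show "(\<lambda>\<omega>. \<integral>\<^sup>+x. H (\<omega>, x) \<partial>?Q) \<in> borel_measurable (past s)"
      using Q.borel_measurable_nn_integral_fst[OF H'] by (subst (asm) measurable_cong_sets[OF sMp refl])
  qed
  also have "\<dots> = (\<integral>\<^sup>+\<omega>. (\<integral>\<^sup>+\<omega>'. H (\<omega>, future 0 \<omega>') \<partial>M) \<partial>M)"
  proof (rule nn_integral_cong)
    fix \<omega> assume w: "\<omega> \<in> space M"
    show "(\<integral>\<^sup>+x. H (\<omega>, x) \<partial>?Q) = (\<integral>\<^sup>+\<omega>'. H (\<omega>, future 0 \<omega>') \<partial>M)"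
      by (rule nn_integral_distr[OF future_measurable[OF order_refl]])
         (subst measurable_distr_eq1, rule H1[OF w])
  qed
  finally show ?thesis .
qed

section \<open>Passage over levels on dyadic grids, and exponential moments\<close>

lemma X_measurable [measurable]: "0 \<le> t \<Longrightarrow> X t \<in> borel_measurable M"
  by (rule rv)

lemma times_grid: "\<delta> \<in> rat_times \<Longrightarrow> \<delta> * real k / 2 ^ n \<in> rat_times"
  by (auto simp: rat_times_def intro!: Rats_divide Rats_mult Rats_power)

lemma future_0: "\<omega> \<in> space M \<Longrightarrow> q \<in> rat_times \<Longrightarrow> future 0 \<omega> q = X q \<omega>"
  by (simp add: future_def X0)

definition up :: "real \<Rightarrow> nat \<Rightarrow> real \<Rightarrow> 'a set" where
  "up \<delta> n x = {\<omega>\<in>space M. \<exists>k\<in>{..2^n}. x < X (\<delta> * real k / 2^n) \<omega>}"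

definition jump_up :: "real \<Rightarrow> nat \<Rightarrow> real \<Rightarrow> 'a set" where
  "jump_up \<delta> n \<epsilon> = {\<omega>\<in>space M. \<exists>k\<in>{..<2^n}. \<epsilon> < X (\<delta> * real (Suc k) / 2^n) \<omega> - X (\<delta> * real k / 2^n) \<omega>}"

lemma up_events [measurable]: "0 \<le> \<delta> \<Longrightarrow> up \<delta> n x \<in> events"
  unfolding up_def by (intro sets.sets_Collect_finite_Ex borel_measurable_less measurable_const rv) auto

lemma jump_up_events [measurable]: "0 \<le> \<delta> \<Longrightarrow> jump_up \<delta> n x \<in> events"
  unfolding jump_up_def
  by (intro sets.sets_Collect_finite_Ex borel_measurable_less measurable_const rv borel_measurable_diff) auto

lemma up_mono_n: "n \<le> m \<Longrightarrow> up \<delta> n x \<subseteq> up \<delta> m x"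
proof -
  assume nm: "n \<le> m"
  show ?thesis
  proof
    fix \<omega> assume "\<omega> \<in> up \<delta> n x"
    then obtain k where k: "\<omega> \<in> space M" "k \<le> 2^n" "x < X (\<delta> * real k / 2^n) \<omega>"
      by (auto simp: up_def)
    obtain j where j: "m = n + j" using nm le_Suc_ex by blast
    have e: "\<delta> * real (k * 2^j) / 2^m = \<delta> * real k / 2^n" by (simp add: j power_add)
    have "k * 2^j \<le> 2^m" using k by (simp add: j power_add)
    then show "\<omega> \<in> up \<delta> m x" unfolding up_def
      using k e by (auto intro!: bexI[of _ "k * 2^j"] simp del: of_nat_mult)
  qed
qed

text \<open>First passage over \<open>x\<close> on the grid, followed by the Markov property: off \<open>jump_up\<close> the
  overshoot over \<open>x\<close> is at most \<open>\<epsilon>\<close>. This yields both the exponential moments and the regularity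
  of the upper half-line.\<close>

lemma prob_up_step:
  assumes d: "\<delta> \<in> rat_times" and x: "0 \<le> x" "0 \<le> y" "0 \<le> \<epsilon>"
  shows "prob (up \<delta> n (x + y + \<epsilon>)) \<le> prob (jump_up \<delta> n \<epsilon>) + prob (up \<delta> n x) * prob (up \<delta> n y)"
proof -
  have d0: "0 \<le> \<delta>" using d by (simp add: rat_times_def)
  define t where "t k = \<delta> * real k / 2^n" for k
  have t0: "0 \<le> t k" for k using d0 by (simp add: t_def)
  have tt: "t k \<in> rat_times" for k unfolding t_def by (rule times_grid[OF d])
  have tadd: "t (k + j) = t k + t j" for k j by (simp add: t_def field_simps)
  have tm: "j \<le> k \<Longrightarrow> t j \<le> t k" for j k using d0 by (simp add: t_def divide_right_mono mult_left_mono)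
  \<comment> \<open>\<open>A k\<close> is first passage over \<open>x\<close> at grid index
    \<open>k\<close>; these events are disjoint and belong to the past of
    \<open>t k\<close>.\<close>
  define A where "A k = {\<omega>\<in>space M. (\<forall>j\<in>{..<k}. X (t j) \<omega> \<le> x) \<and> x < X (t k) \<omega>}" for k
  have A: "A k \<in> sets (past (t k))" for k
  proof -
    have [measurable]: "j \<le> k \<Longrightarrow> X (t j) \<in> borel_measurable (past (t k))" for j
      using t0 tm by (intro X_past) auto
    have "{\<omega>\<in>space (past (t k)). (\<forall>j\<in>{..<k}. X (t j) \<omega> \<le> x) \<and> x < X (t k) \<omega>} \<in> sets (past (t k))"
      by measurable
    then show ?thesis by (simp add: A_def)
  qed
  have Aev: "A k \<in> events" for k using A sets_past_subset by blast
  \<comment> \<open>After the first passage the path is granted all \<open>2 ^ n\<close> steps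
    instead of the remaining ones. This only enlarges the event and makes its probability
    independent of \<open>k\<close>.\<close>
  define B where "B = {z\<in>space paths. \<exists>j\<in>{..2^n}. y < z (t j)}"
  have B: "B \<in> sets paths"
    unfolding B_def by (intro sets.sets_Collect_finite_Ex borel_measurable_less measurable_const measurable_component_singleton tt) auto
  have fut: "{\<omega>\<in>space M. future (t k) \<omega> \<in> B} = {\<omega>\<in>space M. \<exists>j\<in>{..2^n}. y < X (t (k + j)) \<omega> - X (t k) \<omega>}" for k
    using measurable_space[OF future_measurable[OF t0[of k]]] tt by (auto simp: B_def future_def tadd)
  have fut0: "{\<omega>\<in>space M. future 0 \<omega> \<in> B} = up \<delta> n y"
    using measurable_space[OF future_measurable[of 0]] tt by (auto simp: B_def up_def future_0 t_def)
  have disj: "disjoint_family_on A {..2^n}"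
    unfolding disjoint_family_on_def
  proof (intro ballI impI)
    fix m k :: nat assume "m \<noteq> k"
    then show "A m \<inter> A k = {}"
      by (cases m k rule: linorder_cases) (force simp: A_def)+
  qed
  have sub: "up \<delta> n (x + y + \<epsilon>) \<subseteq> jump_up \<delta> n \<epsilon> \<union> (\<Union>k\<in>{..2^n}. A k \<inter> {\<omega>\<in>space M. future (t k) \<omega> \<in> B})" if "0 \<le> y + \<epsilon>"
  proof
    fix \<omega> assume w: "\<omega> \<in> up \<delta> n (x + y + \<epsilon>)"
    then obtain m where m: "\<omega> \<in> space M" "m \<le> 2^n" "x + y + \<epsilon> < X (t m) \<omega>" by (auto simp: up_def t_def)
    define k where "k = (LEAST k. x < X (t k) \<omega>)"
    have xm: "x < X (t m) \<omega>" using m that by linarith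
    have k: "x < X (t k) \<omega>" unfolding k_def by (rule LeastI[of "\<lambda>k. x < X (t k) \<omega>", OF xm])
    have km: "k \<le> m" unfolding k_def by (rule Least_le[of "\<lambda>k. x < X (t k) \<omega>", OF xm])
    have less: "X (t j) \<omega> \<le> x" if "j < k" for j using not_less_Least[OF that[unfolded k_def]] by simp
    \<comment> \<open>The first passage cannot happen at index 0, where the path is 0. Hence there
      is a preceding grid point with value at most \<open>x\<close>, and the overshoot is bounded by
      one increment.\<close>
    have "k \<noteq> 0" using k X0[OF m(1)] x by (intro notI) (simp add: t_def)
    then obtain k' where k': "k = Suc k'" using not0_implies_Suc by blast
    show "\<omega> \<in> jump_up \<delta> n \<epsilon> \<union> (\<Union>k\<in>{..2^n}. A k \<inter> {\<omega>\<in>space M. future (t k) \<omega> \<in> B})"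
    proof (cases "\<omega> \<in> jump_up \<delta> n \<epsilon>")
      case False
      have "k' < 2^n" using k' km m by simp
      then have "X (t k) \<omega> - X (t k') \<omega> \<le> \<epsilon>"
        using False m(1) unfolding k' jump_up_def t_def by (auto simp: not_less)
      then have "X (t k) \<omega> \<le> x + \<epsilon>" using less[of k'] k' by simp
      then have "y < X (t (k + (m - k))) \<omega> - X (t k) \<omega>" using m km by simp
      then have "\<omega> \<in> {\<omega>\<in>space M. future (t k) \<omega> \<in> B}"
        unfolding fut using m(1,2) by (intro CollectI conjI bexI[of _ "m - k"]) auto
      moreover have "\<omega> \<in> A k" using m(1) k less by (auto simp: A_def)
      ultimately show ?thesis using km m by (intro UnI2 UN_I[of k]) auto
    qed auto
  qed
    have fev: "{\<omega>\<in>space M. future (t k) \<omega> \<in> B} \<in> events" for k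
      using measurable_sets[OF future_measurable[OF t0[of k]] B] by (simp add: vimage_def Int_def conj_commute)
    have "prob (up \<delta> n (x + y + \<epsilon>)) \<le> prob (jump_up \<delta> n \<epsilon> \<union> (\<Union>k\<in>{..2^n}. A k \<inter> {\<omega>\<in>space M. future (t k) \<omega> \<in> B}))"
      using d0 Aev fev x by (intro finite_measure_mono sub) auto
    also have "\<dots> \<le> prob (jump_up \<delta> n \<epsilon>) + prob (\<Union>k\<in>{..2^n}. A k \<inter> {\<omega>\<in>space M. future (t k) \<omega> \<in> B})"
      using d0 Aev fev by (intro measure_Un_le) auto
    also have "prob (\<Union>k\<in>{..2^n}. A k \<inter> {\<omega>\<in>space M. future (t k) \<omega> \<in> B}) =
        (\<Sum>k\<in>{..2^n}. prob (A k \<inter> {\<omega>\<in>space M. future (t k) \<omega> \<in> B}))"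
    proof (rule finite_measure_finite_Union)
      show "disjoint_family_on (\<lambda>k. A k \<inter> {\<omega>\<in>space M. future (t k) \<omega> \<in> B}) {..2^n}"
        using disj unfolding disjoint_family_on_def by blast
    qed (use Aev fev in auto)
    also have "\<dots> = (\<Sum>k\<in>{..2^n}. prob (A k) * prob (up \<delta> n y))"
      using markov_prob[OF t0 A B] by (simp add: fut0)
    also have "\<dots> = prob (\<Union>k\<in>{..2^n}. A k) * prob (up \<delta> n y)"
      using Aev disj by (subst finite_measure_finite_Union) (auto simp: sum_distrib_right)
    also have "\<dots> \<le> prob (up \<delta> n x) * prob (up \<delta> n y)"
      using d0 by (intro mult_right_mono finite_measure_mono) (auto simp: A_def up_def t_def)
    finally show ?thesis by simp
qed

text \<open>On a fixed path, \<open>good_path_small_increments\<close> excludes rises above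
  \<open>\<epsilon>\<close> on all sufficiently fine grids. The events are not monotone in
  \<open>n\<close>, so they are enclosed in the decreasing unions \<open>?U n\<close>, whose
  intersection is empty.\<close>

lemma prob_jump_up_tendsto:
  assumes d: "0 < \<delta>" and e: "0 < \<epsilon>"
  shows "(\<lambda>n. prob (jump_up \<delta> n \<epsilon>)) \<longlonglongrightarrow> 0"
proof -
  let ?U = "\<lambda>n. \<Union>m\<in>{n..}. jump_up \<delta> m \<epsilon>"
  have ev: "jump_up \<delta> m \<epsilon> \<in> events" for m using d by (intro jump_up_events) simp
  have dec: "decseq ?U" by (intro decseq_SucI UN_mono) auto
  have "\<omega> \<notin> (\<Inter>n. ?U n)" for \<omega>
  proof
    assume w: "\<omega> \<in> (\<Inter>n. ?U n)"
    then have "\<omega> \<in> space M" by (auto simp: jump_up_def)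
    from good_path_small_increments[OF good[OF this] e, of \<delta>] obtain \<eta> where
      \<eta>: "\<eta> > 0" "\<And>r r'. 0 \<le> r \<and> r < r' \<and> r' < r + \<eta> \<and> r' \<le> \<delta> \<Longrightarrow> X r' \<omega> - X r \<omega> \<le> \<epsilon>" by blast
    obtain N :: nat where N: "\<delta> / \<eta> < 2 ^ N" using real_arch_pow[of 2 "\<delta> / \<eta>"] by auto
    from w obtain m where m: "m \<ge> N" "\<omega> \<in> jump_up \<delta> m \<epsilon>" by auto
    then obtain k where k: "k < 2 ^ m" "\<epsilon> < X (\<delta> * real (Suc k) / 2^m) \<omega> - X (\<delta> * real k / 2^m) \<omega>"
      by (auto simp: jump_up_def)
    have "2 ^ N \<le> (2::real) ^ m" using m by (intro power_increasing) auto
    then have "\<delta> / \<eta> < 2 ^ m" using N by linarith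
    then have 1: "\<delta> / 2 ^ m < \<eta>" using \<eta>(1) by (simp add: field_simps)
    have 2: "\<delta> * real (Suc k) / 2^m = \<delta> * real k / 2^m + \<delta> / 2^m" by (simp add: field_simps)
    have "real (Suc k) \<le> 2 ^ m" using k(1) by (metis Suc_leI of_nat_le_iff of_nat_numeral of_nat_power)
    then have "\<delta> * real (Suc k) \<le> \<delta> * 2 ^ m" using d by (intro mult_left_mono) auto
    then have 3: "\<delta> * real (Suc k) / 2^m \<le> \<delta>" by (simp add: divide_le_eq)
    have "X (\<delta> * real (Suc k) / 2^m) \<omega> - X (\<delta> * real k / 2^m) \<omega> \<le> \<epsilon>"
      using d 1 2 3 by (intro \<eta>(2) conjI) (simp_all del: of_nat_Suc)
    then show False using k(2) by simp
  qed
  then have "(\<Inter>n. ?U n) = {}" by blast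
  moreover have "(\<lambda>n. prob (?U n)) \<longlonglongrightarrow> prob (\<Inter>n. ?U n)"
    using ev dec by (intro finite_Lim_measure_decseq) auto
  ultimately have lim: "(\<lambda>n. prob (?U n)) \<longlonglongrightarrow> 0" by simp
  show ?thesis
  proof (rule tendsto_sandwich[OF _ _ tendsto_const lim])
    show "eventually (\<lambda>n. prob (jump_up \<delta> n \<epsilon>) \<le> prob (?U n)) sequentially"
      using ev by (intro always_eventually allI finite_measure_mono) auto
  qed simp
qed

text \<open>Since the endpoint \<open>\<delta>\<close> lies on every grid, right-continuity makes
  this the probability that the path exceeds \<open>x\<close> somewhere on
  \<open>{0..\<delta>}\<close>.\<close>

definition passage :: "real \<Rightarrow> real \<Rightarrow> real" where
  "passage \<delta> x = prob (\<Union>n. up \<delta> n x)"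

lemma up_tendsto_passage: "0 \<le> \<delta> \<Longrightarrow> (\<lambda>n. prob (up \<delta> n x)) \<longlonglongrightarrow> passage \<delta> x"
  unfolding passage_def
  by (rule finite_Lim_measure_incseq) (auto intro!: incseq_SucI up_mono_n)

text \<open>The term \<open>jump_up\<close> vanishes under refinement for each fixed gap
  \<open>\<epsilon> > 0\<close>. Iterated with unit gaps the bound gives geometric tails; with
  levels and gap tending to 0 it gives a zero-one law.\<close>

lemma passage_step:
  assumes d: "\<delta> \<in> rat_times" "0 < \<delta>" and x: "0 \<le> x" "0 \<le> y" "0 < \<epsilon>"
  shows "passage \<delta> (x + y + \<epsilon>) \<le> passage \<delta> x * passage \<delta> y"
proof (rule LIMSEQ_le)
  show "(\<lambda>n. prob (up \<delta> n (x + y + \<epsilon>))) \<longlonglongrightarrow> passage \<delta> (x + y + \<epsilon>)"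
    using d by (intro up_tendsto_passage) simp
  show "(\<lambda>n. prob (jump_up \<delta> n \<epsilon>) + prob (up \<delta> n x) * prob (up \<delta> n y)) \<longlonglongrightarrow> passage \<delta> x * passage \<delta> y"
  proof -
    have "(\<lambda>n. prob (jump_up \<delta> n \<epsilon>) + prob (up \<delta> n x) * prob (up \<delta> n y)) \<longlonglongrightarrow> 0 + passage \<delta> x * passage \<delta> y"
      using d x by (intro tendsto_add tendsto_mult up_tendsto_passage prob_jump_up_tendsto) simp_all
    then show ?thesis by simp
  qed
  show "\<exists>N. \<forall>n\<ge>N. prob (up \<delta> n (x + y + \<epsilon>)) \<le> prob (jump_up \<delta> n \<epsilon>) + prob (up \<delta> n x) * prob (up \<delta> n y)"
    using prob_up_step[OF d(1)] x by auto
qed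

lemma up_anti: "x \<le> y \<Longrightarrow> up \<delta> n y \<subseteq> up \<delta> n x"
  by (force simp: up_def)

lemma passage_right_continuous_0:
  assumes d: "0 \<le> \<delta>" and a: "a \<longlonglongrightarrow> 0" "\<And>n. 0 < a n" "decseq a"
  shows "(\<lambda>n. passage \<delta> (a n)) \<longlonglongrightarrow> passage \<delta> 0"
proof -
  have eq: "(\<Union>i. \<Union>n. up \<delta> n (a i)) = (\<Union>n. up \<delta> n 0)"
  proof (rule set_eqI, rule iffI)
    fix \<omega> assume "\<omega> \<in> (\<Union>i. \<Union>n. up \<delta> n (a i))"
    then obtain i n where i: "\<omega> \<in> up \<delta> n (a i)" by blast
    have "up \<delta> n (a i) \<subseteq> up \<delta> n 0" using a(2)[of i] by (intro up_anti) simp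
    then show "\<omega> \<in> (\<Union>n. up \<delta> n 0)" using i by blast
  next
    fix \<omega> assume "\<omega> \<in> (\<Union>n. up \<delta> n 0)"
    then obtain n k where *: "\<omega> \<in> space M" "k \<le> 2^n" "0 < X (\<delta> * real k / 2^n) \<omega>" by (auto simp: up_def)
    obtain i where "a i < X (\<delta> * real k / 2^n) \<omega>"
      using order_tendstoD(2)[OF a(1) *(3)] by (auto simp: eventually_sequentially)
    then have "\<omega> \<in> up \<delta> n (a i)" using * by (auto simp: up_def)
    then show "\<omega> \<in> (\<Union>i. \<Union>n. up \<delta> n (a i))" by blast
  qed
  have "(\<lambda>i. prob (\<Union>n. up \<delta> n (a i))) \<longlonglongrightarrow> prob (\<Union>i. \<Union>n. up \<delta> n (a i))"
  proof (rule finite_Lim_measure_incseq)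
    show "range (\<lambda>i. \<Union>n. up \<delta> n (a i)) \<subseteq> events" using d by auto
    show "incseq (\<lambda>i. \<Union>n. up \<delta> n (a i))"
      using a(3) by (intro incseq_SucI UN_mono up_anti) (auto simp: decseq_Suc_iff)
  qed
  then show ?thesis by (simp add: eq passage_def)
qed

lemma AE_increment_iff:
  assumes s: "0 \<le> s" "0 \<le> t" and P: "Measurable.pred borel P"
  shows "(AE \<omega> in M. P (X (s + t) \<omega> - X s \<omega>)) \<longleftrightarrow> (AE \<omega> in M. P (X t \<omega>))"
proof -
  have "(AE \<omega> in M. P (X (s + t) \<omega> - X s \<omega>)) \<longleftrightarrow> (AE x in distr M borel (\<lambda>\<omega>. X (s + t) \<omega> - X s \<omega>). P x)"
    using s P by (subst AE_distr_iff) (auto intro!: borel_measurable_diff rv simp: pred_def)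
  also have "\<dots> \<longleftrightarrow> (AE x in distr M borel (X t). P x)"
  proof -
    have "distr M borel (\<lambda>\<omega>. X (s + t) \<omega> - X s \<omega>) = distr M borel (X t)"
      using stationary[of s "s + t"] s by simp
    then show ?thesis by (simp only:)
  qed
  also have "\<dots> \<longleftrightarrow> (AE \<omega> in M. P (X t \<omega>))"
    using s P by (subst AE_distr_iff) (auto intro!: rv simp: pred_def)
  finally show ?thesis .
qed

text \<open>Otherwise stationarity would make all increments along the multiples of
  \<open>\<delta>\<close> nonpositive, against the drift to infinity.\<close>

lemma not_AE_nonpos:
  assumes d: "0 < \<delta>"
  shows "\<not> (AE \<omega> in M. X \<delta> \<omega> \<le> 0)"
proof
  assume "AE \<omega> in M. X \<delta> \<omega> \<le> 0"
  then have "AE \<omega> in M. X (\<delta> * real k + \<delta>) \<omega> - X (\<delta> * real k) \<omega> \<le> 0" for k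
    using d by (subst AE_increment_iff) auto
  then have "AE \<omega> in M. \<forall>k. X (\<delta> * real k + \<delta>) \<omega> - X (\<delta> * real k) \<omega> \<le> 0"
    by (simp add: AE_all_countable)
  then have "AE \<omega> in M. False"
  proof (rule AE_mp, intro AE_I2 impI)
    fix \<omega> assume w: "\<omega> \<in> space M" and k: "\<forall>k. X (\<delta> * real k + \<delta>) \<omega> - X (\<delta> * real k) \<omega> \<le> 0"
    have neg: "X (\<delta> * real k) \<omega> \<le> 0" for k
    proof (induction k)
      case (Suc k)
      have "X (\<delta> * real (Suc k)) \<omega> \<le> X (\<delta> * real k) \<omega>"
        using k[rule_format, of k] by (simp add: algebra_simps)
      then show ?case using Suc by simp
    qed (simp add: X0 w)
    have "filterlim (\<lambda>t. X t \<omega>) at_top at_top" using good[OF w] by (simp add: good_path_def)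
    moreover have "filterlim (\<lambda>k. \<delta> * real k) at_top sequentially"
      using d by (intro filterlim_tendsto_pos_mult_at_top[OF tendsto_const] filterlim_real_sequentially)
    ultimately have "filterlim (\<lambda>k. X (\<delta> * real k) \<omega>) at_top sequentially" by (rule filterlim_compose)
    then have "eventually (\<lambda>k. 0 < X (\<delta> * real k) \<omega>) sequentially" by (simp add: filterlim_at_top_dense)
    then obtain k where "0 < X (\<delta> * real k) \<omega>" by (auto simp: eventually_sequentially)
    then show False using neg[of k] by simp
  qed
  then show False by (simp add: AE_False)
qed

text \<open>In the limit of small levels \<open>passage_step\<close> yields
  \<open>p \<le> p * p\<close> for \<open>p = passage \<delta> 0\<close>, so \<open>p\<close> is 0
  or 1. The value 0 would force \<open>X \<delta> \<le> 0\<close> almost surely, since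
  \<open>\<delta>\<close> is a grid point.\<close>

lemma passage_0:
  assumes d: "\<delta> \<in> rat_times" "0 < \<delta>"
  shows "passage \<delta> 0 = 1"
proof -
  have 1: "passage \<delta> 0 \<le> passage \<delta> 0 * passage \<delta> 0"
  proof (rule LIMSEQ_le)
    have lim: "(\<lambda>n. c * inverse (real (Suc n))) \<longlonglongrightarrow> 0" for c
      using tendsto_mult[OF tendsto_const LIMSEQ_inverse_real_of_nat, of c] by simp
    have dec: "decseq (\<lambda>n. c * inverse (real (Suc n)))" if "0 < c" for c
      using that by (intro decseq_SucI mult_left_mono le_imp_inverse_le) auto
    have L: "(\<lambda>n. passage \<delta> (c * inverse (real (Suc n)))) \<longlonglongrightarrow> passage \<delta> 0" if "0 < c" for c
      using d that by (intro passage_right_continuous_0 lim dec) auto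
    \<comment> \<open>Two levels and one gap of equal size add up to the factor 3.\<close>
    show "(\<lambda>n. passage \<delta> (3 * inverse (real (Suc n)))) \<longlonglongrightarrow> passage \<delta> 0" by (rule L) simp
    show "(\<lambda>n. passage \<delta> (1 * inverse (real (Suc n))) * passage \<delta> (1 * inverse (real (Suc n)))) \<longlonglongrightarrow> passage \<delta> 0 * passage \<delta> 0"
      by (intro tendsto_mult L) simp_all
    have "passage \<delta> (3 * inverse (real (Suc n))) \<le> passage \<delta> (1 * inverse (real (Suc n))) * passage \<delta> (1 * inverse (real (Suc n)))" for n
      using passage_step[OF d, of "inverse (real (Suc n))" "inverse (real (Suc n))" "inverse (real (Suc n))"] by simp
    then show "\<exists>N. \<forall>n\<ge>N. passage \<delta> (3 * inverse (real (Suc n))) \<le> passage \<delta> (1 * inverse (real (Suc n))) * passage \<delta> (1 * inverse (real (Suc n)))"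
      by blast
  qed
  have 2: "0 \<le> passage \<delta> 0" "passage \<delta> 0 \<le> 1" by (simp_all add: passage_def)
  have "passage \<delta> 0 \<noteq> 0"
  proof
    assume "passage \<delta> 0 = 0"
    moreover have "prob (up \<delta> 0 0) \<le> passage \<delta> 0" unfolding passage_def
      using d by (intro finite_measure_mono sets.countable_UN) auto
    ultimately have "prob (up \<delta> 0 0) \<le> 0" by simp
    then have "AE \<omega> in M. \<omega> \<notin> up \<delta> 0 0" using d
      by (intro AE_not_in null_setsI) (simp_all add: emeasure_eq_measure measure_le_0_iff)
    then have "AE \<omega> in M. X \<delta> \<omega> \<le> 0"
    proof (rule AE_mp, intro AE_I2 impI)
      fix \<omega> assume "\<omega> \<in> space M" "\<omega> \<notin> up \<delta> 0 0"
      then show "X \<delta> \<omega> \<le> 0" by (auto simp: up_def not_less dest: bspec[where x = "1::nat"])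
    qed
    then show False using not_AE_nonpos[OF d(2)] by simp
  qed
  then show ?thesis using 1 2 by (metis antisym less_eq_real_def mult.right_neutral mult_less_cancel_left_pos not_less)
qed

text \<open>Right-continuity at 0 keeps each path below \<open>x\<close> on a short initial
  interval. Lengths are dyadic because a grid point of the halved interval is one of the next finer
  grid of the full interval, so the events decrease in \<open>m\<close>.\<close>

lemma passage_tendsto_0:
  assumes x: "0 < x"
  shows "(\<lambda>m. passage (1 / 2 ^ m) x) \<longlonglongrightarrow> 0"
proof -
  let ?U = "\<lambda>m. \<Union>n. up (1 / 2 ^ m) n x"
  have dec: "decseq ?U"
  proof (rule decseq_SucI, rule subsetI)
    fix m \<omega> assume "\<omega> \<in> ?U (Suc m)"
    then obtain n k where *: "\<omega> \<in> space M" "k \<le> 2^n" "x < X (1 / 2 ^ Suc m * real k / 2^n) \<omega>" by (auto simp: up_def)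
    have "1 / 2 ^ Suc m * real k / 2^n = 1 / 2 ^ m * real k / 2 ^ Suc n" by simp
    moreover have "k \<le> 2 ^ Suc n" using *(2) by simp
    ultimately have "\<omega> \<in> up (1 / 2 ^ m) (Suc n) x"
      unfolding up_def using * by (intro CollectI conjI bexI[of _ k]) (simp_all only: atMost_iff)
    then show "\<omega> \<in> ?U m" by blast
  qed
  have "\<omega> \<notin> (\<Inter>m. ?U m)" for \<omega>
  proof
    assume w: "\<omega> \<in> (\<Inter>m. ?U m)"
    then have sp: "\<omega> \<in> space M" by (auto simp: up_def)
    have "((\<lambda>t. X t \<omega>) \<longlongrightarrow> X 0 \<omega>) (at_right 0)" using good[OF sp] by (auto simp: good_path_def)
    then have "eventually (\<lambda>t. X t \<omega> < x) (at_right 0)" by (rule order_tendstoD(2)) (use X0[OF sp] x in simp)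
    then obtain b where b: "b > 0" "\<And>t. 0 < t \<Longrightarrow> t < b \<Longrightarrow> X t \<omega> < x"
      unfolding eventually_at_right_field by blast
    obtain m :: nat where m: "(1/2) ^ m < b" using real_arch_pow_inv[OF b(1), of "1/2"] by auto
    obtain n k where k: "k \<le> 2^n" "x < X (1 / 2 ^ m * real k / 2^n) \<omega>" 
    proof -
      have "\<omega> \<in> ?U m" using w by blast
      then show ?thesis using that unfolding up_def by blast
    qed
    have "real k \<le> 2 ^ n" using k(1) by (metis of_nat_le_iff of_nat_numeral of_nat_power)
    then have "1 / 2 ^ m * (real k / 2^n) \<le> 1 / 2 ^ m * 1" by (intro mult_left_mono) (auto simp: divide_le_eq)
    then have lb: "1 / 2 ^ m * real k / 2^n < b" using m by (simp add: power_divide)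
    show False
    proof (cases "k = 0")
      case True
      then show False using k(2) X0[OF sp] x by simp
    next
      case False
      then have "0 < 1 / 2 ^ m * real k / 2^n" by simp
      from b(2)[OF this lb] k(2) show False by simp
    qed
  qed
  then have "(\<Inter>m. ?U m) = {}" by blast
  moreover have "(\<lambda>m. prob (?U m)) \<longlonglongrightarrow> prob (\<Inter>m. ?U m)"
  proof (rule finite_Lim_measure_decseq[OF _ dec])
    show "range ?U \<subseteq> events" by (auto intro!: sets.countable_UN up_events)
  qed
  ultimately show ?thesis by (simp add: passage_def)
qed

text \<open>Each further factor costs two units of level: one for the passage itself and one for the
  gap \<open>\<epsilon> = 1\<close>.\<close>

lemma passage_geometric:
  assumes d: "\<delta> \<in> rat_times" "0 < \<delta>"
  shows "passage \<delta> (2 * real n + 1) \<le> passage \<delta> 1 ^ Suc n"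
proof (induction n)
  case (Suc n)
  have "passage \<delta> (2 * real (Suc n) + 1) = passage \<delta> ((2 * real n + 1) + 1 + 1)"
    by (rule arg_cong[where f = "passage \<delta>"]) simp
  also have "\<dots> \<le> passage \<delta> (2 * real n + 1) * passage \<delta> 1"
    by (rule passage_step[OF d]) simp_all
  also have "\<dots> \<le> passage \<delta> 1 ^ Suc n * passage \<delta> 1"
    using Suc by (intro mult_right_mono) (simp_all add: passage_def)
  finally show ?case by (simp add: mult.commute)
qed simp

lemma prob_gt_le_passage:
  assumes "0 \<le> \<delta>" shows "prob {\<omega>\<in>space M. x < X \<delta> \<omega>} \<le> passage \<delta> x"
proof -
  have "{\<omega>\<in>space M. x < X \<delta> \<omega>} \<subseteq> (\<Union>n. up \<delta> n x)"
    by (auto simp: up_def intro!: exI[of _ "0::nat"] bexI[of _ "1::nat"])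
  then show ?thesis unfolding passage_def
    using assms by (intro finite_measure_mono sets.countable_UN) auto
qed

text \<open>The tail of \<open>X \<delta>\<close> decays geometrically with ratio
  \<open>passage \<delta> 1\<close>, which becomes as small as desired for short
  \<open>\<delta>\<close>. The expectation is then summed over layers of height 2.\<close>

lemma exp_moment_small:
  assumes b: "0 < \<beta>"
  shows "\<exists>m. (\<integral>\<^sup>+\<omega>. ennreal (exp (\<beta> * X (1 / 2 ^ m) \<omega>)) \<partial>M) < \<infinity>"
proof -
  \<comment> \<open>On the layer between \<open>2 * n + 1\<close> and \<open>2 * n + 3\<close> the
    integrand is at most \<open>exp (\<beta> * (2 * n + 3))\<close>; against the tail
    \<open>exp (- 3 * \<beta>) ^ Suc n\<close> the summable term \<open>exp (- \<beta>) ^ n\<close>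
    remains.\<close>
  have "eventually (\<lambda>m. passage (1 / 2 ^ m) 1 < exp (- 3 * \<beta>)) sequentially"
    by (rule order_tendstoD(2)[OF passage_tendsto_0]) simp_all
  then obtain m where m: "passage (1 / 2 ^ m) 1 < exp (- 3 * \<beta>)" by (auto simp: eventually_sequentially)
  let ?d = "1 / 2 ^ m :: real"
  have d: "?d \<in> rat_times" "0 < ?d" by (auto simp: rat_times_def intro!: Rats_divide Rats_power)
  let ?A = "\<lambda>n. {\<omega>\<in>space M. 2 * real n + 1 < X ?d \<omega>}"
  have A[measurable]: "?A n \<in> events" for n
    using rv[of ?d] by measurable
  have bound: "ennreal (exp (\<beta> * X ?d \<omega>)) \<le> ennreal (exp \<beta>) + (\<Sum>n. ennreal (exp (\<beta> * (2 * real n + 3))) * indicator (?A n) \<omega>)"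
    if w: "\<omega> \<in> space M" for \<omega>
  proof (cases "X ?d \<omega> \<le> 1")
    case True
    then have "exp (\<beta> * X ?d \<omega>) \<le> exp \<beta>" using b by simp
    then show ?thesis by (intro add_increasing2 ennreal_leI) auto
  next
    case False
    \<comment> \<open>This \<open>n\<close> satisfies \<open>2 * n + 1 < X \<le> 2 * n + 3\<close>;
      rounding up and subtracting 1 makes the lower inequality strict, as \<open>?A n\<close>
      requires.\<close>
    define n where "n = nat (\<lceil>(X ?d \<omega> - 1) / 2\<rceil> - 1)"
    have n: "real n < (X ?d \<omega> - 1) / 2" "(X ?d \<omega> - 1) / 2 \<le> real n + 1"
    proof -
      have "0 < (X ?d \<omega> - 1) / 2" using False by simp
      then have "0 < \<lceil>(X ?d \<omega> - 1) / 2\<rceil>" by (simp only: zero_less_ceiling)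
      then have "real n = of_int (\<lceil>(X ?d \<omega> - 1) / 2\<rceil>) - 1" by (simp add: n_def)
      then show "real n < (X ?d \<omega> - 1) / 2" "(X ?d \<omega> - 1) / 2 \<le> real n + 1" by linarith+
    qed
    have "ennreal (exp (\<beta> * X ?d \<omega>)) \<le> ennreal (exp (\<beta> * (2 * real n + 3))) * indicator (?A n) \<omega>"
      using n w b by (auto simp: indicator_def intro!: ennreal_leI)
    also have "\<dots> = (\<Sum>n\<in>{n}. ennreal (exp (\<beta> * (2 * real n + 3))) * indicator (?A n) \<omega>)"
      by (simp only: sum.insert sum.empty finite.emptyI empty_iff simp_thms add_0_right)
    also have "\<dots> \<le> (\<Sum>n. ennreal (exp (\<beta> * (2 * real n + 3))) * indicator (?A n) \<omega>)"
      by (rule sum_le_suminf) auto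
    finally show ?thesis by (rule add_increasing[OF zero_le])
  qed
  have "(\<integral>\<^sup>+\<omega>. ennreal (exp (\<beta> * X ?d \<omega>)) \<partial>M) \<le>
      (\<integral>\<^sup>+\<omega>. ennreal (exp \<beta>) + (\<Sum>n. ennreal (exp (\<beta> * (2 * real n + 3))) * indicator (?A n) \<omega>) \<partial>M)"
    by (intro nn_integral_mono bound)
  also have "\<dots> = ennreal (exp \<beta>) + (\<Sum>n. ennreal (exp (\<beta> * (2 * real n + 3))) * emeasure M (?A n))"
    by (simp add: nn_integral_add nn_integral_suminf nn_integral_cmult_indicator emeasure_space_1)
  also have "\<dots> \<le> ennreal (exp \<beta>) + (\<Sum>n. ennreal (exp (- \<beta>) ^ n))"
  proof (intro add_left_mono suminf_le)
    fix n
    have "prob (?A n) \<le> passage ?d 1 ^ Suc n"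
      using prob_gt_le_passage[of ?d "2 * real n + 1"] passage_geometric[OF d, of n] by simp
    also have "\<dots> \<le> exp (- 3 * \<beta>) ^ Suc n"
      using m by (intro power_mono) (auto simp: passage_def)
    also have "\<dots> = exp (real (Suc n) * (- 3 * \<beta>))" by (rule exp_of_nat_mult[symmetric])
    finally have "exp (\<beta> * (2 * real n + 3)) * prob (?A n) \<le> exp (\<beta> * (2 * real n + 3)) * exp (real (Suc n) * (- 3 * \<beta>))"
      by (intro mult_left_mono) auto
    also have "\<dots> = exp (real n * (- \<beta>))" by (simp add: exp_add[symmetric] algebra_simps)
    also have "\<dots> = exp (- \<beta>) ^ n" by (rule exp_of_nat_mult)
    finally show "ennreal (exp (\<beta> * (2 * real n + 3))) * emeasure M (?A n) \<le> ennreal (exp (- \<beta>) ^ n)"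
      by (simp add: emeasure_eq_measure ennreal_mult[symmetric] ennreal_leI)
  qed auto
  also have "(\<Sum>n. ennreal (exp (- \<beta>) ^ n)) = ennreal (\<Sum>n. exp (- \<beta>) ^ n)"
    using b by (intro suminf_ennreal2 summable_geometric) auto
  also have "ennreal (exp \<beta>) + \<dots> < \<infinity>" by simp
  finally show ?thesis by blast
qed

text \<open>\<open>X 1\<close> is the sum of \<open>2 ^ m\<close> independent increments distributed
  as \<open>X (1 / 2 ^ m)\<close>. In \<open>ennreal\<close> the identity holds before finiteness is
  known, and so can carry finiteness from one scale to another.\<close>

lemma exp_moment_root:
  "(\<integral>\<^sup>+\<omega>. ennreal (exp (\<beta> * X (1 / 2 ^ m) \<omega>)) \<partial>M) ^ (2 ^ m) = (\<integral>\<^sup>+\<omega>. ennreal (exp (\<beta> * X 1 \<omega>)) \<partial>M)"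
proof -
  let ?t = "\<lambda>k. real k / 2 ^ m"
  let ?D = "\<lambda>i \<omega>. X (?t (Suc i)) \<omega> - X (?t i) \<omega>"
  have iv: "indep_vars (\<lambda>_. borel) ?D {..<2^m}"
    by (rule independent) (auto simp: mono_def divide_right_mono)
  have D[measurable]: "?D i \<in> borel_measurable M" for i by (intro borel_measurable_diff rv) auto
  have "(\<integral>\<^sup>+\<omega>. ennreal (exp (\<beta> * X 1 \<omega>)) \<partial>M) = (\<integral>\<^sup>+\<omega>. (\<Prod>i\<in>{..<2^m}. ennreal (exp (\<beta> * ?D i \<omega>))) \<partial>M)"
  proof (rule nn_integral_cong)
    fix \<omega> assume w: "\<omega> \<in> space M"
    have "X 1 \<omega> = (\<Sum>i\<in>{..<2^m}. ?D i \<omega>)"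
      using X0[OF w] by (subst sum_lessThan_telescope) simp
    then have "exp (\<beta> * X 1 \<omega>) = (\<Prod>i\<in>{..<2^m}. exp (\<beta> * ?D i \<omega>))"
      by (simp add: exp_sum sum_distrib_left)
    then show "ennreal (exp (\<beta> * X 1 \<omega>)) = (\<Prod>i\<in>{..<2^m}. ennreal (exp (\<beta> * ?D i \<omega>)))"
      by (simp add: prod_ennreal)
  qed
  also have "\<dots> = (\<Prod>i\<in>{..<2^m}. \<integral>\<^sup>+\<omega>. ennreal (exp (\<beta> * ?D i \<omega>)) \<partial>M)"
  proof (rule indep_vars_nn_integral)
    show "indep_vars (\<lambda>_. borel) (\<lambda>i \<omega>. ennreal (exp (\<beta> * ?D i \<omega>))) {..<2 ^ m}"
      using indep_vars_compose2[OF iv, of "\<lambda>_ x. ennreal (exp (\<beta> * x))" "\<lambda>_. borel"] by simp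
  qed auto
  also have "\<dots> = (\<Prod>i\<in>{..<2^m::nat}. \<integral>\<^sup>+\<omega>. ennreal (exp (\<beta> * X (1 / 2 ^ m) \<omega>)) \<partial>M)"
  proof (rule prod.cong[OF refl])
    fix i
    have "(\<integral>\<^sup>+\<omega>. ennreal (exp (\<beta> * ?D i \<omega>)) \<partial>M) = (\<integral>\<^sup>+x. ennreal (exp (\<beta> * x)) \<partial>distr M borel (?D i))"
      by (subst nn_integral_distr) auto
    also have "distr M borel (?D i) = distr M borel (X (1 / 2 ^ m))"
    proof -
      have "?t (Suc i) - ?t i = 1 / 2 ^ m" by (simp add: field_simps)
      then show ?thesis using stationary[of "?t i" "?t (Suc i)"] by (simp add: divide_right_mono)
    qed
    also have "(\<integral>\<^sup>+x. ennreal (exp (\<beta> * x)) \<partial>\<dots>) = (\<integral>\<^sup>+\<omega>. ennreal (exp (\<beta> * X (1 / 2 ^ m) \<omega>)) \<partial>M)"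
      by (subst nn_integral_distr) (auto intro!: rv)
    finally show "(\<integral>\<^sup>+\<omega>. ennreal (exp (\<beta> * ?D i \<omega>)) \<partial>M) = \<dots>" .
  qed
  finally show ?thesis by simp
qed

text \<open>Finiteness at one fine scale passes up to time 1 and from there down to every
  scale.\<close>

lemma exp_moment_finite:
  assumes b: "0 < \<beta>"
  shows "(\<integral>\<^sup>+\<omega>. ennreal (exp (\<beta> * X (1 / 2 ^ m) \<omega>)) \<partial>M) < \<infinity>"
proof -
  from exp_moment_small[OF b] obtain l where "(\<integral>\<^sup>+\<omega>. ennreal (exp (\<beta> * X (1 / 2 ^ l) \<omega>)) \<partial>M) < \<infinity>" ..
  then have "(\<integral>\<^sup>+\<omega>. ennreal (exp (\<beta> * X 1 \<omega>)) \<partial>M) < \<infinity>"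
    unfolding exp_moment_root[of \<beta> l, symmetric] by (simp add: power_less_top_ennreal)
  then show ?thesis
    unfolding exp_moment_root[of \<beta> m, symmetric] by (simp add: power_less_top_ennreal)
qed

lemma exp_integrable:
  assumes "0 < \<beta>" shows "integrable M (\<lambda>\<omega>. exp (\<beta> * X (1 / 2 ^ m) \<omega>))"
  using exp_moment_finite[OF assms, of m] by (intro integrableI_nonneg) (auto intro!: rv borel_measurable_times borel_measurable_exp)

lemma exp_moment_pos:
  assumes "0 < \<beta>" shows "0 < (\<integral>\<omega>. exp (\<beta> * X (1 / 2 ^ m) \<omega>) \<partial>M)"
proof -
  have "(\<integral>\<omega>. exp (\<beta> * X (1 / 2 ^ m) \<omega>) \<partial>M) \<noteq> 0"
    using integral_nonneg_eq_0_iff_AE[OF exp_integrable[OF assms, of m]] by (simp add: AE_False)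
  moreover have "0 \<le> (\<integral>\<omega>. exp (\<beta> * X (1 / 2 ^ m) \<omega>) \<partial>M)" by (rule integral_nonneg_AE) simp
  ultimately show ?thesis by linarith
qed

lemma exp_moment_eq:
  assumes b: "0 < \<beta>"
  shows "(\<integral>\<omega>. exp (\<beta> * X (1 / 2 ^ m) \<omega>) \<partial>M) = exp (laplace_exponent M X \<beta> / 2 ^ m)"
proof -
  let ?I = "\<lambda>m. \<integral>\<omega>. exp (\<beta> * X (1 / 2 ^ m) \<omega>) \<partial>M"
  have "ennreal (?I m) ^ (2 ^ m) = ennreal (?I 0)"
    using exp_moment_root[of \<beta> m] nn_integral_eq_integral[OF exp_integrable[OF b, of m]]
      nn_integral_eq_integral[OF exp_integrable[OF b, of 0]] by simp
  then have "?I m ^ (2 ^ m) = ?I 0"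
    using exp_moment_pos[OF b, of m] exp_moment_pos[OF b, of 0] by (simp add: ennreal_power less_imp_le)
  then have "real (2 ^ m) * ln (?I m) = ln (?I 0)"
    using ln_realpow[of "?I m" "2 ^ m"] by simp
  then have "ln (?I m) = laplace_exponent M X \<beta> / 2 ^ m"
    by (simp add: laplace_exponent_def field_simps)
  then show ?thesis using exp_moment_pos[OF b, of m] by (metis exp_ln)
qed

text \<open>With \<open>q n\<close> for this probability, independence makes
  \<open>(1 - q n) ^ (2 ^ n)\<close> the probability of no large rise on the grid of the unit
  interval, which tends to 1. Taking logarithms, \<open>- ln (1 - q n) \<ge> q n\<close> bounds
  \<open>2 ^ n * q n\<close> by a null sequence.\<close>

lemma prob_grid_increment_gt:
  assumes e: "0 < \<epsilon>"
  shows "(\<lambda>n. 2 ^ n * prob {\<omega>\<in>space M. \<epsilon> < X (1 / 2 ^ n) \<omega>}) \<longlonglongrightarrow> 0"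
proof -
  define q where "q n = prob {\<omega>\<in>space M. \<epsilon> < X (1 / 2 ^ n) \<omega>}" for n :: nat
  have q01: "0 \<le> q n" "q n \<le> 1" for n by (auto simp: q_def)
  have J: "prob (jump_up 1 n \<epsilon>) = 1 - (1 - q n) ^ (2 ^ n)" for n
  proof -
    let ?t = "\<lambda>k. real k / 2 ^ n"
    let ?D = "\<lambda>i \<omega>. X (?t (Suc i)) \<omega> - X (?t i) \<omega>"
    have iv: "indep_vars (\<lambda>_. borel) ?D {..<2^n}"
      by (rule independent) (auto simp: mono_def divide_right_mono)
    have D[measurable]: "?D i \<in> borel_measurable M" for i by (intro borel_measurable_diff rv) auto
    have "prob (\<Inter>i\<in>{..<2^n}. ?D i -` {..\<epsilon>} \<inter> space M) = (\<Prod>i\<in>{..<2^n}. prob (?D i -` {..\<epsilon>} \<inter> space M))"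
      by (rule indep_varsD[OF iv]) (auto simp: lessThan_empty_iff)
    also have "\<dots> = (\<Prod>i\<in>{..<2^n::nat}. 1 - q n)"
    proof (rule prod.cong[OF refl])
      fix i
      have "distr M borel (?D i) = distr M borel (X (1 / 2 ^ n))"
      proof -
        have "?t (Suc i) - ?t i = 1 / 2 ^ n" by (simp add: field_simps)
        then show ?thesis using stationary[of "?t i" "?t (Suc i)"] by (simp add: divide_right_mono)
      qed
      then have "prob (?D i -` {..\<epsilon>} \<inter> space M) = measure (distr M borel (X (1 / 2 ^ n))) {..\<epsilon>}"
        using measure_distr[OF D atMost_borel, of i \<epsilon>] by simp
      also have "\<dots> = prob (space M - {\<omega>\<in>space M. \<epsilon> < X (1 / 2 ^ n) \<omega>})"
        by (subst measure_distr) (auto intro!: rv arg_cong[where f = prob])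
      also have "\<dots> = 1 - q n" unfolding q_def
        by (rule prob_compl) (use rv[of "1 / 2 ^ n"] in measurable)
      finally show "prob (?D i -` {..\<epsilon>} \<inter> space M) = 1 - q n" .
    qed
    also have "\<dots> = (1 - q n) ^ (2 ^ n)" by simp
    also have "(\<Inter>i\<in>{..<2^n}. ?D i -` {..\<epsilon>} \<inter> space M) = space M - jump_up 1 n \<epsilon>"
    proof (rule set_eqI)
      fix \<omega>
      have "\<omega> \<in> (\<Inter>i\<in>{..<2^n}. ?D i -` {..\<epsilon>} \<inter> space M) \<longleftrightarrow> \<omega> \<in> space M \<and> (\<forall>i\<in>{..<2^n}. ?D i \<omega> \<le> \<epsilon>)"
        by (auto simp: lessThan_empty_iff)
      moreover have "\<omega> \<in> space M - jump_up 1 n \<epsilon> \<longleftrightarrow> \<omega> \<in> space M \<and> (\<forall>i\<in>{..<2^n}. ?D i \<omega> \<le> \<epsilon>)"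
        by (auto simp: jump_up_def not_less)
      ultimately show "\<omega> \<in> (\<Inter>i\<in>{..<2^n}. ?D i -` {..\<epsilon>} \<inter> space M) \<longleftrightarrow> \<omega> \<in> space M - jump_up 1 n \<epsilon>"
        by (simp only:)
    qed
    also have "prob \<dots> = 1 - prob (jump_up 1 n \<epsilon>)" by (rule prob_compl) simp
    finally show ?thesis by simp
  qed
  have "(\<lambda>n. prob (jump_up 1 n \<epsilon>)) \<longlonglongrightarrow> 0" by (rule prob_jump_up_tendsto) (use e in auto)
  then have l1: "(\<lambda>n. 1 - prob (jump_up 1 n \<epsilon>)) \<longlonglongrightarrow> 1 - 0" by (intro tendsto_intros)
  then have "(\<lambda>n. - ln (1 - prob (jump_up 1 n \<epsilon>))) \<longlonglongrightarrow> - ln 1" by (intro tendsto_intros) auto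
  then have l2: "(\<lambda>n. - ln (1 - prob (jump_up 1 n \<epsilon>))) \<longlonglongrightarrow> 0" by simp
  have "eventually (\<lambda>n. 1 - prob (jump_up 1 n \<epsilon>) > 0) sequentially"
    using order_tendstoD(1)[OF l1, of 0] by simp
  then have ev: "eventually (\<lambda>n. 2 ^ n * q n \<le> - ln (1 - prob (jump_up 1 n \<epsilon>))) sequentially"
  proof eventually_elim
    case (elim n)
    have "1 - q n \<noteq> 0" using elim J[of n] by (intro notI) (simp add: power_0_left)
    then have pos: "0 < 1 - q n" using q01[of n] by simp
    have "ln (1 - prob (jump_up 1 n \<epsilon>)) = 2 ^ n * ln (1 - q n)"
      using J[of n] ln_realpow[of "1 - q n" "2 ^ n"] by simp
    moreover have "ln (1 - q n) \<le> - q n" using ln_le_minus_one[OF pos] by simp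
    then have "2 ^ n * ln (1 - q n) \<le> 2 ^ n * (- q n)" by (intro mult_left_mono) auto
    ultimately show ?case by simp
  qed
  show ?thesis unfolding q_def[symmetric]
    by (rule tendsto_sandwich[OF _ ev tendsto_const l2]) (use q01 in simp)
qed

end

section \<open>The Laplace transform of the overall infimum\<close>

text \<open>Otherwise there would be visits below every \<open>- real n\<close>, all before the time
  after which the path stays positive; at an accumulation point this contradicts lower
  semicontinuity.\<close>

lemma good_path_bounded_below:
  assumes p: "good_path p"
  shows "\<exists>b. \<forall>t\<ge>0. b \<le> p t"
proof (rule ccontr)
  assume "\<not> ?thesis"
  then have ex: "\<exists>t\<ge>0. p t < b" for b by (meson not_le)
  have "eventually (\<lambda>t. p t > 0) at_top"
    using p by (auto simp: good_path_def filterlim_at_top_dense)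
  then obtain T where T: "\<And>t. t \<ge> T \<Longrightarrow> p t > 0" by (auto simp: eventually_at_top_linorder)
  have le: "\<exists>t\<in>{0..T}. p t \<le> - real n" for n
  proof (rule good_path_visit_closed[OF p order_refl], rule allI)
    fix k :: nat
    obtain t where t: "t \<ge> 0" "p t < - real n" using ex by blast
    then have "t \<le> T" using T[of t] by (cases "t \<ge> T") auto
    then show "\<exists>q\<in>{0..T}. p q < - real n + 1 / real (Suc k)"
      using t by (intro bexI[of _ t]) (auto intro: less_trans)
  qed
  then obtain t where t: "\<And>n. t n \<in> {0..T}" "\<And>n. p (t n) \<le> - real n" by metis
  have "seq_compact {0..T}" by (rule compact_imp_seq_compact) simp
  then obtain l r where l: "l \<in> {0..T}" "strict_mono (r :: nat \<Rightarrow> nat)" "(t \<circ> r) \<longlonglongrightarrow> l"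
    using t(1) unfolding seq_compact_def by metis
  have "p l - 1 < p l" by simp
  from good_path_lsc[OF p _ this] l obtain \<eta>
    where e: "\<eta> > 0" "\<forall>r\<ge>0. \<bar>r - l\<bar> < \<eta> \<longrightarrow> p l - 1 < p r" by auto
  have 1: "eventually (\<lambda>n. \<bar>t (r n) - l\<bar> < \<eta>) sequentially"
    using l(3) e(1) by (auto simp: tendsto_iff dist_real_def)
  obtain N :: nat where N: "1 - p l < real N" using reals_Archimedean2 by blast
  have 2: "eventually (\<lambda>n. n \<ge> N) sequentially" by simp
  obtain n where n: "\<bar>t (r n) - l\<bar> < \<eta>" "n \<ge> N"
    using eventually_happens[OF eventually_conj[OF 1 2]] by auto
  have "p l - 1 < p (t (r n))" using e n t(1)[of "r n"] by auto
  moreover have "p (t (r n)) \<le> - real (r n)" by (rule t(2))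
  moreover have "real n \<le> real (r n)" using seq_suble[OF l(2)] by simp
  ultimately show False using N n(2) by linarith
qed

context regular_process begin

definition path_inf :: "(real \<Rightarrow> real) \<Rightarrow> real" where
  "path_inf z = (INF q\<in>rat_times. z q)"

definition grid_inf :: "nat \<Rightarrow> (real \<Rightarrow> real) \<Rightarrow> real" where
  "grid_inf n z = (INF k. z (real k / 2 ^ n))"

lemma grid_in_times [simp]: "real k / 2 ^ n \<in> rat_times"
  using times_grid[of 1 k n] by (simp add: rat_times_def)

lemma countable_rat_times: "countable rat_times"
  unfolding rat_times_def by (rule countable_subset[OF Int_lower1]) (rule countable_rat)

lemma zero_times [simp]: "0 \<in> rat_times" by (simp add: rat_times_def)

lemma path_inf_measurable [measurable]: "path_inf \<in> borel_measurable paths"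
  unfolding path_inf_def by (intro borel_measurable_cINF_real countable_rat_times measurable_component_singleton)

lemma grid_inf_measurable [measurable]: "grid_inf n \<in> borel_measurable paths"
  unfolding grid_inf_def by (intro borel_measurable_cINF_real measurable_component_singleton) auto

lemma bdd_future:
  assumes "\<omega> \<in> space M" "0 \<le> s" "A \<subseteq> rat_times"
  shows "bdd_below (future s \<omega> ` A)"
proof -
  obtain b where b: "\<And>t. 0 \<le> t \<Longrightarrow> b \<le> X t \<omega>" using good_path_bounded_below[OF good[OF assms(1)]] by blast
  show ?thesis
    by (rule bdd_belowI2[of _ "b - X s \<omega>"])
       (use b[of "s + _"] assms in \<open>auto simp: future_def dest!: subsetD dest: times_nonneg\<close>)
qed

text \<open>The infimum runs over rational times, but \<open>good_path_visit_iff\<close> turns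
  near-visits into a visit at a real time, so the equivalence holds for the non-strict
  inequality.\<close>

lemma path_inf_future_le_iff:
  assumes w: "\<omega> \<in> space M" and s: "0 \<le> s"
  shows "path_inf (future s \<omega>) \<le> a \<longleftrightarrow> (\<exists>t\<ge>0. X (s + t) \<omega> - X s \<omega> \<le> a)"
proof -
  have "path_inf (future s \<omega>) \<le> a \<longleftrightarrow> (\<forall>n::nat. path_inf (future s \<omega>) < a + 1 / real (Suc n))"
  proof
    assume "path_inf (future s \<omega>) \<le> a"
    then show "\<forall>n::nat. path_inf (future s \<omega>) < a + 1 / real (Suc n)"
      by (auto intro: le_less_trans)
  next
    assume *: "\<forall>n::nat. path_inf (future s \<omega>) < a + 1 / real (Suc n)"
    show "path_inf (future s \<omega>) \<le> a"
    proof (rule field_le_epsilon)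
      fix e :: real assume "0 < e"
      then obtain n where "1 / real (Suc n) < e" using nat_approx_posE by blast
      then show "path_inf (future s \<omega>) \<le> a + e" using * by (meson add_strict_left_mono less_imp_le less_trans)
    qed
  qed
  also have "\<dots> \<longleftrightarrow> (\<forall>n::nat. \<exists>q\<in>rat_times. future s \<omega> q < a + 1 / real (Suc n))"
    unfolding path_inf_def using bdd_future[OF w s order_refl]
    by (subst cINF_less_iff) (auto intro: exI[of _ 0] zero_times)
  also have "\<dots> \<longleftrightarrow> (\<forall>n::nat. \<exists>q\<in>\<rat>. 0 \<le> q \<and> X (s + q) \<omega> - X s \<omega> < a + 1 / real (Suc n))"
    by (auto simp: future_def rat_times_def Bex_def)
  also have "\<dots> \<longleftrightarrow> (\<exists>t\<ge>0. X (s + t) \<omega> - X s \<omega> \<le> a)"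
    by (rule good_path_visit_iff[OF good_path_shift[OF good[OF w] s] order_refl, symmetric])
  finally show ?thesis .
qed

lemma path_inf_le_iff:
  assumes w: "\<omega> \<in> space M"
  shows "path_inf (future 0 \<omega>) \<le> a \<longleftrightarrow> (\<exists>t\<ge>0. X t \<omega> \<le> a)"
  using path_inf_future_le_iff[OF w order_refl] X0[OF w] by simp

lemma path_inf_le_0: "\<omega> \<in> space M \<Longrightarrow> path_inf (future 0 \<omega>) \<le> 0"
  by (subst path_inf_le_iff) (auto intro!: exI[of _ 0] simp: X0)

lemma grid_inf_le:
  assumes "\<omega> \<in> space M" "0 \<le> s"
  shows "grid_inf n (future s \<omega>) \<le> future s \<omega> (real k / 2 ^ n)"
  unfolding grid_inf_def
  using bdd_future[OF assms, of "range (\<lambda>k. real k / 2 ^ n)"]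
  by (intro cINF_lower) (auto simp: image_image image_subset_iff)

lemma grid_inf_le_0: "\<omega> \<in> space M \<Longrightarrow> 0 \<le> s \<Longrightarrow> grid_inf n (future s \<omega>) \<le> 0"
  using grid_inf_le[of \<omega> s n 0] by (simp add: future_def)

lemma path_inf_le_grid_inf:
  assumes "\<omega> \<in> space M"
  shows "path_inf (future 0 \<omega>) \<le> grid_inf n (future 0 \<omega>)"
  unfolding grid_inf_def path_inf_def using bdd_future[OF assms order_refl order_refl]
  by (intro cINF_greatest cINF_lower) auto

text \<open>The infimum is attained at some \<open>t\<close>; right-continuity gives an interval to
  the right of \<open>t\<close> with values below \<open>a\<close>, which contains a grid point once
  the mesh is shorter.\<close>

lemma grid_inf_tendsto:
  assumes w: "\<omega> \<in> space M"
  shows "(\<lambda>n. grid_inf n (future 0 \<omega>)) \<longlonglongrightarrow> path_inf (future 0 \<omega>)"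
proof (rule order_tendstoI)
  fix a assume "a < path_inf (future 0 \<omega>)"
  then show "eventually (\<lambda>n. a < grid_inf n (future 0 \<omega>)) sequentially"
    using path_inf_le_grid_inf[OF w] by (intro always_eventually allI) (auto intro: less_le_trans)
next
  fix a assume "path_inf (future 0 \<omega>) < a"
  then obtain t where t: "t \<ge> 0" "X t \<omega> < a"
    using path_inf_le_iff[OF w, of "path_inf (future 0 \<omega>)"] by force
  have "eventually (\<lambda>r. X r \<omega> < a) (at_right t)"
    using good[OF w] t by (intro order_tendstoD(2)[of _ "X t \<omega>"]) (auto simp: good_path_def)
  then obtain b where b: "b > t" "\<And>y. t < y \<Longrightarrow> y < b \<Longrightarrow> X y \<omega> < a"
    unfolding eventually_at_right_field by blast
  obtain N :: nat where N: "1 / (b - t) < 2 ^ N" using real_arch_pow[of 2 "1 / (b - t)"] by auto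
  have "grid_inf n (future 0 \<omega>) < a" if n: "n \<ge> N" for n
  proof -
    \<comment> \<open>The grid index strictly beyond \<open>t\<close>: the bound \<open>b(2)\<close>
      is available only to the right of \<open>t\<close>.\<close>
    define k where "k = nat (\<lfloor>t * 2 ^ n\<rfloor> + 1)"
    have k: "t * 2 ^ n < real k" "real k \<le> t * 2 ^ n + 1"
    proof -
      have "0 \<le> \<lfloor>t * 2 ^ n\<rfloor>" using t by simp
      then have "real k = of_int \<lfloor>t * 2 ^ n\<rfloor> + 1" by (simp add: k_def)
      then show "t * 2 ^ n < real k" "real k \<le> t * 2 ^ n + 1" by linarith+
    qed
    have "(2::real) ^ N \<le> 2 ^ n" using n by (intro power_increasing) auto
    then have "1 / (b - t) < 2 ^ n" using N by linarith
    then have "1 < (b - t) * 2 ^ n" using b(1) by (simp add: field_simps)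
    then have "real k < b * 2 ^ n" using k by (simp add: algebra_simps)
    then have "t < real k / 2 ^ n" "real k / 2 ^ n < b" using k by (simp_all add: field_simps)
    then have "X (real k / 2 ^ n) \<omega> < a" by (rule b(2))
    then show ?thesis using grid_inf_le[OF w order_refl, of n k] future_0[OF w, of "real k / 2 ^ n"] by simp
  qed
  then show "eventually (\<lambda>n. grid_inf n (future 0 \<omega>) < a) sequentially"
    by (auto simp: eventually_sequentially)
qed

definition inf_lap :: "real \<Rightarrow> real" where
  "inf_lap \<beta> = (\<integral>\<omega>. exp (\<beta> * path_inf (future 0 \<omega>)) \<partial>M)"

definition grid_lap :: "nat \<Rightarrow> real \<Rightarrow> real" where
  "grid_lap n \<beta> = (\<integral>\<omega>. exp (\<beta> * grid_inf n (future 0 \<omega>)) \<partial>M)"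

text \<open>With \<open>a = X_h + I'\<close> as in \<open>grid_inf_step\<close>, the grid infimum is
  \<open>min 0 a\<close> and this is \<open>max 0 a\<close>, the amount lost by truncating at
  0.\<close>

definition overshoot :: "nat \<Rightarrow> 'a \<Rightarrow> real" where
  "overshoot n \<omega> = max 0 (X (1 / 2 ^ n) \<omega> + grid_inf n (future (1 / 2 ^ n) \<omega>))"

lemma overshoot_measurable [measurable]: "overshoot n \<in> borel_measurable M"
  unfolding overshoot_def by measurable

lemma grid_lap_tendsto:
  assumes b: "0 < \<beta>"
  shows "(\<lambda>n. grid_lap n \<beta>) \<longlonglongrightarrow> inf_lap \<beta>"
  unfolding grid_lap_def inf_lap_def
proof (rule integral_dominated_convergence[where w = "\<lambda>_. 1"])
  show "AE \<omega> in M. (\<lambda>n. exp (\<beta> * grid_inf n (future 0 \<omega>))) \<longlonglongrightarrow> exp (\<beta> * path_inf (future 0 \<omega>))"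
    by (intro AE_I2 tendsto_intros grid_inf_tendsto)
  show "AE \<omega> in M. norm (exp (\<beta> * grid_inf n (future 0 \<omega>))) \<le> 1" for n
    using b by (intro AE_I2) (simp add: mult_nonneg_nonpos grid_inf_le_0)
qed auto

text \<open>Index 0 contributes the value 0, and the remaining grid points are those of the path
  restarted after one step.\<close>

lemma grid_inf_step:
  assumes w: "\<omega> \<in> space M"
  shows "grid_inf n (future 0 \<omega>) = min 0 (X (1 / 2 ^ n) \<omega> + grid_inf n (future (1 / 2 ^ n) \<omega>))"
proof -
  let ?h = "1 / 2 ^ n :: real"
  have f: "X ?h \<omega> + future ?h \<omega> (real k / 2 ^ n) = future 0 \<omega> (real (Suc k) / 2 ^ n)" for k
    using grid_in_times[of "Suc k" n] grid_in_times[of k n] future_0[OF w grid_in_times[of "Suc k" n]]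
    by (simp add: future_def add_divide_distrib del: grid_in_times)
  show ?thesis
  proof (rule antisym)
    have "grid_inf n (future 0 \<omega>) - X ?h \<omega> \<le> grid_inf n (future ?h \<omega>)"
      unfolding grid_inf_def[of n "future ?h \<omega>"]
    proof (rule cINF_greatest)
      fix k
      show "grid_inf n (future 0 \<omega>) - X ?h \<omega> \<le> future ?h \<omega> (real k / 2 ^ n)"
        using grid_inf_le[OF w order_refl, of n "Suc k"] f[of k] by linarith
    qed simp
    then show "grid_inf n (future 0 \<omega>) \<le> min 0 (X ?h \<omega> + grid_inf n (future ?h \<omega>))"
      using grid_inf_le_0[OF w order_refl] by simp
    show "min 0 (X ?h \<omega> + grid_inf n (future ?h \<omega>)) \<le> grid_inf n (future 0 \<omega>)"
      unfolding grid_inf_def[of n "future 0 \<omega>"]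
    proof (rule cINF_greatest)
      fix k :: nat
      show "min 0 (X ?h \<omega> + grid_inf n (future ?h \<omega>)) \<le> future 0 \<omega> (real k / 2 ^ n)"
      proof (cases k)
        case 0
        then show ?thesis by (simp add: future_def)
      next
        case (Suc j)
        then show ?thesis using grid_inf_le[OF w, of ?h n j] f[of j] by simp
      qed
    qed simp
  qed
qed

lemma overshoot_le: "\<omega> \<in> space M \<Longrightarrow> overshoot n \<omega> \<le> max 0 (X (1 / 2 ^ n) \<omega>)"
  using grid_inf_le_0[of \<omega> "1 / 2 ^ n" n] by (auto simp: overshoot_def)

lemma overshoot_nonneg: "0 \<le> overshoot n \<omega>" by (simp add: overshoot_def)

lemma exp_overshoot_integrable:
  assumes b: "0 < \<beta>"
  shows "integrable M (\<lambda>\<omega>. exp (\<beta> * overshoot n \<omega>))"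
proof (rule Bochner_Integration.integrable_bound)
  show "integrable M (\<lambda>\<omega>. 1 + exp (\<beta> * X (1 / 2 ^ n) \<omega>))"
    by (intro Bochner_Integration.integrable_add exp_integrable b) simp
  show "AE \<omega> in M. norm (exp (\<beta> * overshoot n \<omega>)) \<le> norm (1 + exp (\<beta> * X (1 / 2 ^ n) \<omega>))"
  proof (rule AE_I2)
    fix \<omega> assume w: "\<omega> \<in> space M"
    have "exp (\<beta> * overshoot n \<omega>) \<le> exp (\<beta> * max 0 (X (1 / 2 ^ n) \<omega>))"
      using overshoot_le[OF w, of n] b by simp
    also have "\<dots> \<le> 1 + exp (\<beta> * X (1 / 2 ^ n) \<omega>)" by (auto simp: max_def)
    finally show "norm (exp (\<beta> * overshoot n \<omega>)) \<le> norm (1 + exp (\<beta> * X (1 / 2 ^ n) \<omega>))"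
      by (simp add: add_nonneg_nonneg)
  qed
qed measurable

lemma exp_inf_integrable:
  assumes b: "0 < \<beta>"
  shows "integrable M (\<lambda>\<omega>. exp (\<beta> * grid_inf n (future 0 \<omega>)))"
proof (rule Bochner_Integration.integrable_bound[of _ "\<lambda>_. 1 :: real"])
  show "AE \<omega> in M. norm (exp (\<beta> * grid_inf n (future 0 \<omega>))) \<le> norm (1::real)"
    using b by (intro AE_I2) (simp add: mult_nonneg_nonpos grid_inf_le_0)
qed auto

text \<open>From \<open>I = min 0 (X\<^sub>h + I')\<close> with \<open>I'\<close> an independent copy of the grid infimum \<open>I\<close>, where
  \<open>h = 2\<^sup>-\<^sup>n\<close>.\<close>

lemma overshoot_identity:
  assumes b: "0 < \<beta>"
  shows "(\<integral>\<omega>. exp (\<beta> * overshoot n \<omega>) - 1 \<partial>M) = (exp (laplace_exponent M X \<beta> / 2 ^ n) - 1) * grid_lap n \<beta>"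
proof -
  let ?h = "1 / 2 ^ n :: real"
  let ?e = "exp (laplace_exponent M X \<beta> / 2 ^ n)"
  have Xp: "X ?h \<in> borel_measurable (past ?h)" by (rule X_past) auto
  have "(\<integral>\<^sup>+\<omega>. ennreal (exp (\<beta> * (X ?h \<omega> + grid_inf n (future ?h \<omega>)))) \<partial>M) =
    (\<integral>\<^sup>+\<omega>. (\<integral>\<^sup>+\<omega>'. ennreal (exp (\<beta> * (X ?h \<omega> + grid_inf n (future 0 \<omega>')))) \<partial>M) \<partial>M)"
    using markov_nn_integral[of ?h "\<lambda>(\<omega>, z). ennreal (exp (\<beta> * (X ?h \<omega> + grid_inf n z)))"] Xp
    by simp
  also have "\<dots> = (\<integral>\<^sup>+\<omega>. ennreal (exp (\<beta> * X ?h \<omega>)) * (\<integral>\<^sup>+\<omega>'. ennreal (exp (\<beta> * grid_inf n (future 0 \<omega>'))) \<partial>M) \<partial>M)"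
    by (simp add: distrib_left exp_add ennreal_mult nn_integral_cmult)
  also have "\<dots> = (\<integral>\<^sup>+\<omega>. ennreal (exp (\<beta> * X ?h \<omega>)) \<partial>M) * (\<integral>\<^sup>+\<omega>'. ennreal (exp (\<beta> * grid_inf n (future 0 \<omega>'))) \<partial>M)"
    by (subst nn_integral_multc) auto
  also have "(\<integral>\<^sup>+\<omega>. ennreal (exp (\<beta> * X ?h \<omega>)) \<partial>M) = ennreal ?e"
    using nn_integral_eq_integral[OF exp_integrable[OF b, of n]] exp_moment_eq[OF b, of n] by simp
  also have "(\<integral>\<^sup>+\<omega>'. ennreal (exp (\<beta> * grid_inf n (future 0 \<omega>'))) \<partial>M) = ennreal (grid_lap n \<beta>)"
    using nn_integral_eq_integral[OF exp_inf_integrable[OF b, of n]] by (simp add: grid_lap_def)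
  finally have 1: "(\<integral>\<^sup>+\<omega>. ennreal (exp (\<beta> * (X ?h \<omega> + grid_inf n (future ?h \<omega>)))) \<partial>M) = ennreal (?e * grid_lap n \<beta>)"
    by (simp add: ennreal_mult')
  \<comment> \<open>One of \<open>min 0 a\<close> and \<open>max 0 a\<close> vanishes, hence
    \<open>exp (\<beta> * a) = exp (\<beta> * min 0 a) + (exp (\<beta> * max 0 a) -
    1)\<close>.\<close>
  have pw: "exp (\<beta> * (X ?h \<omega> + grid_inf n (future ?h \<omega>))) =
     exp (\<beta> * grid_inf n (future 0 \<omega>)) + (exp (\<beta> * overshoot n \<omega>) - 1)" if "\<omega> \<in> space M" for \<omega>
    unfolding grid_inf_step[OF that] overshoot_def
    by (cases "0 \<le> X ?h \<omega> + grid_inf n (future ?h \<omega>)") (auto simp: max_def min_def)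
  have g0: "0 \<le> grid_lap n \<beta>" unfolding grid_lap_def by (rule integral_nonneg_AE) simp
  have "(\<integral>\<omega>. exp (\<beta> * (X ?h \<omega> + grid_inf n (future ?h \<omega>))) \<partial>M) = ?e * grid_lap n \<beta>"
    using 1 g0 by (subst integral_eq_nn_integral) (auto simp del: ennreal_mult')
  also have "(\<integral>\<omega>. exp (\<beta> * (X ?h \<omega> + grid_inf n (future ?h \<omega>))) \<partial>M) =
      (\<integral>\<omega>. exp (\<beta> * grid_inf n (future 0 \<omega>)) + (exp (\<beta> * overshoot n \<omega>) - 1) \<partial>M)"
    by (rule Bochner_Integration.integral_cong[OF refl pw])
  also have "\<dots> = grid_lap n \<beta> + (\<integral>\<omega>. exp (\<beta> * overshoot n \<omega>) - 1 \<partial>M)"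
    unfolding grid_lap_def
    by (intro Bochner_Integration.integral_add exp_inf_integrable b Bochner_Integration.integrable_diff exp_overshoot_integrable) simp
  finally show ?thesis by (simp add: algebra_simps)
qed

end

text \<open>Three regimes. For \<open>v \<le> \<epsilon>\<close> both quotients are comparable to
  \<open>v\<close> up to the factor \<open>exp (\<gamma> * \<epsilon>)\<close>. Between
  \<open>\<epsilon>\<close> and \<open>K\<close> the left side is at most
  \<open>exp (\<gamma> * K) / \<gamma>\<close>. Beyond \<open>K\<close>, the factorization of
  \<open>exp (2 * \<gamma> * v) - 1\<close> through \<open>exp (\<gamma> * v) - 1\<close> gains
  \<open>exp (- \<gamma> * K)\<close>.\<close>

lemma exp_difference_quotient_bound:
  fixes v :: real
  assumes v: "0 \<le> v" and b: "0 < \<beta>" "0 < \<gamma>"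
  shows "(exp (\<gamma> * v) - 1) / \<gamma> \<le> exp (\<gamma> * \<epsilon>) * ((exp (\<beta> * v) - 1) / \<beta>) +
    (exp (\<gamma> * K) * of_bool (\<epsilon> < v) + exp (- \<gamma> * K) * (exp (2 * \<gamma> * v) - 1)) / \<gamma>"
proof -
  have sb: "v \<le> (exp (\<beta> * v) - 1) / \<beta>"
  proof -
    have "\<beta> * v \<le> exp (\<beta> * v) - 1" using exp_ge_add_one_self[of "\<beta> * v"] by linarith
    then show ?thesis using b by (simp add: pos_le_divide_eq mult.commute)
  qed
  have nb: "0 \<le> (exp (\<beta> * v) - 1) / \<beta>" using sb v by linarith
  have n2: "0 \<le> exp (2 * \<gamma> * v) - 1" using v b by simp
  consider "v \<le> \<epsilon>" | "\<epsilon> < v" "v \<le> K" | "\<epsilon> < v" "K < v" by linarith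
  then show ?thesis
  proof cases
    case 1
    have "1 - \<gamma> * v \<le> exp (- (\<gamma> * v))" using exp_ge_add_one_self[of "- (\<gamma> * v)"] by simp
    then have "(1 - \<gamma> * v) * exp (\<gamma> * v) \<le> exp (- (\<gamma> * v)) * exp (\<gamma> * v)" by (intro mult_right_mono) auto
    then have "exp (\<gamma> * v) - 1 \<le> \<gamma> * (v * exp (\<gamma> * v))" by (simp add: exp_minus_inverse algebra_simps exp_add[symmetric])
    then have "(exp (\<gamma> * v) - 1) / \<gamma> \<le> v * exp (\<gamma> * v)" using b by (simp add: pos_divide_le_eq mult.commute)
    also have "\<dots> \<le> ((exp (\<beta> * v) - 1) / \<beta>) * exp (\<gamma> * \<epsilon>)"
      using sb 1 b v nb by (intro mult_mono) auto
    finally show ?thesis using n2 b by (simp add: mult.commute add_increasing2)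
  next
    case 2
    have "exp (\<gamma> * v) - 1 \<le> exp (\<gamma> * K)" using 2 b by (simp add: add_increasing2 order_trans[of _ "exp (\<gamma> * v)"])
    also have "\<dots> \<le> exp (\<gamma> * K) * of_bool (\<epsilon> < v) + exp (- \<gamma> * K) * (exp (2 * \<gamma> * v) - 1)"
      using 2 n2 by simp
    finally have "(exp (\<gamma> * v) - 1) / \<gamma> \<le> (exp (\<gamma> * K) * of_bool (\<epsilon> < v) + exp (- \<gamma> * K) * (exp (2 * \<gamma> * v) - 1)) / \<gamma>"
      using b by (intro divide_right_mono) auto
    then show ?thesis using nb by (rule add_increasing[OF mult_nonneg_nonneg[OF exp_ge_zero], rotated])
  next
    case 3
    have "1 * (exp (\<gamma> * v) - 1) \<le> (exp (- \<gamma> * K) * (exp (\<gamma> * v) + 1)) * (exp (\<gamma> * v) - 1)"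
    proof (rule mult_right_mono)
      have "1 = exp (- \<gamma> * K) * exp (\<gamma> * K)" by (simp add: exp_add[symmetric])
      also have "\<dots> \<le> exp (- \<gamma> * K) * (exp (\<gamma> * v) + 1)"
        using 3 b by (intro mult_left_mono) (auto intro: add_increasing2)
      finally show "1 \<le> exp (- \<gamma> * K) * (exp (\<gamma> * v) + 1)" .
      show "0 \<le> exp (\<gamma> * v) - 1" using b v by simp
    qed
    also have "\<dots> = exp (- \<gamma> * K) * (exp (2 * \<gamma> * v) - 1)"
    proof -
      have "exp (2 * \<gamma> * v) = exp (\<gamma> * v) * exp (\<gamma> * v)" by (simp add: exp_add[symmetric])
      then show ?thesis by (simp add: algebra_simps)
    qed
    also have "\<dots> \<le> exp (\<gamma> * K) * of_bool (\<epsilon> < v) + exp (- \<gamma> * K) * (exp (2 * \<gamma> * v) - 1)" by simp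
    finally have "(exp (\<gamma> * v) - 1) / \<gamma> \<le> (exp (\<gamma> * K) * of_bool (\<epsilon> < v) + exp (- \<gamma> * K) * (exp (2 * \<gamma> * v) - 1)) / \<gamma>"
      using b by (intro divide_right_mono) auto
    then show ?thesis using nb by (rule add_increasing[OF mult_nonneg_nonneg[OF exp_ge_zero], rotated])
  qed
qed

lemma pow2_exp_tendsto: "(\<lambda>n. 2 ^ n * (exp (a / 2 ^ n) - 1)) \<longlonglongrightarrow> (a::real)"
proof -
  have "((\<lambda>x. exp (a * x)) has_real_derivative a) (at 0)"
    by (auto intro!: derivative_eq_intros)
  then have "((\<lambda>x. (exp (a * x) - 1) / x) \<longlongrightarrow> a) (at 0)"
    by (simp add: has_field_derivative_iff)
  moreover have "filterlim (\<lambda>n. 1 / 2 ^ n) (at (0::real)) sequentially"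
    using LIMSEQ_power_zero[of "1/2 :: real"] by (simp add: filterlim_at power_one_over)
  ultimately have "(\<lambda>n. (exp (a * (1 / 2 ^ n)) - 1) / (1 / 2 ^ n)) \<longlonglongrightarrow> a" by (rule filterlim_compose)
  then show ?thesis by (simp add: mult.commute)
qed

section \<open>Limits of the rescaled overshoots and the derivative of the Laplace exponent at
  0\<close>

context regular_process begin

definition scaled_overshoot :: "nat \<Rightarrow> real \<Rightarrow> real" where
  "scaled_overshoot n \<beta> = 2 ^ n * (\<integral>\<omega>. exp (\<beta> * overshoot n \<omega>) - 1 \<partial>M)"

lemma scaled_overshoot_tendsto:
  assumes "0 < \<beta>"
  shows "(\<lambda>n. scaled_overshoot n \<beta>) \<longlonglongrightarrow> laplace_exponent M X \<beta> * inf_lap \<beta>"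
proof -
  have "(\<lambda>n. (2 ^ n * (exp (laplace_exponent M X \<beta> / 2 ^ n) - 1)) * grid_lap n \<beta>) \<longlonglongrightarrow> laplace_exponent M X \<beta> * inf_lap \<beta>"
    by (intro tendsto_mult pow2_exp_tendsto grid_lap_tendsto assms)
  then show ?thesis by (simp add: scaled_overshoot_def overshoot_identity[OF assms] mult.assoc)
qed

text \<open>As \<open>h\<close> tends to 0 the overshoots become small, so \<open>exp (\<beta> v) - 1\<close> may be replaced by \<open>\<beta> v\<close>. Hence
  the limit of \<open>scaled_overshoot\<close> is linear in the exponent, without any first moment assumption.\<close>

lemma scaled_overshoot_compare:
  assumes b: "0 < \<beta>" "0 < \<gamma>"
  shows "laplace_exponent M X \<gamma> * inf_lap \<gamma> / \<gamma> \<le> laplace_exponent M X \<beta> * inf_lap \<beta> / \<beta>"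
proof -
  let ?r = "\<lambda>\<beta>. laplace_exponent M X \<beta> * inf_lap \<beta>"
  let ?P = "\<lambda>n \<epsilon>. prob {\<omega>\<in>space M. \<epsilon> < X (1 / 2 ^ n) \<omega>}"
  have fin: "scaled_overshoot n \<gamma> / \<gamma> \<le> exp (\<gamma> * \<epsilon>) * (scaled_overshoot n \<beta> / \<beta>) +
      (exp (\<gamma> * K) * (2 ^ n * ?P n \<epsilon>) + exp (- \<gamma> * K) * scaled_overshoot n (2 * \<gamma>)) / \<gamma>" if "0 < \<epsilon>" for n \<epsilon> K
  proof -
    let ?V = "overshoot n"
    have i: "integrable M (\<lambda>\<omega>. exp (\<beta> * ?V \<omega>) - 1)" if "0 < \<beta>" for \<beta>
      using that by (intro Bochner_Integration.integrable_diff exp_overshoot_integrable integrable_const)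
    have ib: "integrable M (\<lambda>\<omega>. of_bool (\<epsilon> < ?V \<omega>) :: real)"
      by (rule Bochner_Integration.integrable_bound[of _ "\<lambda>_. 1 :: real"]) auto
    have "(\<integral>\<omega>. (exp (\<gamma> * ?V \<omega>) - 1) / \<gamma> \<partial>M) \<le> (\<integral>\<omega>. exp (\<gamma> * \<epsilon>) * ((exp (\<beta> * ?V \<omega>) - 1) / \<beta>) +
       (exp (\<gamma> * K) * of_bool (\<epsilon> < ?V \<omega>) + exp (- \<gamma> * K) * (exp (2 * \<gamma> * ?V \<omega>) - 1)) / \<gamma> \<partial>M)"
      using b by (intro integral_mono exp_difference_quotient_bound overshoot_nonneg Bochner_Integration.integrable_add
          integrable_mult_right integrable_divide_zero i ib) auto
    also have "\<dots> = exp (\<gamma> * \<epsilon>) * ((\<integral>\<omega>. exp (\<beta> * ?V \<omega>) - 1 \<partial>M) / \<beta>) +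
       (exp (\<gamma> * K) * (\<integral>\<omega>. of_bool (\<epsilon> < ?V \<omega>) \<partial>M) + exp (- \<gamma> * K) * (\<integral>\<omega>. exp (2 * \<gamma> * ?V \<omega>) - 1 \<partial>M)) / \<gamma>"
    proof -
      note i' = i[OF b(1)] i[of "2 * \<gamma>"] ib
      show ?thesis
        using b i' by (simp add: Bochner_Integration.integral_add Bochner_Integration.integrable_add integrable_mult_right
            integrable_divide_zero del: Bochner_Integration.integral_diff)
    qed
    also have "(\<integral>\<omega>. of_bool (\<epsilon> < ?V \<omega>) \<partial>M) = prob {\<omega>\<in>space M. \<epsilon> < ?V \<omega>}"
    proof -
      have "(\<integral>\<omega>. of_bool (\<epsilon> < ?V \<omega>) \<partial>M) = (\<integral>\<omega>. indicator {\<omega>\<in>space M. \<epsilon> < ?V \<omega>} \<omega> \<partial>M)"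
        by (rule Bochner_Integration.integral_cong) (auto simp: indicator_def)
      also have "\<dots> = measure M ({\<omega>\<in>space M. \<epsilon> < ?V \<omega>} \<inter> space M)" by (rule Bochner_Integration.integral_indicator)
      also have "{\<omega>\<in>space M. \<epsilon> < ?V \<omega>} \<inter> space M = {\<omega>\<in>space M. \<epsilon> < ?V \<omega>}" by auto
      finally show ?thesis .
    qed
    finally have *: "2 ^ n * ((\<integral>\<omega>. (exp (\<gamma> * ?V \<omega>) - 1) / \<gamma> \<partial>M)) \<le> 2 ^ n * (exp (\<gamma> * \<epsilon>) * ((\<integral>\<omega>. exp (\<beta> * ?V \<omega>) - 1 \<partial>M) / \<beta>) +
       (exp (\<gamma> * K) * prob {\<omega>\<in>space M. \<epsilon> < ?V \<omega>} + exp (- \<gamma> * K) * (\<integral>\<omega>. exp (2 * \<gamma> * ?V \<omega>) - 1 \<partial>M)) / \<gamma>)"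
      by (intro mult_left_mono) auto
    have Xm: "{\<omega>\<in>space M. \<epsilon> < X (1 / 2 ^ n) \<omega>} \<in> events" using rv[of "1 / 2 ^ n"] by measurable
    have "prob {\<omega>\<in>space M. \<epsilon> < ?V \<omega>} \<le> ?P n \<epsilon>"
    proof (rule finite_measure_mono[OF subsetI Xm])
      fix \<omega> assume "\<omega> \<in> {\<omega>\<in>space M. \<epsilon> < ?V \<omega>}"
      then show "\<omega> \<in> {\<omega>\<in>space M. \<epsilon> < X (1 / 2 ^ n) \<omega>}"
        using overshoot_le[of \<omega> n] that by auto
    qed
    then have "exp (\<gamma> * K) * (2 ^ n * prob {\<omega>\<in>space M. \<epsilon> < ?V \<omega>}) / \<gamma> \<le> exp (\<gamma> * K) * (2 ^ n * ?P n \<epsilon>) / \<gamma>"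
      using b by (intro divide_right_mono mult_left_mono) auto
    moreover have "scaled_overshoot n \<gamma> / \<gamma> = 2 ^ n * ((\<integral>\<omega>. (exp (\<gamma> * ?V \<omega>) - 1) / \<gamma> \<partial>M))"
      by (simp add: scaled_overshoot_def)
    ultimately show ?thesis using *
      by (simp add: scaled_overshoot_def ring_distribs add_divide_distrib mult_ac)
  qed
  \<comment> \<open>\<open>prob_grid_increment_gt\<close> removes the middle regime, and the large
    overshoots are controlled by the finite limit of \<open>scaled_overshoot\<close> at
    \<open>2 * \<gamma>\<close>.\<close>
  have lim: "?r \<gamma> / \<gamma> \<le> exp (\<gamma> * \<epsilon>) * (?r \<beta> / \<beta>) + (exp (\<gamma> * K) * 0 + exp (- \<gamma> * K) * ?r (2 * \<gamma>)) / \<gamma>"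
    if e: "0 < \<epsilon>" for \<epsilon> K
  proof (rule LIMSEQ_le)
    show "(\<lambda>n. scaled_overshoot n \<gamma> / \<gamma>) \<longlonglongrightarrow> ?r \<gamma> / \<gamma>"
      using b by (intro tendsto_divide tendsto_const scaled_overshoot_tendsto) auto
    show "(\<lambda>n. exp (\<gamma> * \<epsilon>) * (scaled_overshoot n \<beta> / \<beta>) +
      (exp (\<gamma> * K) * (2 ^ n * ?P n \<epsilon>) + exp (- \<gamma> * K) * scaled_overshoot n (2 * \<gamma>)) / \<gamma>)
      \<longlonglongrightarrow> exp (\<gamma> * \<epsilon>) * (?r \<beta> / \<beta>) + (exp (\<gamma> * K) * 0 + exp (- \<gamma> * K) * ?r (2 * \<gamma>)) / \<gamma>"
      using b e by (intro tendsto_add tendsto_mult tendsto_divide tendsto_const scaled_overshoot_tendsto prob_grid_increment_gt) auto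
  qed (use fin[OF e] in blast)
  \<comment> \<open>After the limit in \<open>n\<close>, the growing factor
    \<open>exp (\<gamma> * K)\<close> is multiplied by 0, so \<open>\<epsilon>\<close> can tend to 0
    and \<open>K\<close> to infinity along the same index.\<close>
  show ?thesis
  proof (rule LIMSEQ_le[OF tendsto_const])
    have "filterlim (\<lambda>k. \<gamma> * real k) at_top sequentially"
      using b by (intro filterlim_tendsto_pos_mult_at_top[OF tendsto_const] filterlim_real_sequentially)
    then have "(\<lambda>k. exp (- (\<gamma> * real k))) \<longlonglongrightarrow> 0"
      by (intro filterlim_compose[OF exp_at_bot] filterlim_compose[OF filterlim_uminus_at_bot_at_top])
    then have 1: "(\<lambda>k. exp (- \<gamma> * real k)) \<longlonglongrightarrow> 0" by simp
    have "(\<lambda>k. exp (\<gamma> * inverse (real (Suc k)))) \<longlonglongrightarrow> exp (\<gamma> * 0)"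
      by (intro tendsto_intros LIMSEQ_inverse_real_of_nat)
    then have 2: "(\<lambda>k. exp (\<gamma> * inverse (real (Suc k)))) \<longlonglongrightarrow> 1" by simp
    have "(\<lambda>k. exp (\<gamma> * inverse (real (Suc k))) * (?r \<beta> / \<beta>) + (exp (\<gamma> * real k) * 0 + exp (- \<gamma> * real k) * ?r (2 * \<gamma>)) / \<gamma>)
      \<longlonglongrightarrow> 1 * (?r \<beta> / \<beta>) + (0 + 0 * ?r (2 * \<gamma>)) / \<gamma>"
      using b by (intro tendsto_add tendsto_mult tendsto_divide tendsto_const 1 2) auto
    then show "(\<lambda>k. exp (\<gamma> * inverse (real (Suc k))) * (?r \<beta> / \<beta>) + (exp (\<gamma> * real k) * 0 + exp (- \<gamma> * real k) * ?r (2 * \<gamma>)) / \<gamma>)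
      \<longlonglongrightarrow> ?r \<beta> / \<beta>" by simp
    show "\<exists>N. \<forall>n\<ge>N. ?r \<gamma> / \<gamma> \<le> exp (\<gamma> * inverse (real (Suc n))) * (?r \<beta> / \<beta>) + (exp (\<gamma> * real n) * 0 + exp (- \<gamma> * real n) * ?r (2 * \<gamma>)) / \<gamma>"
      by (intro exI[of _ 0] allI impI lim) simp
  qed
qed

text \<open>The value at \<open>\<beta> = 1\<close> of a quotient that does not depend on
  \<open>\<beta>\<close>; \<open>right_deriv_exponent\<close> identifies it with the right
  derivative of the Laplace exponent at 0.\<close>

definition drift :: real where "drift = laplace_exponent M X 1 * inf_lap 1"

lemma exponent_inf_lap:
  assumes "0 < \<beta>"
  shows "laplace_exponent M X \<beta> * inf_lap \<beta> = drift * \<beta>"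
proof -
  have "laplace_exponent M X \<beta> * inf_lap \<beta> / \<beta> = drift"
    using scaled_overshoot_compare[of \<beta> 1] scaled_overshoot_compare[of 1 \<beta>] assms by (simp add: drift_def)
  then show ?thesis using assms by (simp add: field_simps)
qed

lemma inf_lap_pos:
  assumes "0 < \<beta>" shows "0 < inf_lap \<beta>"
proof -
  have int: "integrable M (\<lambda>\<omega>. exp (\<beta> * path_inf (future 0 \<omega>)))"
  proof (rule Bochner_Integration.integrable_bound[of _ "\<lambda>_. 1 :: real"])
    show "AE \<omega> in M. norm (exp (\<beta> * path_inf (future 0 \<omega>))) \<le> norm (1::real)"
      using assms by (intro AE_I2) (simp add: mult_nonneg_nonpos path_inf_le_0)
  qed auto
  have "inf_lap \<beta> \<noteq> 0" unfolding inf_lap_def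
    using integral_nonneg_eq_0_iff_AE[OF int] by (simp add: AE_False)
  moreover have "0 \<le> inf_lap \<beta>" unfolding inf_lap_def by (rule integral_nonneg_AE) simp
  ultimately show ?thesis by linarith
qed

lemma inf_lap_tendsto_1: "(inf_lap \<longlongrightarrow> 1) (at_right 0)"
proof (rule tendsto_at_right_sequentially[of 0 1])
  fix S :: "nat \<Rightarrow> real" assume S: "\<And>n. 0 < S n" "S \<longlonglongrightarrow> 0"
  have "(\<lambda>n. \<integral>\<omega>. exp (S n * path_inf (future 0 \<omega>)) \<partial>M) \<longlonglongrightarrow> (\<integral>\<omega>. 1 \<partial>M)"
  proof (rule integral_dominated_convergence[where w = "\<lambda>_. 1"])
    show "AE \<omega> in M. (\<lambda>n. exp (S n * path_inf (future 0 \<omega>))) \<longlonglongrightarrow> 1"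
    proof (rule AE_I2)
      fix \<omega>
      have "(\<lambda>n. exp (S n * path_inf (future 0 \<omega>))) \<longlonglongrightarrow> exp (0 * path_inf (future 0 \<omega>))"
        by (intro tendsto_intros S)
      then show "(\<lambda>n. exp (S n * path_inf (future 0 \<omega>))) \<longlonglongrightarrow> 1" by simp
    qed
    show "AE \<omega> in M. norm (exp (S n * path_inf (future 0 \<omega>))) \<le> 1" for n
      using S(1)[of n] by (intro AE_I2) (simp add: mult_nonneg_nonpos path_inf_le_0)
  qed auto
  then show "(\<lambda>n. inf_lap (S n)) \<longlonglongrightarrow> 1" by (simp add: inf_lap_def prob_space)
qed simp

lemma exponent_eq: "0 < \<beta> \<Longrightarrow> laplace_exponent M X \<beta> = drift * \<beta> / inf_lap \<beta>"
  using exponent_inf_lap[of \<beta>] inf_lap_pos[of \<beta>] by (simp add: field_simps)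

lemma exponent_0: "laplace_exponent M X 0 = 0"
  by (simp add: laplace_exponent_def prob_space)

text \<open>The difference quotient at 0 is \<open>drift / inf_lap \<beta>\<close>, and
  \<open>inf_lap\<close> tends to 1; nothing is differentiated under the expectation.\<close>

lemma right_deriv_exponent: "right_deriv (laplace_exponent M X) 0 = drift"
proof -
  have "((\<lambda>\<beta>. drift / inf_lap \<beta>) \<longlongrightarrow> drift / 1) (at_right 0)"
    by (intro tendsto_intros inf_lap_tendsto_1) simp
  moreover have "eventually (\<lambda>\<beta>. drift / inf_lap \<beta> = (laplace_exponent M X \<beta> - laplace_exponent M X 0) / (\<beta> - 0)) (at_right 0)"
    using eventually_at_right_less[of "0::real"] by eventually_elim (simp add: exponent_eq exponent_0)
  ultimately have "((\<lambda>\<beta>. (laplace_exponent M X \<beta> - laplace_exponent M X 0) / (\<beta> - 0)) \<longlongrightarrow> drift) (at_right 0)"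
    by (simp add: tendsto_cong)
  then have "(laplace_exponent M X has_vector_derivative drift) (at_right 0)"
    by (simp add: has_field_derivative_iff has_real_derivative_iff_has_vector_derivative[symmetric])
  then show ?thesis unfolding right_deriv_def
    by (intro vector_derivative_within) (auto simp: trivial_limit_at_right_real)
qed

text \<open>If \<open>drift\<close> were not positive, the exponential moments of \<open>X 1\<close>
  would be at most 1 for all \<open>\<beta> > 0\<close>. By the Markov inequality \<open>X 1\<close>
  would then exceed no \<open>\<epsilon> > 0\<close> with positive probability, contradicting
  \<open>not_AE_nonpos\<close>.\<close>

lemma drift_pos: "0 < drift"
proof -
  have exp_le: "exp (\<beta> * \<epsilon>) * prob {\<omega>\<in>space M. \<epsilon> < X 1 \<omega>} \<le> exp (laplace_exponent M X \<beta>)" if "0 < \<beta>" for \<beta> \<epsilon>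
  proof -
    have Xm: "{\<omega>\<in>space M. \<epsilon> < X 1 \<omega>} \<in> events" using rv[of 1] by measurable
    have "exp (\<beta> * \<epsilon>) * prob {\<omega>\<in>space M. \<epsilon> < X 1 \<omega>} = (\<integral>\<omega>. exp (\<beta> * \<epsilon>) * indicator {\<omega>\<in>space M. \<epsilon> < X 1 \<omega>} \<omega> \<partial>M)"
      using Xm by simp
    also have "\<dots> \<le> (\<integral>\<omega>. exp (\<beta> * X 1 \<omega>) \<partial>M)"
    proof (rule integral_mono)
      show "integrable M (\<lambda>\<omega>. exp (\<beta> * X 1 \<omega>))" using exp_integrable[OF that, of 0] by simp
      show "integrable M (\<lambda>\<omega>. exp (\<beta> * \<epsilon>) * indicator {\<omega>\<in>space M. \<epsilon> < X 1 \<omega>} \<omega>)"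
        using Xm by (intro integrable_mult_right integrable_real_indicator) (auto simp: emeasure_eq_measure)
    qed (use that in \<open>auto simp: indicator_def\<close>)
    also have "\<dots> = exp (laplace_exponent M X \<beta>)" using exp_moment_eq[OF that, of 0] by simp
    finally show ?thesis .
  qed
  have "drift > 0"
  proof (rule ccontr)
    assume "\<not> drift > 0"
    then have neg: "laplace_exponent M X \<beta> \<le> 0" if "0 < \<beta>" for \<beta>
      using exponent_eq[OF that] inf_lap_pos[OF that] that by (simp add: divide_nonpos_pos mult_nonpos_nonneg)
    have zero: "prob {\<omega>\<in>space M. \<epsilon> < X 1 \<omega>} = 0" if e: "0 < \<epsilon>" for \<epsilon>
    proof (rule ccontr)
      let ?p = "prob {\<omega>\<in>space M. \<epsilon> < X 1 \<omega>}"
      assume "?p \<noteq> 0"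
      then have p: "0 < ?p" using measure_nonneg[of M "{\<omega>\<in>space M. \<epsilon> < X 1 \<omega>}"] by linarith
      \<comment> \<open>Chosen so that \<open>(1 + \<beta> * \<epsilon>) * ?p = ?p + 1\<close>,
        which exceeds the bound 1.\<close>
      define \<beta> where "\<beta> = 1 / (?p * \<epsilon>)"
      have b: "0 < \<beta>" using p e by (simp add: \<beta>_def)
      have "exp (\<beta> * \<epsilon>) * ?p \<le> 1" using exp_le[OF b, of \<epsilon>] neg[OF b] by (simp add: order_trans[of _ "exp (laplace_exponent M X \<beta>)"])
      moreover have "1 + \<beta> * \<epsilon> \<le> exp (\<beta> * \<epsilon>)" by (rule exp_ge_add_one_self)
      then have "(1 + \<beta> * \<epsilon>) * ?p \<le> exp (\<beta> * \<epsilon>) * ?p" using p by (intro mult_right_mono) auto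
      ultimately have "(1 + \<beta> * \<epsilon>) * ?p \<le> 1" by linarith
      moreover have "(1 + \<beta> * \<epsilon>) * ?p = ?p + 1" using p e by (simp add: \<beta>_def field_simps)
      ultimately show False using p by linarith
    qed
    have "AE \<omega> in M. X 1 \<omega> \<le> 1 / real (Suc n)" for n
    proof -
      have Xm: "{\<omega>\<in>space M. 1 / real (Suc n) < X 1 \<omega>} \<in> events" using rv[of 1] by measurable
      then have "{\<omega>\<in>space M. 1 / real (Suc n) < X 1 \<omega>} \<in> null_sets M"
        using zero[of "1 / real (Suc n)"] by (intro null_setsI) (auto simp: emeasure_eq_measure)
      from AE_not_in[OF this] show ?thesis
        by (rule AE_mp) (intro AE_I2, auto simp: not_less)
    qed
    then have "AE \<omega> in M. \<forall>n. X 1 \<omega> \<le> 1 / real (Suc n)" by (simp add: AE_all_countable)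
    then have "AE \<omega> in M. X 1 \<omega> \<le> 0"
    proof (rule AE_mp, intro AE_I2 impI)
      fix \<omega> assume *: "\<forall>n. X 1 \<omega> \<le> 1 / real (Suc n)"
      have "(\<lambda>n. 1 / real (Suc n)) \<longlonglongrightarrow> 0" using LIMSEQ_inverse_real_of_nat by (simp add: inverse_eq_divide)
      then show "X 1 \<omega> \<le> 0" using * by (intro LIMSEQ_le_const) auto
    qed
    then show False using not_AE_nonpos[of 1] by simp
  qed
  then show ?thesis .
qed

lemma exponent_pos: "0 < \<beta> \<Longrightarrow> 0 < laplace_exponent M X \<beta>"
  using drift_pos inf_lap_pos[of \<beta>] by (simp add: exponent_eq)

text \<open>Hence the supremum in \<open>is_scale_function\<close> is 0, and its Laplace identity is
  available for every \<open>\<beta> > 0\<close>.\<close>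

lemma exponent_zeros: "{\<beta>. 0 \<le> \<beta> \<and> laplace_exponent M X \<beta> = 0} = {0}"
proof -
  have "\<beta> = 0" if "0 \<le> \<beta>" "laplace_exponent M X \<beta> = 0" for \<beta>
    using that exponent_pos[of \<beta>] by (cases "\<beta> = 0") auto
  then show ?thesis using exponent_0 by auto
qed

end

section \<open>Identification of the scale function\<close>

lemma nn_integral_exp_atLeast:
  fixes \<beta> :: real
  assumes b: "0 < \<beta>"
  shows "(\<integral>\<^sup>+x. ennreal (exp (- \<beta> * x)) * indicator {a..} x \<partial>lborel) = ennreal (exp (- \<beta> * a) / \<beta>)"
proof -
  have "((\<lambda>x. - exp (- \<beta> * x) / \<beta>) \<longlongrightarrow> - 0 / \<beta>) at_top"
  proof (intro tendsto_divide tendsto_minus tendsto_const)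
    have "filterlim (\<lambda>x. \<beta> * x) at_top at_top"
      using b by (intro filterlim_tendsto_pos_mult_at_top[OF tendsto_const _ filterlim_ident])
    then have "((\<lambda>x. exp (- (\<beta> * x))) \<longlongrightarrow> 0) at_top"
      by (intro filterlim_compose[OF exp_at_bot] filterlim_compose[OF filterlim_uminus_at_bot_at_top])
    then show "((\<lambda>x. exp (- \<beta> * x)) \<longlongrightarrow> 0) at_top" by simp
  qed (use b in auto)
  then have lim: "((\<lambda>x. - exp (- \<beta> * x) / \<beta>) \<longlongrightarrow> 0) at_top" by simp
  have "(\<integral>\<^sup>+x. ennreal (exp (- \<beta> * x)) * indicator {a..} x \<partial>lborel) = ennreal (0 - (- exp (- \<beta> * a) / \<beta>))"
    by (rule nn_integral_FTC_atLeast[OF _ _ _ lim]) (use b in \<open>auto intro!: derivative_eq_intros\<close>)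
  then show ?thesis by simp
qed

lemma exp_has_integral_atLeast:
  fixes \<beta> :: real
  assumes b: "0 < \<beta>"
  shows "((\<lambda>x. exp (- \<beta> * x)) has_integral 1 / \<beta>) {0..}"
proof -
  have "((\<lambda>x. if x \<in> {0..} then exp (- \<beta> * x) else 0) has_integral 1 / \<beta>) UNIV"
  proof (rule nn_integral_has_integral)
    show "(\<integral>\<^sup>+x. ennreal (if x \<in> {0..} then exp (- \<beta> * x) else 0) \<partial>lborel) = ennreal (1 / \<beta>)"
    proof -
      have "(\<integral>\<^sup>+x. ennreal (if x \<in> {0..} then exp (- \<beta> * x) else 0) \<partial>lborel) =
          (\<integral>\<^sup>+x. ennreal (exp (- \<beta> * x)) * indicator {0..} x \<partial>lborel)"
        by (rule nn_integral_cong) (simp add: indicator_def)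
      then show ?thesis using nn_integral_exp_atLeast[OF b, of 0] by simp
    qed
  qed (use b in auto)
  then show ?thesis by (simp only: has_integral_restrict_UNIV)
qed

text \<open>Weierstrass approximation in the variable \<open>exp (- x)\<close>.\<close>

lemma exp_moments_zero:
  fixes G :: "real \<Rightarrow> real"
  assumes G: "integrable lborel G" and neg: "\<And>x. x < 0 \<Longrightarrow> G x = 0"
    and mom: "\<And>k::nat. (\<integral>x. exp (- x) ^ k * G x \<partial>lborel) = 0"
  shows "(\<integral>x. indicator {..<y} x * G x \<partial>lborel) = 0"
proof -
  define a where "a = exp (- y)"
  \<comment> \<open>Continuous ramps in the variable \<open>u = exp (- x)\<close> that increase to
    the indicator of \<open>u > a\<close>, which is the condition \<open>x < y\<close>.\<close>
  define \<phi> where "\<phi> m u = max 0 (min 1 (real m * (u - a)))" for m :: nat and u :: real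
  have cont: "continuous_on {0..1} (\<phi> m)" for m unfolding \<phi>_def
    by (intro continuous_on_max continuous_on_min continuous_on_mult continuous_on_diff continuous_on_const continuous_on_id)
  have ex: "\<forall>m. \<exists>g. real_polynomial_function g \<and> (\<forall>x\<in>{0..1}. \<bar>\<phi> m x - g x\<bar> < 1 / real (Suc m))"
  proof
    fix m :: nat
    have "0 < 1 / real (Suc m)" by simp
    obtain p where "real_polynomial_function p" "\<And>x. x \<in> {0..1} \<Longrightarrow> \<bar>\<phi> m x - p x\<bar> < 1 / real (Suc m)"
      by (rule Stone_Weierstrass_real_polynomial_function[OF compact_Icc cont[of m] \<open>0 < 1 / real (Suc m)\<close>]) (rule that)
    then show "\<exists>g. real_polynomial_function g \<and> (\<forall>x\<in>{0..1}. \<bar>\<phi> m x - g x\<bar> < 1 / real (Suc m))" by blast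
  qed
  obtain g where "\<forall>m. real_polynomial_function (g m) \<and> (\<forall>x\<in>{0..1}. \<bar>\<phi> m x - g m x\<bar> < 1 / real (Suc m))"
    using choice[OF ex] by (elim exE)
  then have g: "\<And>m. real_polynomial_function (g m)"
    "\<And>m. \<forall>x\<in>{0..1}. \<bar>\<phi> m x - g m x\<bar> < 1 / real (Suc m)" by blast+
  have gint: "(\<integral>x. g m (exp (- x)) * G x \<partial>lborel) = 0" for m
  proof -
    obtain c n where c: "g m = (\<lambda>x. \<Sum>i\<le>n. c i * x ^ i)"
      using g(1)[of m] unfolding real_polynomial_function_iff_sum by blast
    have int: "integrable lborel (\<lambda>x. exp (- x) ^ i * G x)" for i
    proof (rule Bochner_Integration.integrable_bound[OF G])
      show "AE x in lborel. norm (exp (- x) ^ i * G x) \<le> norm (G x)"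
      proof (rule AE_I2)
        fix x :: real
        show "norm (exp (- x) ^ i * G x) \<le> norm (G x)"
        proof (cases "x < 0")
          case False
          then have "exp (- x) ^ i \<le> 1" by (intro power_le_one) auto
          then show ?thesis unfolding real_norm_def abs_mult by (intro mult_left_le_one_le) auto
        qed (simp add: neg)
      qed
    qed (use borel_measurable_integrable[OF G] in measurable)
    have "(\<integral>x. g m (exp (- x)) * G x \<partial>lborel) = (\<integral>x. (\<Sum>i\<le>n. c i * (exp (- x) ^ i * G x)) \<partial>lborel)"
      by (simp add: c sum_distrib_right mult.assoc)
    also have "\<dots> = (\<Sum>i\<le>n. c i * (\<integral>x. exp (- x) ^ i * G x \<partial>lborel))"
      using int by (subst Bochner_Integration.integral_sum) auto
    finally show ?thesis by (simp add: mom)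
  qed
  have gm: "(\<lambda>x. g m (exp (- x))) \<in> borel_measurable borel" for m
  proof -
    obtain c n where c: "g m = (\<lambda>x. \<Sum>i\<le>n. c i * x ^ i)"
      using g(1)[of m] unfolding real_polynomial_function_iff_sum by blast
    show ?thesis unfolding c by measurable
  qed
  have "(\<lambda>m. \<integral>x. g m (exp (- x)) * G x \<partial>lborel) \<longlonglongrightarrow> (\<integral>x. indicator {..<y} x * G x \<partial>lborel)"
  \<comment> \<open>The constant 2 bounds \<open>\<bar>g m\<bar>\<close>: the ramp is at most 1 and
    the approximation error at most \<open>1 / real (Suc m) \<le> 1\<close>.\<close>
  proof (rule integral_dominated_convergence[where w = "\<lambda>x. 2 * norm (G x)"])
    show "integrable lborel (\<lambda>x. 2 * norm (G x))" using G by auto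
    show "AE x in lborel. norm (g m (exp (- x)) * G x) \<le> 2 * norm (G x)" for m
    proof (rule AE_I2)
      fix x :: real
      show "norm (g m (exp (- x)) * G x) \<le> 2 * norm (G x)"
      proof (cases "x < 0")
        case False
        then have "exp (- x) \<in> {0..1}" by auto
        from bspec[OF g(2)[of m] this] have "\<bar>\<phi> m (exp (- x)) - g m (exp (- x))\<bar> < 1 / real (Suc m)" .
        moreover have "1 / real (Suc m) \<le> 1" by simp
        moreover have "0 \<le> \<phi> m (exp (- x))" "\<phi> m (exp (- x)) \<le> 1" by (simp_all add: \<phi>_def)
        ultimately have "\<bar>g m (exp (- x))\<bar> \<le> 2" by linarith
        then show ?thesis unfolding real_norm_def abs_mult by (rule mult_right_mono) simp
      qed (simp add: neg)
    qed
    show "AE x in lborel. (\<lambda>m. g m (exp (- x)) * G x) \<longlonglongrightarrow> indicator {..<y} x * G x"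
    proof (rule AE_I2)
      fix x :: real
      show "(\<lambda>m. g m (exp (- x)) * G x) \<longlonglongrightarrow> indicator {..<y} x * G x"
      proof (cases "x < 0")
        case False
        then have ex: "exp (- x) \<in> {0..1}" by auto
        have l0: "(\<lambda>m. 1 / real (Suc m)) \<longlonglongrightarrow> 0"
          using LIMSEQ_inverse_real_of_nat by (simp add: inverse_eq_divide)
        have "(\<lambda>m. \<phi> m (exp (- x)) - g m (exp (- x))) \<longlonglongrightarrow> 0"
          by (rule Lim_null_comparison[OF always_eventually l0]) (intro allI, unfold real_norm_def, rule less_imp_le, rule bspec[OF g(2) ex])
        moreover have "(\<lambda>m. \<phi> m (exp (- x))) \<longlonglongrightarrow> indicator {..<y} x"
        proof (cases "x < y")
          case True
          then have pos: "0 < exp (- x) - a" by (simp add: a_def)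
          obtain N :: nat where N: "1 / (exp (- x) - a) < real N" using reals_Archimedean2 by blast
          have "\<phi> m (exp (- x)) = 1" if "m \<ge> N" for m
          proof -
            have "1 / (exp (- x) - a) < real m" using N that by (meson less_le_trans of_nat_le_iff)
            then have "1 < real m * (exp (- x) - a)" using pos by (simp add: pos_divide_less_eq)
            then show ?thesis by (simp add: \<phi>_def)
          qed
          then have "eventually (\<lambda>m. \<phi> m (exp (- x)) = 1) sequentially" by (auto simp: eventually_sequentially)
          then show ?thesis using True by (simp add: tendsto_eventually)
        next
          case False
          then have "exp (- x) \<le> a" by (simp add: a_def)
          have "\<phi> m (exp (- x)) = 0" for m
          proof -
            have "real m * (exp (- x) - a) \<le> 0" using \<open>exp (- x) \<le> a\<close> by (intro mult_nonneg_nonpos) auto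
            then show ?thesis by (simp add: \<phi>_def)
          qed
          then show ?thesis using False by simp
        qed
        ultimately have "(\<lambda>m. \<phi> m (exp (- x)) - (\<phi> m (exp (- x)) - g m (exp (- x)))) \<longlonglongrightarrow> indicator {..<y} x - 0"
          by (intro tendsto_diff)
        then have "(\<lambda>m. g m (exp (- x))) \<longlonglongrightarrow> indicator {..<y} x" by simp
        then show ?thesis by (rule tendsto_mult_right)
      qed (simp add: neg)
    qed
  qed (use borel_measurable_integrable[OF G] gm in measurable)
  then have "(\<lambda>m. 0 :: real) \<longlonglongrightarrow> (\<integral>x. indicator {..<y} x * G x \<partial>lborel)" by (simp add: gint)
  then show ?thesis by (simp add: LIMSEQ_const_iff)
qed

context regular_process begin

definition inf_tail :: "real \<Rightarrow> real" where
  "inf_tail x = prob {\<omega>\<in>space M. - x < path_inf (future 0 \<omega>)}"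

lemma inf_tail_mono: "mono inf_tail"
  unfolding inf_tail_def by (intro monoI finite_measure_mono) auto

lemma inf_tail_measurable [measurable]: "inf_tail \<in> borel_measurable borel"
  by (rule borel_measurable_mono[OF inf_tail_mono])

text \<open>Tonelli: for fixed \<open>\<omega>\<close> the condition on \<open>x\<close> is
  \<open>x > - I\<close>, and integrating \<open>exp (- \<beta> * x)\<close> over that half-line
  gives \<open>exp (\<beta> * I) / \<beta>\<close>. The endpoint is a Lebesgue null set.\<close>

lemma inf_tail_laplace:
  assumes b: "0 < \<beta>"
  shows "(\<integral>\<^sup>+x. ennreal (indicator {0..} x * (exp (- \<beta> * x) * inf_tail x)) \<partial>lborel) = ennreal (inf_lap \<beta> / \<beta>)"
proof -
  let ?I = "\<lambda>\<omega>. path_inf (future 0 \<omega>)"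
  have "(\<integral>\<^sup>+x. ennreal (indicator {0..} x * (exp (- \<beta> * x) * inf_tail x)) \<partial>lborel) =
      (\<integral>\<^sup>+x. (\<integral>\<^sup>+\<omega>. ennreal (exp (- \<beta> * x)) * (indicator {0..} x * indicator {- x<..} (?I \<omega>)) \<partial>M) \<partial>lborel)"
  proof (rule nn_integral_cong)
    fix x :: real
    have "(\<integral>\<^sup>+\<omega>. ennreal (exp (- \<beta> * x)) * (indicator {0..} x * indicator {- x<..} (?I \<omega>)) \<partial>M) =
      (\<integral>\<^sup>+\<omega>. (ennreal (exp (- \<beta> * x)) * indicator {0..} x) * indicator {\<omega>\<in>space M. - x < ?I \<omega>} \<omega> \<partial>M)"
      by (intro nn_integral_cong) (auto simp: indicator_def)
    also have "\<dots> = (ennreal (exp (- \<beta> * x)) * indicator {0..} x) * ennreal (inf_tail x)"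
      by (simp add: nn_integral_cmult_indicator inf_tail_def emeasure_eq_measure)
    also have "\<dots> = ennreal (indicator {0..} x * (exp (- \<beta> * x) * inf_tail x))"
      by (simp add: indicator_def ennreal_mult inf_tail_def)
    finally show "ennreal (indicator {0..} x * (exp (- \<beta> * x) * inf_tail x)) =
      (\<integral>\<^sup>+\<omega>. ennreal (exp (- \<beta> * x)) * (indicator {0..} x * indicator {- x<..} (?I \<omega>)) \<partial>M)" by simp
  qed
  also have "\<dots> = (\<integral>\<^sup>+\<omega>. (\<integral>\<^sup>+x. ennreal (exp (- \<beta> * x)) * (indicator {0..} x * indicator {- x<..} (?I \<omega>)) \<partial>lborel) \<partial>M)"
  proof -
    interpret L: pair_sigma_finite lborel M by unfold_locales
    have [measurable]: "(\<lambda>p. indicator {- fst p<..} (?I (snd p)) :: ennreal) \<in> borel_measurable (lborel \<Otimes>\<^sub>M M)"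
    proof -
      have "(\<lambda>p. indicator {- fst p<..} (?I (snd p)) :: ennreal) = indicator {p. - fst p < ?I (snd p)}"
        by (auto simp: indicator_def)
      moreover have "{p \<in> space (lborel \<Otimes>\<^sub>M M). - fst p < ?I (snd p)} \<in> sets (lborel \<Otimes>\<^sub>M M)" by measurable
      ultimately show ?thesis by (simp add: borel_measurable_indicator_iff Collect_conj_eq Int_commute)
    qed
    show ?thesis by (rule L.Fubini'[symmetric]) measurable
  qed
  also have "\<dots> = (\<integral>\<^sup>+\<omega>. ennreal (exp (\<beta> * ?I \<omega>) / \<beta>) \<partial>M)"
  proof (rule nn_integral_cong)
    fix \<omega> assume w: "\<omega> \<in> space M"
    have "(\<integral>\<^sup>+x. ennreal (exp (- \<beta> * x)) * (indicator {0..} x * indicator {- x<..} (?I \<omega>)) \<partial>lborel) =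
      (\<integral>\<^sup>+x. ennreal (exp (- \<beta> * x)) * indicator {- ?I \<omega>..} x \<partial>lborel)"
    proof (rule nn_integral_cong_AE)
      show "AE x in lborel. ennreal (exp (- \<beta> * x)) * (indicator {0..} x * indicator {- x<..} (?I \<omega>)) = ennreal (exp (- \<beta> * x)) * indicator {- ?I \<omega>..} x"
        using AE_lborel_singleton[of "- ?I \<omega>"]
        by eventually_elim (use path_inf_le_0[OF w] in \<open>auto simp: indicator_def\<close>)
    qed
    then show "(\<integral>\<^sup>+x. ennreal (exp (- \<beta> * x)) * (indicator {0..} x * indicator {- x<..} (?I \<omega>)) \<partial>lborel) = ennreal (exp (\<beta> * ?I \<omega>) / \<beta>)"
      using nn_integral_exp_atLeast[OF b, of "- ?I \<omega>"] by simp
  qed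
  also have "\<dots> = ennreal (inf_lap \<beta> / \<beta>)"
  proof -
    have "integrable M (\<lambda>\<omega>. exp (\<beta> * ?I \<omega>))"
    proof (rule Bochner_Integration.integrable_bound[of _ "\<lambda>_. 1 :: real"])
      show "AE \<omega> in M. norm (exp (\<beta> * path_inf (future 0 \<omega>))) \<le> norm (1::real)"
        using b by (intro AE_I2) (simp add: mult_nonneg_nonpos path_inf_le_0)
    qed auto
    then have "integrable M (\<lambda>\<omega>. exp (\<beta> * ?I \<omega>) / \<beta>)" by simp
    from nn_integral_eq_integral[OF this] b show ?thesis by (simp add: inf_lap_def)
  qed
  finally show ?thesis .
qed

text \<open>The integral in \<open>is_scale_function\<close> is a gauge integral and
  \<open>W\<close> comes without a sign, whereas the comparison with \<open>inf_tail\<close> needs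
  Lebesgue integrals. By monotonicity \<open>W x - W 0\<close> is nonnegative, so its integral
  transfers; the constant \<open>W 0\<close> is added back.\<close>

lemma scale_function_laplace:
  assumes W: "is_scale_function (laplace_exponent M X) W" and b: "0 < \<beta>"
  shows "integrable lborel (\<lambda>x. indicator {0..} x * (exp (- \<beta> * x) * W x))"
    and "(\<integral>x. indicator {0..} x * (exp (- \<beta> * x) * W x) \<partial>lborel) = 1 / laplace_exponent M X \<beta>"
proof -
  have mono: "0 \<le> W x - W 0" if "0 \<le> x" for x
    using W that by (cases "x = 0") (auto simp: is_scale_function_def strict_mono_on_def intro: less_imp_le)
  have "continuous_on {0..} W" using W by (simp add: is_scale_function_def)
  then have Wm: "(\<lambda>x. indicator {0..} x * W x) \<in> borel_measurable borel"
    using borel_measurable_continuous_on_indicator[of "{0..}" W] by simp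
  have hi: "((\<lambda>x. exp (- \<beta> * x) * W x) has_integral 1 / laplace_exponent M X \<beta>) {0..}"
    using W b unfolding is_scale_function_def exponent_zeros by simp
  have "((\<lambda>x. exp (- \<beta> * x) * W x - exp (- \<beta> * x) * W 0) has_integral 1 / laplace_exponent M X \<beta> - 1 / \<beta> * W 0) {0..}"
    by (intro has_integral_diff hi has_integral_mult_left exp_has_integral_atLeast b)
  then have hi': "((\<lambda>x. exp (- \<beta> * x) * (W x - W 0)) has_integral 1 / laplace_exponent M X \<beta> - 1 / \<beta> * W 0) {0..}"
    by (simp add: right_diff_distrib)
  let ?f = "\<lambda>x. indicator {0..} x * (exp (- \<beta> * x) * (W x - W 0))"
  let ?e = "\<lambda>x. indicator {0..} x * exp (- \<beta> * x)"
  have "(\<integral>\<^sup>+x. ennreal (exp (- \<beta> * x) * (W x - W 0)) * indicator {0..} x \<partial>lborel) = ennreal (1 / laplace_exponent M X \<beta> - 1 / \<beta> * W 0)"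
    by (rule nn_integral_has_integral_lebesgue'[OF _ hi']) (use mono in auto)
  moreover have "(\<integral>\<^sup>+x. ennreal (?f x) \<partial>lborel) = (\<integral>\<^sup>+x. ennreal (exp (- \<beta> * x) * (W x - W 0)) * indicator {0..} x \<partial>lborel)"
    by (rule nn_integral_cong) (simp add: indicator_def)
  ultimately have nf: "(\<integral>\<^sup>+x. ennreal (?f x) \<partial>lborel) = ennreal (1 / laplace_exponent M X \<beta> - 1 / \<beta> * W 0)"
    by (rule trans[rotated])
  have ne: "(\<integral>\<^sup>+x. ennreal (?e x) \<partial>lborel) = ennreal (1 / \<beta>)"
  proof -
    have "(\<integral>\<^sup>+x. ennreal (?e x) \<partial>lborel) = (\<integral>\<^sup>+x. ennreal (exp (- \<beta> * x)) * indicator {0..} x \<partial>lborel)"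
      by (rule nn_integral_cong) (simp add: indicator_def)
    then show ?thesis using nn_integral_exp_atLeast[OF b, of 0] by simp
  qed
  have fm: "?f \<in> borel_measurable lborel"
  proof -
    have "?f = (\<lambda>x. exp (- \<beta> * x) * (indicator {0..} x * W x - indicator {0..} x * W 0))" by (auto simp: indicator_def)
    then show ?thesis using Wm by simp
  qed
  have f0: "0 \<le> ?f x" for x using mono[of x] by (simp add: indicator_def)
  have fi: "integrable lborel ?f" by (rule integrableI_nn_integral_finite[OF fm _ nf]) (use f0 in simp)
  have ei: "integrable lborel ?e" by (rule integrableI_nn_integral_finite[OF _ _ ne]) auto
  have eq: "(\<lambda>x. indicator {0..} x * (exp (- \<beta> * x) * W x)) = (\<lambda>x. ?f x + ?e x * W 0)"
    by (auto simp: indicator_def algebra_simps)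
  show "integrable lborel (\<lambda>x. indicator {0..} x * (exp (- \<beta> * x) * W x))"
    unfolding eq by (intro Bochner_Integration.integrable_add fi integrable_mult_left ei)
  have "0 \<le> 1 / laplace_exponent M X \<beta> - 1 / \<beta> * W 0"
    by (rule has_integral_nonneg[OF hi']) (use mono in auto)
  then have "(\<integral>x. ?f x \<partial>lborel) = 1 / laplace_exponent M X \<beta> - 1 / \<beta> * W 0"
    using nf f0 fm by (subst integral_eq_nn_integral) auto
  moreover have "(\<integral>x. ?e x \<partial>lborel) = 1 / \<beta>"
    using ne b by (subst integral_eq_nn_integral) auto
  ultimately show "(\<integral>x. indicator {0..} x * (exp (- \<beta> * x) * W x) \<partial>lborel) = 1 / laplace_exponent M X \<beta>"
    unfolding eq using fi ei by (simp add: Bochner_Integration.integral_add)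
qed

lemma inf_tail_integrable:
  assumes b: "0 < \<beta>"
  shows "integrable lborel (\<lambda>x. indicator {0..} x * (exp (- \<beta> * x) * inf_tail x))"
    and "(\<integral>x. indicator {0..} x * (exp (- \<beta> * x) * inf_tail x) \<partial>lborel) = drift / laplace_exponent M X \<beta>"
proof -
  have nn: "0 \<le> indicator {0..} x * (exp (- \<beta> * x) * inf_tail x)" for x
    by (simp add: indicator_def inf_tail_def)
  show "integrable lborel (\<lambda>x. indicator {0..} x * (exp (- \<beta> * x) * inf_tail x))"
    by (rule integrableI_nn_integral_finite[OF _ _ inf_tail_laplace[OF b]]) (use nn in auto)
  have "(\<integral>x. indicator {0..} x * (exp (- \<beta> * x) * inf_tail x) \<partial>lborel) = inf_lap \<beta> / \<beta>"
    using inf_tail_laplace[OF b] nn inf_lap_pos[OF b] b by (subst integral_eq_nn_integral) auto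
  also have "\<dots> = drift / laplace_exponent M X \<beta>"
    using exponent_inf_lap[OF b] exponent_pos[OF b] b by (simp add: field_simps)
  finally show "(\<integral>x. indicator {0..} x * (exp (- \<beta> * x) * inf_tail x) \<partial>lborel) = \<dots>" .
qed

text \<open>Equal Laplace transforms only make the weighted difference \<open>G\<close> integrate to
  0 over intervals. The pointwise equality comes from monotonicity of both functions and continuity
  of \<open>W\<close> at \<open>x\<close>.\<close>

lemma inf_tail_eq_scale:
  assumes W: "is_scale_function (laplace_exponent M X) W" and x: "0 < x"
  shows "inf_tail x = drift * W x"
proof -
  \<comment> \<open>The weight \<open>exp (- t)\<close> makes the difference integrable; its moments
    against \<open>exp (- t) ^ k\<close> are the Laplace transforms at
    \<open>1 + real k\<close>.\<close>
  define G where "G t = indicator {0..} t * (exp (- 1 * t) * inf_tail t) - drift * (indicator {0..} t * (exp (- 1 * t) * W t))" for t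
  have G: "integrable lborel G" unfolding G_def
    by (intro Bochner_Integration.integrable_diff inf_tail_integrable(1) integrable_mult_right scale_function_laplace(1)[OF W]) simp_all
  have "(\<integral>t. exp (- t) ^ k * G t \<partial>lborel) = 0" for k
  proof -
    let ?b = "1 + real k"
    have e: "exp (- t) ^ k * exp (- 1 * t) = exp (- ?b * t)" for t
      by (simp add: exp_of_nat_mult[symmetric] exp_add[symmetric] algebra_simps)
    have "exp (- t) ^ k * G t = indicator {0..} t * ((exp (- t) ^ k * exp (- 1 * t)) * inf_tail t) - drift * (indicator {0..} t * ((exp (- t) ^ k * exp (- 1 * t)) * W t))" for t
      by (simp add: G_def algebra_simps)
    then have "(\<integral>t. exp (- t) ^ k * G t \<partial>lborel) =
      (\<integral>t. indicator {0..} t * (exp (- ?b * t) * inf_tail t) - drift * (indicator {0..} t * (exp (- ?b * t) * W t)) \<partial>lborel)"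
      by (simp only: e)
    also have "\<dots> = drift / laplace_exponent M X ?b - drift * (1 / laplace_exponent M X ?b)"
      using inf_tail_integrable[of ?b] scale_function_laplace[OF W, of ?b]
      by (subst Bochner_Integration.integral_diff) (simp_all del: minus_add_distrib)
    finally show ?thesis by simp
  qed
  from exp_moments_zero[OF G _ this] have Z: "(\<integral>t. indicator {..<y} t * G t \<partial>lborel) = 0" for y
    by (simp add: G_def)
  have iG: "integrable lborel (\<lambda>t. indicator A t * G t)" if "A \<in> sets borel" for A
    using integrable_mult_indicator[of A lborel G] G that by simp
  have Z2: "(\<integral>t. indicator {u..<v} t * G t \<partial>lborel) = 0" if "u \<le> v" for u v
  proof -
    have "(\<integral>t. indicator {u..<v} t * G t \<partial>lborel) = (\<integral>t. indicator {..<v} t * G t - indicator {..<u} t * G t \<partial>lborel)"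
      using that by (intro Bochner_Integration.integral_cong) (auto simp: indicator_def)
    also have "\<dots> = 0" using Z by (subst Bochner_Integration.integral_diff) (auto intro!: iG)
    finally show ?thesis .
  qed
  have Wmono: "W u \<le> W v" if "0 \<le> u" "u \<le> v" for u v
    using W that by (cases "u = v") (auto simp: is_scale_function_def strict_mono_on_def intro: less_imp_le)
  have c0: "0 \<le> drift" using drift_pos by simp
  have intc: "(\<integral>t. indicator {u..<v} t * d \<partial>lborel) = (v - u) * d" if "u \<le> v" for u v d :: real
    using that by simp
  \<comment> \<open>Otherwise both monotonicities would keep \<open>G\<close> above the positive
    constant \<open>?d\<close> on all of \<open>{u..<v}\<close>, where its integral is 0. The bound
    \<open>lo\<close> is the mirror image.\<close>
  have up: "inf_tail u \<le> drift * W v" if uv: "0 \<le> u" "u < v" for u v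
  proof (rule ccontr)
    assume "\<not> ?thesis"
    then have d: "0 < inf_tail u - drift * W v" by simp
    let ?d = "exp (- v) * (inf_tail u - drift * W v)"
    have "(\<integral>t. indicator {u..<v} t * ?d \<partial>lborel) \<le> (\<integral>t. indicator {u..<v} t * G t \<partial>lborel)"
    proof (rule integral_mono[OF _ iG])
      show "integrable lborel (\<lambda>t. indicator {u..<v} t * ?d)"
        using uv by (intro integrable_mult_left integrable_real_indicator) auto
      fix t
      show "indicator {u..<v} t * ?d \<le> indicator {u..<v} t * G t"
      proof (cases "t \<in> {u..<v}")
        case True
        then have "inf_tail u \<le> inf_tail t" "drift * W t \<le> drift * W v" "0 \<le> t" "exp (- v) \<le> exp (- t)"
          using uv Wmono[of t v] c0 monoD[OF inf_tail_mono, of u t] by (auto intro: mult_left_mono)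
        then have "?d \<le> exp (- t) * (inf_tail t - drift * W t)" using d by (intro mult_mono) auto
        also have "\<dots> = G t" using \<open>0 \<le> t\<close> by (simp add: G_def algebra_simps)
        finally show ?thesis using True by simp
      qed simp
    qed simp
    then have "(v - u) * ?d \<le> 0" using Z2[of u v] intc[of u v ?d] uv by simp
    moreover have "0 < (v - u) * ?d" using uv d by simp
    ultimately show False by linarith
  qed
  have lo: "drift * W u \<le> inf_tail v" if uv: "0 \<le> u" "u < v" for u v
  proof (rule ccontr)
    assume "\<not> ?thesis"
    then have d: "0 < drift * W u - inf_tail v" by simp
    let ?d = "exp (- v) * (drift * W u - inf_tail v)"
    have "(\<integral>t. indicator {u..<v} t * G t \<partial>lborel) \<le> (\<integral>t. indicator {u..<v} t * (- ?d) \<partial>lborel)"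
    proof (rule integral_mono[OF iG])
      show "integrable lborel (\<lambda>t. indicator {u..<v} t * (- ?d))"
        using uv by (intro integrable_mult_left integrable_real_indicator) auto
      fix t
      show "indicator {u..<v} t * G t \<le> indicator {u..<v} t * (- ?d)"
      proof (cases "t \<in> {u..<v}")
        case True
        then have "inf_tail t \<le> inf_tail v" "drift * W u \<le> drift * W t" "0 \<le> t" "exp (- v) \<le> exp (- t)"
          using uv Wmono[of u t] c0 monoD[OF inf_tail_mono, of t v] by (auto intro: mult_left_mono)
        then have "?d \<le> exp (- t) * (drift * W t - inf_tail t)" using d by (intro mult_mono) auto
        also have "\<dots> = - G t" using \<open>0 \<le> t\<close> by (simp add: G_def algebra_simps)
        finally show ?thesis using True by simp
      qed simp
    qed simp
    then have "0 \<le> (v - u) * (- ?d)" using Z2[of u v] intc[of u v "- ?d"] uv by simp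
    moreover have "0 < (v - u) * ?d" using uv d by simp
    ultimately show False by simp
  qed
  have cW: "((\<lambda>t. drift * W t) \<longlongrightarrow> drift * W x) (at x)"
  proof (intro tendsto_intros)
    have "continuous_on {0<..} W" using W by (auto simp: is_scale_function_def intro: continuous_on_subset)
    then have "isCont W x" using x by (simp add: continuous_on_eq_continuous_at)
    then show "(W \<longlongrightarrow> W x) (at x)" by (simp add: isCont_def)
  qed
  show ?thesis
  proof (rule antisym)
    show "inf_tail x \<le> drift * W x"
    proof (rule tendsto_lowerbound)
      show "((\<lambda>t. drift * W t) \<longlongrightarrow> drift * W x) (at_right x)"
        by (rule filterlim_mono[OF cW order_refl at_le]) simp
      show "eventually (\<lambda>t. inf_tail x \<le> drift * W t) (at_right x)"
        using eventually_at_right_less[of x] by eventually_elim (use up x in simp)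
    qed simp
    show "drift * W x \<le> inf_tail x"
    proof (rule tendsto_upperbound)
      show "((\<lambda>t. drift * W t) \<longlongrightarrow> drift * W x) (at_left x)"
        by (rule filterlim_mono[OF cW order_refl at_le]) simp
      have "eventually (\<lambda>t. t \<in> {0<..<x}) (at_left x)"
        using x by (rule eventually_at_leftI[rotated]) simp
      then show "eventually (\<lambda>t. drift * W t \<le> inf_tail x) (at_left x)"
        by eventually_elim (use lo in auto)
    qed simp
  qed
qed

section \<open>Time reversal and the survival probability at every starting point\<close>

lemma grid_sum:
  assumes "\<omega> \<in> space M" "k \<le> N"
  shows "(\<Sum>j<k. (\<lambda>j\<in>{..<N}. X (h * real (Suc j)) \<omega> - X (h * real j) \<omega>) j) = X (h * real k) \<omega>"
proof -
  have "(\<Sum>j<k. (\<lambda>j\<in>{..<N}. X (h * real (Suc j)) \<omega> - X (h * real j) \<omega>) j) = (\<Sum>j<k. X (h * real (Suc j)) \<omega> - X (h * real j) \<omega>)"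
    using assms by (intro sum.cong) auto
  also have "\<dots> = X (h * real k) \<omega>" using assms by (subst sum_lessThan_telescope) (simp add: X0)
  finally show ?thesis .
qed

text \<open>Independent identically distributed increments keep their law when read backwards. If
  the total is 0, the reversed partial sum up to \<open>k\<close> is minus the original one up to
  \<open>N - k\<close>, which exchanges the two sign conditions.\<close>

lemma reversal:
  assumes h: "0 < h" and N: "0 < N"
  shows "prob {\<omega>\<in>space M. (\<forall>k\<in>{..N}. 0 \<le> X (h * real k) \<omega>) \<and> X (h * real N) \<omega> = 0} =
    prob {\<omega>\<in>space M. (\<forall>k\<in>{..N}. X (h * real k) \<omega> \<le> 0) \<and> X (h * real N) \<omega> = 0}"
proof -
  let ?P = "\<Pi>\<^sub>M k\<in>{..<N}. (borel :: real measure)"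
  let ?D = "\<lambda>\<omega>. \<lambda>j\<in>{..<N}. X (h * real (Suc j)) \<omega> - X (h * real j) \<omega>"
  let ?\<mu> = "distr M borel (X h)"
  let ?Q = "\<Pi>\<^sub>M k\<in>{..<N}. ?\<mu>"
  let ?R = "\<lambda>x. \<lambda>n\<in>{..<N}. x (N - Suc n) :: real"
  have D: "?D \<in> measurable M ?P" using h by (intro measurable_restrict borel_measurable_diff rv) auto
  have law: "distr M ?P ?D = ?Q"
  proof -
    have e: "h * real (Suc k) - h * real k = h" for k by (simp add: algebra_simps)
    show ?thesis
      using increments_law[of 0 "\<lambda>k. h * real k" N] h N by (simp add: mono_def e del: of_nat_Suc)
  qed
  have \<mu>: "prob_space ?\<mu>" using h by (intro prob_space_distr rv) simp
  have setsQ: "sets ?Q = sets ?P" by (intro sets_PiM_cong) auto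
  have spQ: "space ?Q = space ?P" by (rule sets_eq_imp_space_eq[OF setsQ])
  have rev: "distr ?Q ?Q ?R = ?Q"
  proof -
    have "inj_on (\<lambda>n. N - Suc n) {..<N}" by (rule inj_onI) auto
    moreover have "(\<lambda>n. N - Suc n) \<in> {..<N} \<rightarrow> {..<N}" by auto
    ultimately show ?thesis
      by (rule distr_PiM_reindex[of "{..<N}" "\<lambda>_. ?\<mu>" "\<lambda>n. N - Suc n" "{..<N}", OF \<mu>])
  qed
  have R: "?R \<in> measurable ?P ?P"
  proof (rule measurable_restrict)
    fix n assume "n \<in> {..<N}"
    then show "(\<lambda>x. x (N - Suc n)) \<in> borel_measurable ?P" by (intro measurable_component_singleton) auto
  qed
  let ?S = "{x\<in>space ?P. (\<forall>k\<in>{..N}. 0 \<le> (\<Sum>j<k. x j)) \<and> (\<Sum>j<N. x j) = 0}"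
  let ?T = "{x\<in>space ?P. (\<forall>k\<in>{..N}. (\<Sum>j<k. x j) \<le> 0) \<and> (\<Sum>j<N. x j) = 0}"
  have sm: "(\<lambda>x. \<Sum>j<k. x j) \<in> borel_measurable ?P" if "k \<le> N" for k
    using that by (intro borel_measurable_sum measurable_component_singleton) auto
  have S: "?S \<in> sets ?P" and T: "?T \<in> sets ?P"
    by (intro sets.sets_Collect_conj sets.sets_Collect_finite_All borel_measurable_le borel_measurable_eq sm measurable_const; simp)+
  have ST: "?R -` ?T \<inter> space ?P = ?S"
  proof (rule set_eqI)
    fix x
    show "x \<in> ?R -` ?T \<inter> space ?P \<longleftrightarrow> x \<in> ?S"
    proof (cases "x \<in> space ?P")
      case True
      have sr: "(\<Sum>j<k. ?R x j) = (\<Sum>j<N. x j) - (\<Sum>j<N - k. x j)" if k: "k \<le> N" for k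
      proof -
        have "(\<Sum>j<k. ?R x j) = (\<Sum>j<k. x (N - Suc j))" using k by (intro sum.cong) auto
        also have "\<dots> = (\<Sum>j\<in>{N - k..<N}. x j)"
          by (rule sum.reindex_bij_witness[of _ "\<lambda>j. N - Suc j" "\<lambda>j. N - Suc j"]) (use k in auto)
        also have "\<dots> = (\<Sum>j<N. x j) - (\<Sum>j<N - k. x j)"
        proof -
          have "{..<N} = {..<N - k} \<union> {N - k..<N}" by auto
          then have "(\<Sum>j<N. x j) = (\<Sum>j<N - k. x j) + (\<Sum>j\<in>{N - k..<N}. x j)"
            by (simp add: sum.union_disjoint ivl_disj_int)
          then show ?thesis by simp
        qed
        finally show ?thesis .
      qed
      have tot: "(\<Sum>j<N. ?R x j) = (\<Sum>j<N. x j)" using sr[of N] by simp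
      have "(\<forall>k\<in>{..N}. (\<Sum>j<k. ?R x j) \<le> 0) \<longleftrightarrow> (\<forall>k\<in>{..N}. 0 \<le> (\<Sum>j<k. x j))" if z: "(\<Sum>j<N. x j) = 0"
      proof
        assume a: "\<forall>k\<in>{..N}. (\<Sum>j<k. ?R x j) \<le> 0"
        show "\<forall>k\<in>{..N}. 0 \<le> (\<Sum>j<k. x j)"
        proof
          fix k assume "k \<in> {..N}"
          then show "0 \<le> (\<Sum>j<k. x j)" using bspec[OF a, of "N - k"] sr[of "N - k"] z by simp
        qed
      next
        assume a: "\<forall>k\<in>{..N}. 0 \<le> (\<Sum>j<k. x j)"
        show "\<forall>k\<in>{..N}. (\<Sum>j<k. ?R x j) \<le> 0"
        proof
          fix k assume "k \<in> {..N}"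
          then show "(\<Sum>j<k. ?R x j) \<le> 0" using bspec[OF a, of "N - k"] sr[of k] z by simp
        qed
      qed
      then show ?thesis using True measurable_space[OF R True] tot by (simp only: vimage_eq Int_iff mem_Collect_eq simp_thms) blast
    qed simp
  qed
  have pre: "prob {\<omega>\<in>space M. (\<forall>k\<in>{..N}. 0 \<le> X (h * real k) \<omega>) \<and> X (h * real N) \<omega> = 0} = measure ?Q ?S"
  proof -
    have "{\<omega>\<in>space M. (\<forall>k\<in>{..N}. 0 \<le> X (h * real k) \<omega>) \<and> X (h * real N) \<omega> = 0} = ?D -` ?S \<inter> space M"
      using measurable_space[OF D] grid_sum[of _ _ N h] by auto
    then show ?thesis unfolding law[symmetric] using measure_distr[OF D S] by simp
  qed
  have post: "prob {\<omega>\<in>space M. (\<forall>k\<in>{..N}. X (h * real k) \<omega> \<le> 0) \<and> X (h * real N) \<omega> = 0} = measure ?Q ?T"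
  proof -
    have "{\<omega>\<in>space M. (\<forall>k\<in>{..N}. X (h * real k) \<omega> \<le> 0) \<and> X (h * real N) \<omega> = 0} = ?D -` ?T \<inter> space M"
      using measurable_space[OF D] grid_sum[of _ _ N h] by auto
    then show ?thesis unfolding law[symmetric] using measure_distr[OF D T] by simp
  qed
  have "measure ?Q ?T = measure (distr ?Q ?Q ?R) ?T" by (simp only: rev)
  also have "\<dots> = measure ?Q (?R -` ?T \<inter> space ?Q)"
    by (rule measure_distr) (use R T in \<open>simp_all add: setsQ measurable_cong_sets[OF setsQ setsQ]\<close>)
  also have "\<dots> = measure ?Q ?S" by (simp only: spQ ST)
  finally show ?thesis using pre post by simp
qed

text \<open>Time reversal turns a path above 0 that ends at 0 into a path below 0, which is excluded by
  \<open>passage_0\<close>.\<close>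

lemma stays_nonneg_returns_null:
  assumes u: "u \<in> rat_times" "0 < u"
  shows "AE \<omega> in M. \<not> (X u \<omega> = 0 \<and> (\<forall>t\<ge>0. 0 \<le> X t \<omega>))"
proof -
  let ?S = "\<lambda>m. {\<omega>\<in>space M. (\<forall>k\<in>{..2^m}. 0 \<le> X (u / 2^m * real k) \<omega>) \<and> X (u / 2^m * real (2^m::nat)) \<omega> = 0}"
  let ?T = "\<lambda>m. {\<omega>\<in>space M. (\<forall>k\<in>{..2^m}. X (u / 2^m * real k) \<omega> \<le> 0) \<and> X (u / 2^m * real (2^m::nat)) \<omega> = 0}"
  have Xm: "X (u / 2^m * real k) \<in> borel_measurable M" for m k using u by (intro rv) simp
  have Sev: "?S m \<in> events" for m
    by (intro sets.sets_Collect_conj sets.sets_Collect_finite_All borel_measurable_le borel_measurable_eq Xm measurable_const; simp)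
  have le: "prob (?S m) \<le> 1 - prob (up u m 0)" for m
  proof -
    have "prob (?S m) = prob (?T m)" using reversal[of "u / 2^m" "2^m"] u by simp
    also have "\<dots> \<le> prob (space M - up u m 0)"
    proof (rule finite_measure_mono)
      have e: "u * real k / 2^m = u / 2^m * real k" for k by simp
      show "?T m \<subseteq> space M - up u m 0"
        unfolding up_def e by (auto simp: not_less[symmetric])
    qed (use u in auto)
    also have "\<dots> = 1 - prob (up u m 0)" by (rule prob_compl) (use u in auto)
    finally show ?thesis .
  qed
  have "(\<lambda>m. 1 - prob (up u m 0)) \<longlonglongrightarrow> 1 - passage u 0"
    using u by (intro tendsto_diff tendsto_const up_tendsto_passage) simp
  then have lim: "(\<lambda>m. 1 - prob (up u m 0)) \<longlonglongrightarrow> 0" using passage_0[OF u] by simp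
  have "prob (\<Inter>m. ?S m) \<le> prob (?S m)" for m using Sev by (intro finite_measure_mono) auto
  then have "prob (\<Inter>m. ?S m) \<le> 1 - prob (up u m 0)" for m using le[of m] by (meson order_trans)
  then have "prob (\<Inter>m. ?S m) \<le> 0" using lim by (intro LIMSEQ_le_const) auto
  then have "(\<Inter>m. ?S m) \<in> null_sets M" using Sev
    by (intro null_setsI) (auto simp: emeasure_eq_measure measure_le_0_iff)
  from AE_not_in[OF this] show ?thesis
  proof (rule AE_mp, intro AE_I2 impI)
    fix \<omega> assume w: "\<omega> \<in> space M" "\<omega> \<notin> (\<Inter>m. ?S m)"
    show "\<not> (X u \<omega> = 0 \<and> (\<forall>t\<ge>0. 0 \<le> X t \<omega>))"
    proof
      assume a: "X u \<omega> = 0 \<and> (\<forall>t\<ge>0. 0 \<le> X t \<omega>)"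
      have "\<omega> \<in> ?S m" for m using a w u by simp
      then show False using w by blast
    qed
  qed
qed

text \<open>The probability that the process started at \<open>x\<close> has last zero 0
  (\<open>survival_path_last_zero\<close>). Time 0 is excluded, because a visit at time 0 alone
  leaves the last zero at 0.\<close>

definition survival :: "real \<Rightarrow> real" where
  "survival x = prob {\<omega>\<in>space M. \<not> (\<exists>t>0. x + X t \<omega> \<le> 0)}"

context
  fixes W :: "real \<Rightarrow> real"
  assumes W: "is_scale_function (laplace_exponent M X) W"
begin

text \<open>The events with \<open>x\<close> replaced by larger levels decrease to the one with the
  non-strict inequality, and \<open>W\<close> is right-continuous even at 0. The point is the case
  \<open>x = 0\<close>: there the strict inequality has probability 0, as the infimum is never
  positive.\<close>

lemma inf_tail_right_limit:
  assumes x: "0 \<le> x"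
  shows "prob {\<omega>\<in>space M. - x \<le> path_inf (future 0 \<omega>)} = drift * W x"
proof -
  let ?A = "\<lambda>n. {\<omega>\<in>space M. - (x + inverse (real (Suc n))) < path_inf (future 0 \<omega>)}"
  have l0: "(\<lambda>n. inverse (real (Suc n))) \<longlonglongrightarrow> 0" by (rule LIMSEQ_inverse_real_of_nat)
  have "(\<lambda>n. prob (?A n)) \<longlonglongrightarrow> prob (\<Inter>n. ?A n)"
  proof (rule finite_Lim_measure_decseq)
    show "decseq ?A"
    proof (rule decseq_SucI, rule subsetI)
      fix n \<omega> assume "\<omega> \<in> ?A (Suc n)"
      moreover have "inverse (real (Suc (Suc n))) \<le> inverse (real (Suc n))" by (intro le_imp_inverse_le) auto
      ultimately show "\<omega> \<in> ?A n" unfolding mem_Collect_eq by - (elim conjE, intro conjI, assumption, linarith)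
    qed
  qed auto
  moreover have "(\<Inter>n. ?A n) = {\<omega>\<in>space M. - x \<le> path_inf (future 0 \<omega>)}"
  proof (rule set_eqI, rule iffI)
    fix \<omega> assume w: "\<omega> \<in> (\<Inter>n. ?A n)"
    then have "- (x + inverse (real (Suc n))) < path_inf (future 0 \<omega>)" for n by blast
    moreover have "(\<lambda>n. - (x + inverse (real (Suc n)))) \<longlonglongrightarrow> - (x + 0)"
      by (intro tendsto_minus tendsto_add tendsto_const l0)
    ultimately have "- (x + 0) \<le> path_inf (future 0 \<omega>)"
      by (intro LIMSEQ_le_const2) (auto intro: less_imp_le)
    then show "\<omega> \<in> {\<omega>\<in>space M. - x \<le> path_inf (future 0 \<omega>)}" using w by auto
  next
    fix \<omega> assume w: "\<omega> \<in> {\<omega>\<in>space M. - x \<le> path_inf (future 0 \<omega>)}"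
    show "\<omega> \<in> (\<Inter>n. ?A n)"
    proof
      fix n
      have "0 < inverse (real (Suc n))" by simp
      then show "\<omega> \<in> ?A n" using w by (simp del: of_nat_Suc inverse_positive_iff_positive)
    qed
  qed
  moreover have "prob (?A n) = drift * W (x + inverse (real (Suc n)))" for n
    using inf_tail_eq_scale[OF W, of "x + inverse (real (Suc n))"] x
    by (simp add: inf_tail_def add_nonneg_pos del: of_nat_Suc)
  moreover have "(\<lambda>n. drift * W (x + inverse (real (Suc n)))) \<longlonglongrightarrow> drift * W (x + 0)"
  proof (intro tendsto_mult tendsto_const)
    have "continuous_on {0..} W" using W by (simp add: is_scale_function_def)
    then show "(\<lambda>n. W (x + inverse (real (Suc n)))) \<longlonglongrightarrow> W (x + 0)"
      by (rule continuous_on_tendsto_compose[OF _ tendsto_add[OF tendsto_const l0]]) (use x in auto)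
  qed
  ultimately show ?thesis using LIMSEQ_unique by fastforce
qed

text \<open>For \<open>x > 0\<close> the strict and the non-strict tail are both
  \<open>drift * W x\<close>, so the law of the infimum has no atom below 0.\<close>

lemma prob_inf_eq:
  assumes x: "0 < x"
  shows "prob {\<omega>\<in>space M. path_inf (future 0 \<omega>) = - x} = 0"
proof -
  have "prob ({\<omega>\<in>space M. - x \<le> path_inf (future 0 \<omega>)} - {\<omega>\<in>space M. - x < path_inf (future 0 \<omega>)}) =
    prob {\<omega>\<in>space M. - x \<le> path_inf (future 0 \<omega>)} - prob {\<omega>\<in>space M. - x < path_inf (future 0 \<omega>)}"
    by (rule finite_measure_Diff) auto
  also have "\<dots> = 0" using inf_tail_right_limit[of x] inf_tail_eq_scale[OF W x] x by (simp add: inf_tail_def)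
  also have "{\<omega>\<in>space M. - x \<le> path_inf (future 0 \<omega>)} - {\<omega>\<in>space M. - x < path_inf (future 0 \<omega>)} =
      {\<omega>\<in>space M. path_inf (future 0 \<omega>) = - x}" by auto
  finally show ?thesis .
qed

text \<open>The infimum of the future is independent of \<open>X u\<close> and has no atom below 0,
  so it meets the level fixed at time \<open>u\<close> with probability 0.\<close>

lemma AE_no_return:
  assumes u: "u \<in> rat_times" "0 < u"
  shows "AE \<omega> in M. \<not> (0 < X u \<omega> \<and> path_inf (future u \<omega>) = - X u \<omega>)"
proof -
  have u0: "0 \<le> u" using u by simp
  have Xp[measurable]: "X u \<in> borel_measurable (past u)" by (rule X_past) (use u in auto)
  have Xm[measurable]: "X u \<in> borel_measurable M" by (rule rv[OF u0])
  have fm[measurable]: "future u \<in> measurable M paths" by (rule future_measurable[OF u0])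
  define H where "H = (\<lambda>p. indicator {q. 0 < X u (fst q) \<and> path_inf (snd q) = - X u (fst q)} p :: ennreal)"
  have Hm: "H \<in> borel_measurable (past u \<Otimes>\<^sub>M paths)"
  proof -
    have "{q\<in>space (past u \<Otimes>\<^sub>M paths). 0 < X u (fst q) \<and> path_inf (snd q) = - X u (fst q)} \<in> sets (past u \<Otimes>\<^sub>M paths)"
      by measurable
    then show ?thesis unfolding H_def by (simp add: borel_measurable_indicator_iff Collect_conj_eq Int_commute Int_assoc Int_left_commute)
  qed
  have "(\<integral>\<^sup>+\<omega>. H (\<omega>, future u \<omega>) \<partial>M) = (\<integral>\<^sup>+\<omega>. (\<integral>\<^sup>+\<omega>'. H (\<omega>, future 0 \<omega>') \<partial>M) \<partial>M)"
    by (rule markov_nn_integral[OF u0 Hm])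
  also have "\<dots> = (\<integral>\<^sup>+\<omega>. 0 \<partial>M)"
  proof (rule nn_integral_cong)
    fix \<omega>
    show "(\<integral>\<^sup>+\<omega>'. H (\<omega>, future 0 \<omega>') \<partial>M) = 0"
    proof (cases "0 < X u \<omega>")
      case True
      have "(\<integral>\<^sup>+\<omega>'. H (\<omega>, future 0 \<omega>') \<partial>M) = (\<integral>\<^sup>+\<omega>'. indicator {\<omega>'\<in>space M. path_inf (future 0 \<omega>') = - X u \<omega>} \<omega>' \<partial>M)"
        using True by (intro nn_integral_cong) (simp add: H_def indicator_def)
      also have "\<dots> = emeasure M {\<omega>'\<in>space M. path_inf (future 0 \<omega>') = - X u \<omega>}"
        by (rule nn_integral_indicator) measurable
      also have "\<dots> = 0" using prob_inf_eq[OF True] by (simp add: emeasure_eq_measure)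
      finally show ?thesis .
    qed (simp add: H_def)
  qed
  finally have "(\<integral>\<^sup>+\<omega>. H (\<omega>, future u \<omega>) \<partial>M) = 0" by simp
  moreover have "(\<lambda>\<omega>. H (\<omega>, future u \<omega>)) \<in> borel_measurable M"
    by (rule measurable_compose[OF _ Hm]) (intro measurable_Pair id_past fm)
  ultimately have "AE \<omega> in M. H (\<omega>, future u \<omega>) = 0" by (simp add: nn_integral_0_iff_AE)
  then show ?thesis by eventually_elim (auto simp: H_def indicator_def)
qed

text \<open>Staying positive after time 0 and having a nonnegative infimum differ only if the path
  touches 0 again without going below. At a dyadic time \<open>?u\<close> before such a return the
  path is at 0, excluded by \<open>stays_nonneg_returns_null\<close>, or above 0 and later down to
  exactly 0, excluded by \<open>AE_no_return\<close>.\<close>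

lemma survival_0: "survival 0 = drift * W 0"
proof -
  have "AE \<omega> in M. \<forall>n. \<not> (0 < X (1 / 2 ^ n) \<omega> \<and> path_inf (future (1 / 2 ^ n) \<omega>) = - X (1 / 2 ^ n) \<omega>) \<and>
     \<not> (X (1 / 2 ^ n) \<omega> = 0 \<and> (\<forall>t\<ge>0. 0 \<le> X t \<omega>))"
    unfolding AE_all_countable
  proof
    fix n :: nat
    have t: "1 / 2 ^ n \<in> rat_times" "0 < (1 / 2 ^ n :: real)" using grid_in_times[of 1 n] by auto
    show "AE \<omega> in M. \<not> (0 < X (1 / 2 ^ n) \<omega> \<and> path_inf (future (1 / 2 ^ n) \<omega>) = - X (1 / 2 ^ n) \<omega>) \<and>
       \<not> (X (1 / 2 ^ n) \<omega> = 0 \<and> (\<forall>t\<ge>0. 0 \<le> X t \<omega>))"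
      using AE_no_return[OF t] stays_nonneg_returns_null[OF t] by eventually_elim blast
  qed
  then have AE: "AE \<omega> in M. (\<not> (\<exists>t>0. X t \<omega> \<le> 0)) \<longleftrightarrow> 0 \<le> path_inf (future 0 \<omega>)"
  proof (rule AE_mp, intro AE_I2 impI)
    fix \<omega> assume w: "\<omega> \<in> space M" and a: "\<forall>n. \<not> (0 < X (1 / 2 ^ n) \<omega> \<and> path_inf (future (1 / 2 ^ n) \<omega>) = - X (1 / 2 ^ n) \<omega>) \<and>
     \<not> (X (1 / 2 ^ n) \<omega> = 0 \<and> (\<forall>t\<ge>0. 0 \<le> X t \<omega>))"
    have I: "0 \<le> path_inf (future 0 \<omega>) \<longleftrightarrow> (\<forall>t\<ge>0. 0 \<le> X t \<omega>)"
    proof -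
      have "path_inf (future 0 \<omega>) < 0 \<longleftrightarrow> (\<exists>t\<ge>0. X t \<omega> < 0)"
      proof
        assume "path_inf (future 0 \<omega>) < 0"
        then show "\<exists>t\<ge>0. X t \<omega> < 0" using path_inf_le_iff[OF w, of "path_inf (future 0 \<omega>)"] by force
      next
        assume "\<exists>t\<ge>0. X t \<omega> < 0"
        then obtain t where "t \<ge> 0" "X t \<omega> < 0" by blast
        then show "path_inf (future 0 \<omega>) < 0" using path_inf_le_iff[OF w, of "X t \<omega>"] by force
      qed
      then show ?thesis by (meson not_less)
    qed
    show "(\<not> (\<exists>t>0. X t \<omega> \<le> 0)) \<longleftrightarrow> 0 \<le> path_inf (future 0 \<omega>)"
    proof
      assume "\<not> (\<exists>t>0. X t \<omega> \<le> 0)"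
      then have "0 \<le> X t \<omega>" if "t \<ge> 0" for t
        using that X0[OF w] by (cases "t = 0") (auto simp: not_le intro: less_imp_le)
      then show "0 \<le> path_inf (future 0 \<omega>)" using I by blast
    next
      assume "0 \<le> path_inf (future 0 \<omega>)"
      then have nn: "\<forall>t\<ge>0. 0 \<le> X t \<omega>" using I by blast
      show "\<not> (\<exists>t>0. X t \<omega> \<le> 0)"
      proof
        assume "\<exists>t>0. X t \<omega> \<le> 0"
        then obtain t where t: "t > 0" "X t \<omega> \<le> 0" by blast
        \<comment> \<open>A dyadic time before the return: the exceptional sets were removed for
          countably many times only.\<close>
        obtain n :: nat where n: "(1/2) ^ n < t" using real_arch_pow_inv[OF t(1), of "1/2"] by auto
        let ?u = "1 / 2 ^ n :: real"
        have ut: "?u < t" using n by (simp add: power_one_over)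
        have "0 \<le> X ?u \<omega>" using nn by simp
        moreover have "X ?u \<omega> \<noteq> 0" using a nn by blast
        ultimately have pos: "0 < X ?u \<omega>" by simp
        have le: "path_inf (future ?u \<omega>) \<le> - X ?u \<omega>"
          using t ut by (subst path_inf_future_le_iff[OF w]) (auto intro!: exI[of _ "t - ?u"])
        have "- X ?u \<omega> \<le> path_inf (future ?u \<omega>)"
        proof (rule ccontr)
          assume "\<not> ?thesis"
          then obtain r where r: "r \<ge> 0" "X (?u + r) \<omega> - X ?u \<omega> < - X ?u \<omega>"
            using path_inf_future_le_iff[OF w, of ?u "path_inf (future ?u \<omega>)"] by force
          then have "X (?u + r) \<omega> < 0" by simp
          moreover have "0 \<le> X (?u + r) \<omega>" using nn r(1) by simp
          ultimately show False by simp
        qed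
        then show False using le pos a by force
      qed
    qed
  qed
  have sm: "{\<omega>\<in>space M. \<not> (\<exists>t>0. X t \<omega> \<le> 0)} \<in> events"
  proof -
    have "{\<omega>\<in>space M. \<not> (\<exists>t>0. X t \<omega> \<le> 0)} = {\<omega>\<in>space M. \<forall>n::nat. - X (1 / 2 ^ n) \<omega> < path_inf (future (1 / 2 ^ n) \<omega>)}"
    proof (rule Collect_cong, rule conj_cong[OF refl])
      fix \<omega> assume w: "\<omega> \<in> space M"
      have "(\<exists>t>0. X t \<omega> \<le> 0) \<longleftrightarrow> (\<exists>n::nat. path_inf (future (1 / 2 ^ n) \<omega>) \<le> - X (1 / 2 ^ n) \<omega>)"
      proof
        assume "\<exists>t>0. X t \<omega> \<le> 0"
        then obtain t where t: "t > 0" "X t \<omega> \<le> 0" by blast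
        obtain n :: nat where n: "(1/2) ^ n < t" using real_arch_pow_inv[OF t(1), of "1/2"] by auto
        then have "1 / 2 ^ n < t" by (simp add: power_one_over)
        then have "path_inf (future (1 / 2 ^ n) \<omega>) \<le> - X (1 / 2 ^ n) \<omega>"
          using t by (subst path_inf_future_le_iff[OF w]) (auto intro!: exI[of _ "t - 1 / 2 ^ n"])
        then show "\<exists>n::nat. path_inf (future (1 / 2 ^ n) \<omega>) \<le> - X (1 / 2 ^ n) \<omega>" by blast
      next
        assume "\<exists>n::nat. path_inf (future (1 / 2 ^ n) \<omega>) \<le> - X (1 / 2 ^ n) \<omega>"
        then obtain n :: nat where "path_inf (future (1 / 2 ^ n) \<omega>) \<le> - X (1 / 2 ^ n) \<omega>" by blast
        then obtain r where "r \<ge> 0" "X (1 / 2 ^ n + r) \<omega> - X (1 / 2 ^ n) \<omega> \<le> - X (1 / 2 ^ n) \<omega>"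
          by (subst (asm) path_inf_future_le_iff[OF w]) auto
        then show "\<exists>t>0. X t \<omega> \<le> 0" by (intro exI[of _ "1 / 2 ^ n + r"]) (auto intro: add_pos_nonneg)
      qed
      then show "(\<not> (\<exists>t>0. X t \<omega> \<le> 0)) = (\<forall>n::nat. - X (1 / 2 ^ n) \<omega> < path_inf (future (1 / 2 ^ n) \<omega>))"
        by (simp add: not_le)
    qed
    moreover have "X (1 / 2 ^ n) \<in> borel_measurable M" "future (1 / 2 ^ n) \<in> measurable M paths" for n
      by (auto intro!: rv future_measurable)
    ultimately show ?thesis by simp
  qed
  have "survival 0 = prob {\<omega>\<in>space M. - 0 \<le> path_inf (future 0 \<omega>)}"
    unfolding survival_def
  proof (rule finite_measure_eq_AE)
    show "AE \<omega> in M. (\<omega> \<in> {\<omega>\<in>space M. \<not> (\<exists>t>0. 0 + X t \<omega> \<le> 0)}) = (\<omega> \<in> {\<omega>\<in>space M. - 0 \<le> path_inf (future 0 \<omega>)})"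
      using AE by eventually_elim simp
  qed (use sm in auto)
  also have "\<dots> = drift * W 0" by (rule inf_tail_right_limit) simp
  finally show ?thesis .
qed

text \<open>For \<open>x < 0\<close> both sides vanish, since right-continuity keeps the path below
  0 for a short positive time. For \<open>x > 0\<close> time 0 is not a visit, so survival is the
  strict tail of the infimum; \<open>x = 0\<close> is the case settled by time reversal.\<close>

lemma survival_eq_scale: "survival x = drift * W x"
proof -
  consider "x < 0" | "x = 0" | "0 < x" by linarith
  then show ?thesis
  proof cases
    case 1
    have "{\<omega>\<in>space M. \<not> (\<exists>t>0. x + X t \<omega> \<le> 0)} = {}"
    proof -
      have "\<exists>t>0. x + X t \<omega> \<le> 0" if w: "\<omega> \<in> space M" for \<omega>
      proof -
        have "((\<lambda>t. X t \<omega>) \<longlongrightarrow> X 0 \<omega>) (at_right 0)" using good[OF w] by (auto simp: good_path_def)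
        then have "eventually (\<lambda>t. X t \<omega> < - x) (at_right 0)" by (rule order_tendstoD(2)) (use X0[OF w] 1 in simp)
        then obtain b where b: "b > 0" "\<And>t. 0 < t \<Longrightarrow> t < b \<Longrightarrow> X t \<omega> < - x"
          unfolding eventually_at_right_field by blast
        have "X (b / 2) \<omega> < - x" using b by simp
        then show ?thesis using b(1) by (intro exI[of _ "b / 2"]) simp
      qed
      then show ?thesis by blast
    qed
    then have "survival x = 0" unfolding survival_def by (simp only: measure_empty)
    then show ?thesis using W 1 by (simp add: is_scale_function_def)
  next
    case 2
    then show ?thesis using survival_0 by simp
  next
    case 3
    have "{\<omega>\<in>space M. \<not> (\<exists>t>0. x + X t \<omega> \<le> 0)} = {\<omega>\<in>space M. - x < path_inf (future 0 \<omega>)}"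
    proof (rule Collect_cong, rule conj_cong[OF refl])
      fix \<omega> assume w: "\<omega> \<in> space M"
      have "(\<exists>t>0. x + X t \<omega> \<le> 0) \<longleftrightarrow> (\<exists>t\<ge>0. X t \<omega> \<le> - x)"
      proof
        assume "\<exists>t>0. x + X t \<omega> \<le> 0"
        then obtain t where "t > 0" "x + X t \<omega> \<le> 0" by blast
        then show "\<exists>t\<ge>0. X t \<omega> \<le> - x" by (intro exI[of _ t]) auto
      next
        assume "\<exists>t\<ge>0. X t \<omega> \<le> - x"
        then obtain t where t: "t \<ge> 0" "X t \<omega> \<le> - x" by blast
        then have "t \<noteq> 0" using X0[OF w] 3 by auto
        then show "\<exists>t>0. x + X t \<omega> \<le> 0" using t by (intro exI[of _ t]) auto
      qed
      then show "(\<not> (\<exists>t>0. x + X t \<omega> \<le> 0)) = (- x < path_inf (future 0 \<omega>))"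
        using path_inf_le_iff[OF w, of "- x"] by (simp add: not_le[symmetric])
    qed
    then show ?thesis using inf_tail_eq_scale[OF W 3] by (simp add: survival_def inf_tail_def)
  qed
qed

end

end

section \<open>Convex functions and their right derivatives\<close>

text \<open>Convexity on the closed half-line gives continuity in the interior only and permits a
  downward jump at 0; \<open>rc0\<close> excludes it, so that integrating the derivative starts from
  the value \<open>D 0\<close>.\<close>

locale convex_right_continuous =
  fixes D :: "real \<Rightarrow> real"
  assumes cvx: "convex_on {0..} D"
    and nonneg: "\<And>t. 0 \<le> t \<Longrightarrow> 0 \<le> D t"
    and rc0: "(D \<longlongrightarrow> D 0) (at_right 0)"
begin

abbreviation f :: "real \<Rightarrow> real" where "f \<equiv> right_deriv D"

lemma slope_mono:
  assumes "0 \<le> x" "x < t" "t < y"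
  shows "(D t - D x) / (t - x) \<le> (D y - D x) / (y - x)" "(D y - D x) / (y - x) \<le> (D y - D t) / (y - t)"
proof -
  have e: "(D a - D b) / (a - b) = (D b - D a) / (b - a)" for a b
    by (metis minus_diff_eq minus_divide_divide)
  show "(D t - D x) / (t - x) \<le> (D y - D x) / (y - x)"
    using convex_on_slope_le(1)[OF cvx, of x y t] assms e[of x t] e[of x y] by simp
  show "(D y - D x) / (y - x) \<le> (D y - D t) / (y - t)"
    using convex_on_slope_le(2)[OF cvx, of x y t] assms e[of t y] e[of x y] by simp
qed

text \<open>The slopes to the right of \<open>s\<close> increase with \<open>t\<close> and are
  bounded below by any slope to the left, so their infimum is their limit. The slope to 0 provides a
  lower bound because \<open>s > 0\<close>.\<close>

lemma right_deriv_slopes: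
  assumes s: "0 < s"
  shows "((\<lambda>t. (D t - D s) / (t - s)) \<longlongrightarrow> f s) (at_right s)"
    and "\<And>t. s < t \<Longrightarrow> f s \<le> (D t - D s) / (t - s)"
    and "\<And>r. 0 \<le> r \<Longrightarrow> r < s \<Longrightarrow> (D s - D r) / (s - r) \<le> f s"
proof -
  let ?q = "\<lambda>t. (D t - D s) / (t - s)"
  define R where "R = Inf (?q ` {s<..})"
  have lower: "(D s - D r) / (s - r) \<le> ?q t" if "0 \<le> r" "r < s" "s < t" for r t
    using slope_mono[of r s t] that by linarith
  have bdd: "bdd_below (?q ` {s<..})"
    by (rule bdd_belowI2[of _ "(D s - D 0) / (s - 0)"]) (use lower[of 0] s in auto)
  have R1: "R \<le> ?q t" if "s < t" for t
    unfolding R_def using that by (intro cINF_lower bdd) auto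
  have R2: "(D s - D r) / (s - r) \<le> R" if "0 \<le> r" "r < s" for r
    unfolding R_def using lower[OF that] by (intro cINF_greatest) auto
  have lim: "(?q \<longlongrightarrow> R) (at_right s)"
  proof (rule order_tendstoI)
    fix a assume "a < R"
    show "eventually (\<lambda>t. a < ?q t) (at_right s)"
      using eventually_at_right_less[of s] by eventually_elim (use R1 \<open>a < R\<close> less_le_trans in blast)
  next
    fix a assume "R < a"
    then obtain t where t: "s < t" "?q t < a"
      unfolding R_def using cINF_less_iff[OF _ bdd, of a] by auto
    have "eventually (\<lambda>r. r < t) (at_right s)" using t(1) by (rule eventually_at_right_real[THEN eventually_mono]) auto
    then show "eventually (\<lambda>r. ?q r < a) (at_right s)"
      using eventually_at_right_less[of s]
    proof eventually_elim
      case (elim r)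
      have "?q r \<le> ?q t" using slope_mono(1)[of s r t] elim s by simp
      then show ?case using t(2) by linarith
    qed
  qed
  then have "(D has_vector_derivative R) (at_right s)"
    by (simp add: has_field_derivative_iff has_real_derivative_iff_has_vector_derivative[symmetric])
  then have "f s = R" unfolding right_deriv_def
    by (intro vector_derivative_within) (auto simp: trivial_limit_at_right_real)
  then show "(?q \<longlongrightarrow> f s) (at_right s)" "\<And>t. s < t \<Longrightarrow> f s \<le> ?q t"
    "\<And>r. 0 \<le> r \<Longrightarrow> r < s \<Longrightarrow> (D s - D r) / (s - r) \<le> f s"
    using lim R1 R2 by auto
qed

lemma right_deriv_mono: "0 < s \<Longrightarrow> s \<le> t \<Longrightarrow> f s \<le> f t"
  using right_deriv_slopes(2)[of s t] right_deriv_slopes(3)[of t s] by (cases "s = t") force+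

lemma right_deriv_measurable: "(\<lambda>s. indicator {0<..} s * f s) \<in> borel_measurable borel"
proof -
  have "f \<in> borel_measurable (restrict_space borel {0<..})"
    by (rule borel_measurable_mono_on_fnc) (auto simp: mono_on_def intro: right_deriv_mono)
  then show ?thesis by (simp add: borel_measurable_restrict_space_iff mult.commute)
qed

text \<open>\<open>ennreal\<close> sends negative reals to 0, so this integrates the positive part
  of the derivative, and \<open>neg_part\<close> the negative part.\<close>

definition pos_part :: "real set \<Rightarrow> ennreal" where
  "pos_part A = (\<integral>\<^sup>+s. ennreal (f s) * indicator A s \<partial>lborel)"

definition neg_part :: "real set \<Rightarrow> ennreal" where
  "neg_part A = (\<integral>\<^sup>+s. ennreal (- f s) * indicator A s \<partial>lborel)"

lemma parts_measurable:
  assumes "A \<in> sets borel" "A \<subseteq> {0<..}"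
  shows "(\<lambda>s. ennreal (f s) * indicator A s) \<in> borel_measurable borel"
    and "(\<lambda>s. ennreal (- f s) * indicator A s) \<in> borel_measurable borel"
proof -
  note [measurable] = right_deriv_measurable assms(1)
  have "(\<lambda>s. ennreal (f s) * indicator A s) = (\<lambda>s. ennreal (indicator {0<..} s * f s) * indicator A s)"
    using assms(2) by (intro ext) (auto simp: indicator_def)
  then show "(\<lambda>s. ennreal (f s) * indicator A s) \<in> borel_measurable borel" by simp
  have "(\<lambda>s. ennreal (- f s) * indicator A s) = (\<lambda>s. ennreal (- (indicator {0<..} s * f s)) * indicator A s)"
    using assms(2) by (intro ext) (auto simp: indicator_def)
  then show "(\<lambda>s. ennreal (- f s) * indicator A s) \<in> borel_measurable borel" by simp
qed

lemma right_deriv_integrable: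
  assumes a: "0 < a"
  shows "integrable lborel (\<lambda>s. indicator {a<..b} s * f s)"
proof (rule Bochner_Integration.integrable_bound)
  show "integrable lborel (\<lambda>s. indicator {a<..b} s * (\<bar>f a\<bar> + \<bar>f b\<bar>))"
    by (cases "a \<le> b") (auto intro!: integrable_mult_left integrable_real_indicator)
  have "(\<lambda>s. indicator {a<..b} s * f s) = (\<lambda>s. indicator {a<..b} s * (indicator {0<..} s * f s))"
    using a by (auto simp: indicator_def)
  then show "(\<lambda>s. indicator {a<..b} s * f s) \<in> borel_measurable lborel"
    using right_deriv_measurable by simp
  show "AE s in lborel. norm (indicator {a<..b} s * f s) \<le> norm (indicator {a<..b} s * (\<bar>f a\<bar> + \<bar>f b\<bar>))"
  proof (rule AE_I2)
    fix s
    show "norm (indicator {a<..b} s * f s) \<le> norm (indicator {a<..b} s * (\<bar>f a\<bar> + \<bar>f b\<bar>))"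
    proof (cases "s \<in> {a<..b}")
      case True
      then have "f a \<le> f s" "f s \<le> f b" using a by (auto intro: right_deriv_mono)
      then show ?thesis using True by auto
    qed simp
  qed
qed

text \<open>The derivative is monotone but may jump. The error \<open>E\<close> is additive over
  adjacent intervals and at most the oscillation of \<open>f\<close> times the length; over equal
  pieces the oscillations telescope, leaving a bound that vanishes with the mesh.\<close>

lemma right_deriv_ftc:
  assumes a: "0 < a" "a \<le> b"
  shows "(\<integral>s. indicator {a<..b} s * f s \<partial>lborel) = D b - D a"
proof -
  define E where "E x y = D y - D x - (\<integral>s. indicator {x<..y} s * f s \<partial>lborel)" for x y
  have add: "E x z = E x y + E y z" if "a \<le> x" "x \<le> y" "y \<le> z" for x y z
  proof -
    have "(\<integral>s. indicator {x<..z} s * f s \<partial>lborel) = (\<integral>s. indicator {x<..y} s * f s + indicator {y<..z} s * f s \<partial>lborel)"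
      using that by (intro Bochner_Integration.integral_cong) (auto simp: indicator_def)
    also have "\<dots> = (\<integral>s. indicator {x<..y} s * f s \<partial>lborel) + (\<integral>s. indicator {y<..z} s * f s \<partial>lborel)"
      using that a by (intro Bochner_Integration.integral_add right_deriv_integrable) auto
    finally show ?thesis by (simp add: E_def)
  qed
  have bound: "\<bar>E x y\<bar> \<le> (f y - f x) * (y - x)" if xy: "a \<le> x" "x < y" for x y
  proof -
    have ci: "(\<integral>s. indicator {x<..y} s * c \<partial>lborel) = (y - x) * c" "integrable lborel (\<lambda>s. indicator {x<..y} s * c)" for c :: real
      using xy by (auto intro!: integrable_mult_left integrable_real_indicator)
    have 1: "(y - x) * f x \<le> (\<integral>s. indicator {x<..y} s * f s \<partial>lborel)"
      unfolding ci(1)[symmetric] using xy a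
      by (intro integral_mono ci(2) right_deriv_integrable) (auto simp: indicator_def intro: right_deriv_mono)
    have 2: "(\<integral>s. indicator {x<..y} s * f s \<partial>lborel) \<le> (y - x) * f y"
      unfolding ci(1)[symmetric] using xy a
      by (intro integral_mono ci(2) right_deriv_integrable) (auto simp: indicator_def intro: right_deriv_mono)
    have "f x \<le> (D y - D x) / (y - x)" "(D y - D x) / (y - x) \<le> f y"
      using right_deriv_slopes(2)[of x y] right_deriv_slopes(3)[of y x] xy a by auto
    then have 3: "(y - x) * f x \<le> D y - D x" "D y - D x \<le> (y - x) * f y"
      using xy by (simp_all add: pos_le_divide_eq pos_divide_le_eq mult.commute)
    show ?thesis using 1 2 3 unfolding E_def abs_le_iff by (simp add: algebra_simps)
  qed
  have "\<bar>E a b\<bar> \<le> 0"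
  proof (cases "a = b")
    case True
    then show ?thesis by (simp add: E_def)
  next
    case False
    then have ab: "a < b" using a by simp
    have n: "\<bar>E a b\<bar> \<le> (f b - f a) * (b - a) * inverse (real (Suc n))" for n
    proof -
      define h where "h = (b - a) / real (Suc n)"
      have h: "0 < h" using ab by (simp add: h_def)
      have "\<bar>E a (a + real k * h)\<bar> \<le> (f (a + real k * h) - f a) * h" for k
      proof (induction k)
        case 0
        show ?case by (simp add: E_def)
      next
        case (Suc k)
        let ?x = "a + real k * h" and ?y = "a + real (Suc k) * h"
        have xy: "a \<le> ?x" "?x < ?y" "?y - ?x = h" using h by (auto simp: algebra_simps)
        have "E a ?y = E a ?x + E ?x ?y" using xy by (intro add) auto
        then have "\<bar>E a ?y\<bar> \<le> \<bar>E a ?x\<bar> + \<bar>E ?x ?y\<bar>" by simp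
        also have "\<dots> \<le> (f ?x - f a) * h + (f ?y - f ?x) * h"
          using Suc bound[OF xy(1,2)] xy(3) by simp
        finally show ?case by (simp add: algebra_simps)
      qed
      from this[of "Suc n"] have "\<bar>E a (a + real (Suc n) * h)\<bar> \<le> (f (a + real (Suc n) * h) - f a) * h" .
      moreover have "a + real (Suc n) * h = b" by (simp add: h_def del: of_nat_Suc)
      ultimately show ?thesis by (simp add: h_def divide_inverse mult.assoc del: of_nat_Suc)
    qed
    have "(\<lambda>n. (f b - f a) * (b - a) * inverse (real (Suc n))) \<longlonglongrightarrow> (f b - f a) * (b - a) * 0"
      by (intro tendsto_mult tendsto_const LIMSEQ_inverse_real_of_nat)
    then show ?thesis using n by (intro LIMSEQ_le_const) auto
  qed
  then show ?thesis by (simp add: E_def)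
qed

lemma parts_interval:
  assumes a: "0 < a" "a \<le> b"
  shows "ennreal (D b) + neg_part {a<..b} = ennreal (D a) + pos_part {a<..b}" "pos_part {a<..b} < \<infinity>" "neg_part {a<..b} < \<infinity>"
proof -
  let ?g = "\<lambda>s. indicator {a<..b} s * f s"
  have p: "pos_part {a<..b} = (\<integral>\<^sup>+s. ennreal (?g s) \<partial>lborel)" unfolding pos_part_def
    by (intro nn_integral_cong) (simp add: indicator_def)
  have n: "neg_part {a<..b} = (\<integral>\<^sup>+s. ennreal (- ?g s) \<partial>lborel)" unfolding neg_part_def
    by (intro nn_integral_cong) (simp add: indicator_def)
  note g = right_deriv_integrable[OF a(1), of b]
  show fin: "pos_part {a<..b} < \<infinity>" "neg_part {a<..b} < \<infinity>"
    using g unfolding p n real_integrable_def by (auto simp: less_top)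
  have "(\<integral>s. ?g s \<partial>lborel) = enn2real (pos_part {a<..b}) - enn2real (neg_part {a<..b})"
    unfolding p n by (rule real_lebesgue_integral_def[OF g])
  then have "D b + enn2real (neg_part {a<..b}) = D a + enn2real (pos_part {a<..b})"
    using right_deriv_ftc[OF a] by simp
  then have "ennreal (D b) + ennreal (enn2real (neg_part {a<..b})) = ennreal (D a) + ennreal (enn2real (pos_part {a<..b}))"
    using nonneg[of a] nonneg[of b] a by (simp add: ennreal_plus[symmetric] del: ennreal_plus)
  then show "ennreal (D b) + neg_part {a<..b} = ennreal (D a) + pos_part {a<..b}"
    using fin by simp
qed

lemma nn_integral_indicator_LIMSEQ:
  fixes h :: "real \<Rightarrow> ennreal"
  assumes m: "\<And>n. (\<lambda>s. h s * indicator (A n) s) \<in> borel_measurable lborel" and inc: "incseq A"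
  shows "(\<lambda>n. \<integral>\<^sup>+s. h s * indicator (A n) s \<partial>lborel) \<longlonglongrightarrow> (\<integral>\<^sup>+s. h s * indicator (\<Union>n. A n) s \<partial>lborel)"
proof (rule nn_integral_LIMSEQ)
  show "incseq (\<lambda>n s. h s * indicator (A n) s)"
    using inc by (auto simp: incseq_def le_fun_def indicator_def)
  fix s
  show "(\<lambda>n. h s * indicator (A n) s) \<longlonglongrightarrow> h s * indicator (\<Union>n. A n) s"
  proof (cases "s \<in> (\<Union>n. A n)")
    case True
    then obtain N where "s \<in> A N" by blast
    then have "s \<in> A n" if "n \<ge> N" for n using inc that by (auto simp: incseq_def)
    then have "eventually (\<lambda>n. h s * indicator (A n) s = h s) sequentially"
      unfolding eventually_sequentially by (intro exI[of _ N]) simp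
    then show ?thesis using True by (simp add: tendsto_eventually)
  next
    case False
    then show ?thesis by simp
  qed
qed (rule m)

text \<open>The derivative may be unbounded near 0, so the identity on \<open>{a<..T}\<close> is
  passed to the limit by monotone convergence, with \<open>rc0\<close> for the values of
  \<open>D\<close>. The additive form avoids subtracting integrals not yet known to be
  finite.\<close>

lemma parts_eq:
  assumes T: "0 \<le> T"
  shows "ennreal (D T) + neg_part {0<..T} = ennreal (D 0) + pos_part {0<..T}"
proof (cases "T = 0")
  case True
  then show ?thesis by (simp add: neg_part_def pos_part_def)
next
  case False
  then have T: "0 < T" using T by simp
  let ?a = "\<lambda>n. T * inverse (real (Suc n))"
  have a: "0 < ?a n" "?a n \<le> T" for n
  proof -
    have "inverse (real (Suc n)) \<le> 1" by (simp add: inverse_le_1_iff)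
    then show "0 < ?a n" "?a n \<le> T" using T mult_left_mono[of "inverse (real (Suc n))" 1 T] by auto
  qed
  have a0: "?a \<longlonglongrightarrow> 0"
    using tendsto_mult[OF tendsto_const LIMSEQ_inverse_real_of_nat, of T] by simp
  have inc: "incseq (\<lambda>n. {?a n<..T})"
  proof (rule incseq_SucI)
    fix n
    have "inverse (real (Suc (Suc n))) \<le> inverse (real (Suc n))" by (intro le_imp_inverse_le) auto
    then have "?a (Suc n) \<le> ?a n" using T by (intro mult_left_mono) auto
    then show "{?a n<..T} \<subseteq> {?a (Suc n)<..T}" by (auto simp del: of_nat_Suc)
  qed
  have un: "(\<Union>n. {?a n<..T}) = {0<..T}"
  proof (rule set_eqI, rule iffI)
    fix s assume "s \<in> {0<..T}"
    then have "eventually (\<lambda>n. ?a n < s) sequentially" using a0 by (intro order_tendstoD) auto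
    then obtain n where "?a n < s" by (auto simp: eventually_sequentially)
    then show "s \<in> (\<Union>n. {?a n<..T})" using \<open>s \<in> {0<..T}\<close> by (intro UN_I[of n]) (auto simp del: of_nat_Suc)
  next
    fix s assume "s \<in> (\<Union>n. {?a n<..T})"
    then obtain n where "?a n < s" "s \<le> T" by auto
    then show "s \<in> {0<..T}" using a(1)[of n] by simp
  qed
  have sub: "{?a n<..T} \<subseteq> {0<..}" for n using a(1)[of n] by auto
  have lp: "(\<lambda>n. pos_part {?a n<..T}) \<longlonglongrightarrow> pos_part {0<..T}"
    unfolding pos_part_def using nn_integral_indicator_LIMSEQ[OF _ inc, of "\<lambda>s. ennreal (f s)"] parts_measurable(1)[OF _ sub] un by simp
  have ln: "(\<lambda>n. neg_part {?a n<..T}) \<longlonglongrightarrow> neg_part {0<..T}"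
    unfolding neg_part_def using nn_integral_indicator_LIMSEQ[OF _ inc, of "\<lambda>s. ennreal (- f s)"] parts_measurable(2)[OF _ sub] un by simp
  have "filterlim ?a (at_right 0) sequentially"
    using a0 a(1) by (auto simp: filterlim_at_right_to_0 filterlim_at intro!: always_eventually simp del: of_nat_Suc)
  then have lD: "(\<lambda>n. D (?a n)) \<longlonglongrightarrow> D 0" using rc0 by (rule filterlim_compose[rotated])
  have "(\<lambda>n. ennreal (D T) + neg_part {?a n<..T}) \<longlonglongrightarrow> ennreal (D T) + neg_part {0<..T}"
    by (intro tendsto_add tendsto_const ln)
  moreover have "(\<lambda>n. ennreal (D (?a n)) + pos_part {?a n<..T}) \<longlonglongrightarrow> ennreal (D 0) + pos_part {0<..T}"
    by (intro tendsto_add lp tendsto_ennrealI lD)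
  moreover have "ennreal (D T) + neg_part {?a n<..T} = ennreal (D (?a n)) + pos_part {?a n<..T}" for n
    by (rule parts_interval(1)[OF a])
  ultimately show ?thesis using LIMSEQ_unique by fastforce
qed

text \<open>By monotonicity the derivative is negative first and nonnegative afterwards, so its
  negative part integrates to a single descent from \<open>D 0\<close>, which cannot exceed
  \<open>D 0\<close> because \<open>D\<close> stays nonnegative.\<close>

lemma neg_part_le_bounded:
  assumes T: "0 \<le> T"
  shows "neg_part {0<..T} \<le> ennreal (D 0)"
proof (cases "\<exists>t. 0 < t \<and> t \<le> T \<and> 0 \<le> f t")
  case False
  then have "pos_part {0<..T} = 0" unfolding pos_part_def
  proof (subst nn_integral_0_iff_AE)
    show "AE s in lborel. ennreal (f s) * indicator {0<..T} s = 0"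
    proof (rule AE_I2)
      fix s
      show "ennreal (f s) * indicator {0<..T} s = 0"
        using False by (cases "s \<in> {0<..T}") (force simp: ennreal_neg not_le)+
    qed
  qed (auto intro!: parts_measurable)
  then have "ennreal (D T) + neg_part {0<..T} = ennreal (D 0)" using parts_eq[OF T] by simp
  then show ?thesis by (metis le_add_same_cancel2 zero_le add.commute le_iff_add)
next
  case True
  \<comment> \<open>The time of the change of sign; it may be 0, and the sign of \<open>f t0\<close>
    itself is irrelevant to the integrals.\<close>
  define t0 where "t0 = Inf {t. 0 < t \<and> t \<le> T \<and> 0 \<le> f t}"
  have ne: "{t. 0 < t \<and> t \<le> T \<and> 0 \<le> f t} \<noteq> {}" using True by auto
  have bdd: "bdd_below {t. 0 < t \<and> t \<le> T \<and> 0 \<le> f t}" by (rule bdd_belowI[of _ 0]) auto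
  have t0: "0 \<le> t0" "t0 \<le> T"
    using ne cInf_greatest[OF ne, of 0] cInf_lower[OF _ bdd] unfolding t0_def by (auto intro: order_trans)
  have neg: "f s \<le> 0" if "0 < s" "s < t0" for s
  proof (rule ccontr)
    assume "\<not> f s \<le> 0"
    then have "s \<in> {t. 0 < t \<and> t \<le> T \<and> 0 \<le> f t}" using that t0 by auto
    then have "t0 \<le> s" unfolding t0_def by (rule cInf_lower[OF _ bdd])
    then show False using that by simp
  qed
  have pos: "0 \<le> f s" if "t0 < s" for s
  proof -
    have "\<exists>t\<in>{t. 0 < t \<and> t \<le> T \<and> 0 \<le> f t}. t < s"
      using that unfolding t0_def by (rule cInf_less_iff[OF ne bdd, THEN iffD1])
    then obtain t where "0 < t" "0 \<le> f t" "t < s" by blast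
    then show ?thesis using right_deriv_mono[of t s] by simp
  qed
  have "neg_part {0<..T} = neg_part {0<..t0}" unfolding neg_part_def
  proof (rule nn_integral_cong)
    fix s
    show "ennreal (- f s) * indicator {0<..T} s = ennreal (- f s) * indicator {0<..t0} s"
      using pos[of s] t0 by (auto simp: indicator_def ennreal_neg)
  qed
  moreover have "pos_part {0<..t0} = 0" unfolding pos_part_def
  proof (subst nn_integral_0_iff_AE)
    show "AE s in lborel. ennreal (f s) * indicator {0<..t0} s = 0"
      using AE_lborel_singleton[of t0]
    proof eventually_elim
      case (elim s)
      then show ?case using neg[of s] by (auto simp: indicator_def ennreal_neg)
    qed
  qed (auto intro!: parts_measurable)
  then have "ennreal (D t0) + neg_part {0<..t0} = ennreal (D 0)" using parts_eq[OF t0(1)] by simp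
  ultimately show ?thesis by (metis add.commute le_iff_add)
qed

lemma nn_integral_at_top:
  fixes h :: "real \<Rightarrow> ennreal"
  assumes m: "\<And>T. (\<lambda>s. h s * indicator {0<..T} s) \<in> borel_measurable lborel"
  shows "((\<lambda>T. \<integral>\<^sup>+s. h s * indicator {0<..T} s \<partial>lborel) \<longlongrightarrow> (\<integral>\<^sup>+s. h s * indicator {0<..} s \<partial>lborel)) at_top"
proof -
  let ?J = "\<lambda>T. \<integral>\<^sup>+s. h s * indicator {0<..T} s \<partial>lborel"
  have mono: "?J S \<le> ?J T" if "S \<le> T" for S T
    using that by (intro nn_integral_mono mult_left_mono) (auto simp: indicator_def)
  have le: "?J T \<le> (\<integral>\<^sup>+s. h s * indicator {0<..} s \<partial>lborel)" for T
    by (intro nn_integral_mono mult_left_mono) (auto simp: indicator_def)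
  have un: "(\<Union>n. {0<..real n}) = {0<..}"
  proof (rule set_eqI, rule iffI)
    fix s :: real assume s: "s \<in> {0<..}"
    obtain n :: nat where "s \<le> real n" using real_arch_simple[of s] by blast
    then show "s \<in> (\<Union>n. {0<..real n})" using s by (intro UN_I[of n]) auto
  qed auto
  have "incseq (\<lambda>n. {0<..real n})" by (intro incseq_SucI) auto
  from nn_integral_indicator_LIMSEQ[OF m this]
  have seq: "(\<lambda>n. ?J (real n)) \<longlonglongrightarrow> (\<integral>\<^sup>+s. h s * indicator {0<..} s \<partial>lborel)" by (simp only: un)
  show ?thesis
  proof (rule order_tendstoI)
    fix a assume "a < (\<integral>\<^sup>+s. h s * indicator {0<..} s \<partial>lborel)"
    from order_tendstoD(1)[OF seq this] obtain n where "a < ?J (real n)" by (auto simp: eventually_sequentially)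
    then have "a < ?J T" if "T \<ge> real n" for T using mono[OF that] by (rule less_le_trans)
    then show "eventually (\<lambda>T. a < ?J T) at_top" unfolding eventually_at_top_linorder by blast
  next
    fix a assume a: "(\<integral>\<^sup>+s. h s * indicator {0<..} s \<partial>lborel) < a"
    show "eventually (\<lambda>T. ?J T < a) at_top"
      by (rule always_eventually, rule allI, rule le_less_trans[OF le a])
  qed
qed

lemma pos_part_tendsto: "((\<lambda>T. pos_part {0<..T}) \<longlongrightarrow> pos_part {0<..}) at_top"
  unfolding pos_part_def by (rule nn_integral_at_top) (auto intro!: parts_measurable)

lemma neg_part_tendsto: "((\<lambda>T. neg_part {0<..T}) \<longlongrightarrow> neg_part {0<..}) at_top"
  unfolding neg_part_def by (rule nn_integral_at_top) (auto intro!: parts_measurable)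

lemma neg_part_le: "neg_part {0<..} \<le> ennreal (D 0)"
proof (rule tendsto_upperbound[OF neg_part_tendsto])
  show "eventually (\<lambda>T. neg_part {0<..T} \<le> ennreal (D 0)) at_top"
    using eventually_ge_at_top[of 0] by eventually_elim (rule neg_part_le_bounded)
qed simp

lemma payoff_eq_parts:
  assumes T: "0 \<le> T"
  shows "ereal (D T) = enn2ereal (ennreal (D 0) + pos_part {0<..T}) - enn2ereal (neg_part {0<..T})"
proof -
  have fin: "neg_part {0<..T} < \<infinity>" using neg_part_le_bounded[OF T] by (rule le_less_trans) simp
  then obtain r where r: "neg_part {0<..T} = ennreal r" "0 \<le> r" by (cases "neg_part {0<..T}") auto
  have "enn2ereal (ennreal (D 0) + pos_part {0<..T}) = enn2ereal (ennreal (D T) + ennreal r)"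
    using parts_eq[OF T] r by simp
  also have "\<dots> = ereal (D T + r)" using nonneg[OF T] r by (simp add: ennreal_plus[symmetric] del: ennreal_plus)
  finally show ?thesis using r by simp
qed

text \<open>This computes the value that \<open>stopped_value\<close> assigns to an infinite time.
  The bound on \<open>neg_part\<close> rules out a difference of infinities.\<close>

lemma payoff_tendsto: "((\<lambda>t. ereal (D t)) \<longlongrightarrow> enn2ereal (ennreal (D 0) + pos_part {0<..}) - enn2ereal (neg_part {0<..})) at_top"
proof -
  have fin: "neg_part {0<..} < \<infinity>" using neg_part_le by (rule le_less_trans) simp
  have "((\<lambda>T. enn2ereal (ennreal (D 0) + pos_part {0<..T}) - enn2ereal (neg_part {0<..T})) \<longlongrightarrow>
     enn2ereal (ennreal (D 0) + pos_part {0<..}) - enn2ereal (neg_part {0<..})) at_top"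
  proof (intro tendsto_diff_ereal_general tendsto_enn2erealI tendsto_add tendsto_const pos_part_tendsto neg_part_tendsto)
    have "enn2ereal (neg_part {0<..}) \<noteq> \<infinity>" using fin by (simp add: enn2ereal_eq_top_iff)
    moreover have "enn2ereal (neg_part {0<..}) \<noteq> - \<infinity>" using enn2ereal_nonneg[of "neg_part {0<..}"] by auto
    ultimately show "\<not> (enn2ereal (ennreal (D 0) + pos_part {0<..}) = \<infinity> \<and> enn2ereal (neg_part {0<..}) = \<infinity> \<or>
      enn2ereal (ennreal (D 0) + pos_part {0<..}) = - \<infinity> \<and> enn2ereal (neg_part {0<..}) = - \<infinity>)" by blast
  qed
  then show ?thesis
  proof (rule Lim_transform_eventually)
    show "eventually (\<lambda>T. enn2ereal (ennreal (D 0) + pos_part {0<..T}) - enn2ereal (neg_part {0<..T}) = ereal (D T)) at_top"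
      using eventually_ge_at_top[of 0] by eventually_elim (simp only: payoff_eq_parts)
  qed
qed

end

text \<open>The set \<open>A\<close> treats finite and infinite \<open>T\<close> alike: it is
  \<open>{0<..t}\<close> or \<open>{0<..}\<close>. It omits 0, where the right derivative may
  diverge.\<close>

lemma stopped_value_eq:
  fixes d :: "real \<Rightarrow> real \<Rightarrow> real" and T :: ennreal
  assumes "convex_right_continuous (\<lambda>t. d t \<gamma>)"
  defines "A \<equiv> {s. 0 < s \<and> ennreal s \<le> T}"
  shows "stopped_value d T \<gamma> =
      enn2ereal (ennreal (d 0 \<gamma>) + (\<integral>\<^sup>+s. ennreal (right_deriv (\<lambda>t. d t \<gamma>) s) * indicator A s \<partial>lborel)) -
      enn2ereal (\<integral>\<^sup>+s. ennreal (- right_deriv (\<lambda>t. d t \<gamma>) s) * indicator A s \<partial>lborel)"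
    and "(\<integral>\<^sup>+s. ennreal (- right_deriv (\<lambda>t. d t \<gamma>) s) * indicator A s \<partial>lborel) \<le> ennreal (d 0 \<gamma>)"
proof -
  interpret convex_right_continuous "\<lambda>t. d t \<gamma>" by fact
  show "stopped_value d T \<gamma> =
      enn2ereal (ennreal (d 0 \<gamma>) + (\<integral>\<^sup>+s. ennreal (right_deriv (\<lambda>t. d t \<gamma>) s) * indicator A s \<partial>lborel)) -
      enn2ereal (\<integral>\<^sup>+s. ennreal (- right_deriv (\<lambda>t. d t \<gamma>) s) * indicator A s \<partial>lborel)"
  proof (cases "T = \<top>")
    case True
    then have A: "A = {0<..}" by (auto simp: A_def)
    have "Lim at_top (\<lambda>t. ereal (d t \<gamma>)) = enn2ereal (ennreal (d 0 \<gamma>) + pos_part {0<..}) - enn2ereal (neg_part {0<..})"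
      by (rule tendsto_Lim[OF _ payoff_tendsto]) simp
    then show ?thesis using True by (simp add: stopped_value_def A pos_part_def neg_part_def)
  next
    case False
    then obtain t where t: "T = ennreal t" "0 \<le> t" by (cases T) auto
    then have A: "A = {0<..t}" by (auto simp: A_def)
    show ?thesis using payoff_eq_parts[OF t(2)] t False by (simp add: stopped_value_def A pos_part_def neg_part_def)
  qed
  have "(\<integral>\<^sup>+s. ennreal (- right_deriv (\<lambda>t. d t \<gamma>) s) * indicator A s \<partial>lborel) \<le> neg_part {0<..}"
    unfolding neg_part_def by (intro nn_integral_mono mult_left_mono) (auto simp: A_def indicator_def)
  then show "(\<integral>\<^sup>+s. ennreal (- right_deriv (\<lambda>t. d t \<gamma>) s) * indicator A s \<partial>lborel) \<le> ennreal (d 0 \<gamma>)"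
    using neg_part_le by (rule order_trans)
qed

section \<open>Last zeros and joint measurability\<close>

text \<open>Approximating the time by grid points from the right gives functions that depend on it
  through an integer only, hence are jointly measurable. The truncation \<open>max 0\<close> extends
  them to all real times.\<close>

lemma right_continuous_joint_measurable:
  fixes h :: "real \<Rightarrow> 'b \<Rightarrow> real"
  assumes m: "\<And>s. 0 \<le> s \<Longrightarrow> h s \<in> borel_measurable N"
    and rc: "\<And>s \<omega>. 0 \<le> s \<Longrightarrow> \<omega> \<in> space N \<Longrightarrow> ((\<lambda>t. h t \<omega>) \<longlongrightarrow> h s \<omega>) (at_right s)"
  shows "(\<lambda>p. h (max 0 (fst p)) (snd p)) \<in> borel_measurable (borel \<Otimes>\<^sub>M N)"
proof -
  \<comment> \<open>The next multiple of \<open>1 / real (Suc n)\<close> strictly beyond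
    \<open>s\<close>; the summand 1 gives the strictness required by a limit along
    \<open>at_right\<close>.\<close>
  define r where "r n s = (of_int \<lfloor>real (Suc n) * s\<rfloor> + 1) * inverse (real (Suc n))" for n and s :: real
  have r: "s < r n s" "r n s \<le> s + inverse (real (Suc n))" for n s
  proof -
    have "real (Suc n) * s < of_int \<lfloor>real (Suc n) * s\<rfloor> + 1" "of_int \<lfloor>real (Suc n) * s\<rfloor> \<le> real (Suc n) * s"
      by linarith+
    then have "real (Suc n) * s * inverse (real (Suc n)) < r n s" "r n s \<le> (real (Suc n) * s + 1) * inverse (real (Suc n))"
      unfolding r_def by (auto intro!: mult_strict_right_mono mult_right_mono simp del: of_nat_Suc)
    then show "s < r n s" "r n s \<le> s + inverse (real (Suc n))"
      by (simp_all add: distrib_right mult.commute[of _ s] mult.assoc del: of_nat_Suc)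
  qed
  show ?thesis
  proof (rule borel_measurable_LIMSEQ_real)
    fix p :: "real \<times> 'b" assume p: "p \<in> space (borel \<Otimes>\<^sub>M N)"
    let ?s = "max 0 (fst p)"
    have "(\<lambda>n. r n ?s) \<longlonglongrightarrow> ?s"
    proof (rule tendsto_sandwich[OF _ _ tendsto_const])
      show "(\<lambda>n. ?s + inverse (real (Suc n))) \<longlonglongrightarrow> ?s"
        using tendsto_add[OF tendsto_const LIMSEQ_inverse_real_of_nat, of ?s] by simp
      show "eventually (\<lambda>n. ?s \<le> r n ?s) sequentially" using r(1) by (intro always_eventually allI less_imp_le)
      show "eventually (\<lambda>n. r n ?s \<le> ?s + inverse (real (Suc n))) sequentially" using r(2) by (intro always_eventually allI)
    qed
    moreover have "eventually (\<lambda>n. r n ?s > ?s) sequentially" using r(1) by simp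
    ultimately have "filterlim (\<lambda>n. r n ?s) (at_right ?s) sequentially"
      by (auto simp: filterlim_at elim: eventually_mono)
    moreover have "((\<lambda>t. h t (snd p)) \<longlongrightarrow> h ?s (snd p)) (at_right ?s)"
      using p by (intro rc) (auto simp: space_pair_measure)
    ultimately show "(\<lambda>n. h (r n ?s) (snd p)) \<longlonglongrightarrow> h ?s (snd p)" by (rule filterlim_compose[rotated])
  next
    fix n
    let ?h = "\<lambda>(i::int) p. h (max 0 ((of_int i + 1) * inverse (real (Suc n)))) (snd p)"
    have 1: "(\<lambda>p. ?h (\<lfloor>real (Suc n) * max 0 (fst p)\<rfloor>) p) \<in> borel_measurable (borel \<Otimes>\<^sub>M N)"
    proof (rule measurable_compose_countable[of ?h "borel \<Otimes>\<^sub>M N" borel "\<lambda>p. \<lfloor>real (Suc n) * max 0 (fst p)\<rfloor>"])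
      show "(\<lambda>p. \<lfloor>real (Suc n) * max 0 (fst p)\<rfloor>) \<in> measurable (borel \<Otimes>\<^sub>M N) (count_space UNIV)" by measurable
      show "?h i \<in> borel_measurable (borel \<Otimes>\<^sub>M N)" for i
        by (rule measurable_compose[OF measurable_snd m]) simp
    qed
    have 2: "max 0 (r n (max 0 x)) = r n (max 0 x)" for x using r(1)[of "max 0 x" n] by simp
    have eq: "(\<lambda>p. h (r n (max 0 (fst p))) (snd p)) = (\<lambda>p. ?h (\<lfloor>real (Suc n) * max 0 (fst p)\<rfloor>) p)"
      by (subst 2[symmetric]) (simp add: r_def)
    show "(\<lambda>p. h (r n (max 0 (fst p))) (snd p)) \<in> borel_measurable (borel \<Otimes>\<^sub>M N)"
      unfolding eq by (rule 1)
  qed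
qed

section \<open>Measurability of the payoff and of its right derivative\<close>

locale convex_payoff =
  fixes d :: "real \<Rightarrow> real \<Rightarrow> real"
  assumes d_nonneg: "\<And>t \<gamma>. 0 \<le> t \<Longrightarrow> 0 \<le> \<gamma> \<Longrightarrow> 0 \<le> d t \<gamma>"
    and d_convex: "convex_on ({0..} \<times> {0..}) (\<lambda>(t, \<gamma>). d t \<gamma>)"
    and d_rc0: "\<And>\<gamma>. 0 \<le> \<gamma> \<Longrightarrow> ((\<lambda>t. d t \<gamma>) \<longlongrightarrow> d 0 \<gamma>) (at_right 0)"
begin

lemma section_convex:
  assumes g: "0 \<le> \<gamma>"
  shows "convex_right_continuous (\<lambda>t. d t \<gamma>)"
proof
  show "convex_on {0..} (\<lambda>t. d t \<gamma>)"
  proof (rule convex_onI)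
    fix t x y :: real assume t: "0 < t" "t < 1" and xy: "x \<in> {0..}" "y \<in> {0..}"
    have "(\<lambda>(t, \<gamma>). d t \<gamma>) ((1 - t) *\<^sub>R (x, \<gamma>) + t *\<^sub>R (y, \<gamma>)) \<le> (1 - t) * (\<lambda>(t, \<gamma>). d t \<gamma>) (x, \<gamma>) + t * (\<lambda>(t, \<gamma>). d t \<gamma>) (y, \<gamma>)"
      by (rule convex_onD[OF d_convex]) (use t xy g in auto)
    then show "d ((1 - t) *\<^sub>R x + t *\<^sub>R y) \<gamma> \<le> (1 - t) * d x \<gamma> + t * d y \<gamma>"
      by (simp add: algebra_simps)
  qed simp
qed (use d_nonneg d_rc0 g in auto)

text \<open>Convexity in the second argument gives continuity for positive \<open>\<gamma>\<close>;
  the remaining point 0 contributes a constant.\<close>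

lemma section_measurable:
  assumes s: "0 \<le> s"
  shows "(\<lambda>\<gamma>. d s (max 0 \<gamma>)) \<in> borel_measurable borel"
proof -
  have "convex_on {0..} (\<lambda>\<gamma>. d s \<gamma>)"
  proof (rule convex_onI)
    fix t x y :: real assume t: "0 < t" "t < 1" and xy: "x \<in> {0..}" "y \<in> {0..}"
    have "(\<lambda>(t, \<gamma>). d t \<gamma>) ((1 - t) *\<^sub>R (s, x) + t *\<^sub>R (s, y)) \<le> (1 - t) * (\<lambda>(t, \<gamma>). d t \<gamma>) (s, x) + t * (\<lambda>(t, \<gamma>). d t \<gamma>) (s, y)"
      by (rule convex_onD[OF d_convex]) (use t xy s in auto)
    then show "d s ((1 - t) *\<^sub>R x + t *\<^sub>R y) \<le> (1 - t) * d s x + t * d s y"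
      by (simp add: algebra_simps)
  qed simp
  then have "convex_on {0<..} (\<lambda>\<gamma>. d s \<gamma>)" by (rule convex_on_subset) auto
  then have "continuous_on {0<..} (\<lambda>\<gamma>. d s \<gamma>)" by (intro convex_on_continuous) auto
  then have m: "(\<lambda>\<gamma>. indicator {0<..} \<gamma> * d s \<gamma>) \<in> borel_measurable borel"
    using borel_measurable_continuous_on_indicator[of "{0<..}" "d s"] by simp
  have eq: "(\<lambda>\<gamma>. d s (max 0 \<gamma>)) = (\<lambda>\<gamma>. indicator {0<..} \<gamma> * d s \<gamma> + indicator {..0} \<gamma> * d s 0)"
    by (intro ext) (auto simp: indicator_def max_def)
  show ?thesis unfolding eq using m by simp
qed

lemma section_right_continuous:
  assumes g: "0 \<le> \<gamma>" and s: "0 \<le> s"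
  shows "((\<lambda>t. d t \<gamma>) \<longlongrightarrow> d s \<gamma>) (at_right s)"
proof (cases "s = 0")
  case True
  then show ?thesis using d_rc0[OF g] by simp
next
  case False
  interpret convex_right_continuous "\<lambda>t. d t \<gamma>" by (rule section_convex[OF g])
  have "convex_on {0<..} (\<lambda>t. d t \<gamma>)" by (rule convex_on_subset[OF cvx]) auto
  then have "continuous_on {0<..} (\<lambda>t. d t \<gamma>)" by (intro convex_on_continuous) auto
  then have "isCont (\<lambda>t. d t \<gamma>) s" using False s by (simp add: continuous_on_eq_continuous_at)
  then show ?thesis by (auto simp: isCont_def intro: filterlim_mono at_le)
qed

lemma d_measurable: "(\<lambda>p. d (max 0 (fst p)) (max 0 (snd p))) \<in> borel_measurable (borel \<Otimes>\<^sub>M borel)"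
  using right_continuous_joint_measurable[of "\<lambda>s \<gamma>. d s (max 0 \<gamma>)" borel]
  by (simp add: section_measurable section_right_continuous)

text \<open>A total version of the right derivative: it agrees with \<open>right_deriv\<close> for
  \<open>s > 0\<close> and nonnegative \<open>\<gamma>\<close>, and the default values make it Borel
  measurable on the whole plane.\<close>

definition dx :: "real \<Rightarrow> real \<Rightarrow> real" where
  "dx s \<gamma> = (if 0 < s then right_deriv (\<lambda>t. d t (max 0 \<gamma>)) s else 0)"

text \<open>A pointwise limit of difference quotients of the jointly measurable payoff; by convexity
  they converge to the right derivative at every \<open>s > 0\<close>.\<close>

lemma dx_measurable: "(\<lambda>p. dx (fst p) (snd p)) \<in> borel_measurable (borel \<Otimes>\<^sub>M borel)"
proof (rule borel_measurable_LIMSEQ_real)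
  let ?q = "\<lambda>n p. indicator {0<..} (fst p) * ((d (max 0 (fst p + inverse (real (Suc n)))) (max 0 (snd p)) - d (max 0 (fst p)) (max 0 (snd p))) / inverse (real (Suc n)))"
  have sh: "(\<lambda>p. (fst p + c, snd p)) \<in> measurable (borel \<Otimes>\<^sub>M borel) (borel \<Otimes>\<^sub>M (borel :: real measure))" for c :: real
    by measurable
  have "(\<lambda>p. d (max 0 (fst p + c)) (max 0 (snd p))) \<in> borel_measurable (borel \<Otimes>\<^sub>M borel)" for c
    using measurable_compose[OF sh d_measurable] by simp
  then show "?q n \<in> borel_measurable (borel \<Otimes>\<^sub>M borel)" for n
    using d_measurable by measurable
  fix p :: "real \<times> real"
  show "(\<lambda>n. ?q n p) \<longlonglongrightarrow> dx (fst p) (snd p)"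
  proof (cases "0 < fst p")
    case True
    interpret convex_right_continuous "\<lambda>t. d t (max 0 (snd p))" by (rule section_convex) simp
    have "filterlim (\<lambda>n. fst p + inverse (real (Suc n))) (at_right (fst p)) sequentially"
    proof -
      have "(\<lambda>n. fst p + inverse (real (Suc n))) \<longlonglongrightarrow> fst p + 0"
        by (intro tendsto_add tendsto_const LIMSEQ_inverse_real_of_nat)
      then show ?thesis by (auto simp: filterlim_at)
    qed
    from filterlim_compose[OF right_deriv_slopes(1)[OF True] this]
    have "(\<lambda>n. (d (fst p + inverse (real (Suc n))) (max 0 (snd p)) - d (fst p) (max 0 (snd p))) / inverse (real (Suc n)))
       \<longlonglongrightarrow> right_deriv (\<lambda>t. d t (max 0 (snd p))) (fst p)" by simp
    moreover have "max 0 (fst p + inverse (real (Suc n))) = fst p + inverse (real (Suc n))" for n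
    proof -
      have "0 < inverse (real (Suc n))" by simp
      then show ?thesis using True by linarith
    qed
    ultimately show ?thesis using True by (simp add: dx_def del: of_nat_Suc)
  qed (simp add: dx_def)
qed

end

section \<open>Last zeros before and after a fixed time\<close>

context regular_process begin

lemma X_joint: "(\<lambda>p. X (max 0 (fst p)) (snd p)) \<in> borel_measurable (borel \<Otimes>\<^sub>M M)"
  by (rule right_continuous_joint_measurable) (use rv good in \<open>auto simp: good_path_def\<close>)

abbreviation gs :: "real \<Rightarrow> 'a \<Rightarrow> real" where
  "gs s \<omega> \<equiv> last_zero_before s (\<lambda>t. X t \<omega>)"

lemma gs_ge_iff:
  assumes "\<omega> \<in> space M" "0 < u"
  shows "u \<le> gs s \<omega> \<longleftrightarrow> u \<le> s \<and> (\<forall>n::nat. \<exists>q\<in>\<rat> \<inter> {0..1}. X (u + q * (s - u)) \<omega> < 1 / real (Suc n))"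
  using last_zero_before_ge_iff[OF good[OF assms(1)] assms(2), of s]
    good_path_visit_iff_bounded[OF good[OF assms(1)], of u s 0] assms(2)
  by (cases "u \<le> s") simp_all

lemma countable_unit_rats: "countable (\<rat> \<inter> {0..1::real})"
  by (rule countable_subset[OF Int_lower1]) (rule countable_rat)

text \<open>The times \<open>u + q * (s - u)\<close> with \<open>q\<close> in \<open>{0..1}\<close>
  never exceed \<open>s\<close>, so the countable description of a visit uses the past only.\<close>

lemma gs_past: "gs s \<in> borel_measurable (past s)"
proof (rule borel_measurableI_ge)
  fix u
  show "{\<omega>\<in>space (past s). u \<le> gs s \<omega>} \<in> sets (past s)"
  proof (cases "0 < u \<and> u \<le> s")
    case False
    show ?thesis
    proof (cases "0 < u")
      case True
      then have "{\<omega>\<in>space (past s). u \<le> gs s \<omega>} = {}" using False by (auto simp: gs_ge_iff)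
      then show ?thesis by (simp only: sets.empty_sets)
    next
      case False
      have "u \<le> gs s \<omega>" for \<omega> using last_zero_before_nonneg[of s "\<lambda>t. X t \<omega>"] False by linarith
      then show ?thesis using sets.top[of "past s"] by simp
    qed
  next
    case True
    have "X (u + q * (s - u)) \<in> borel_measurable (past s)" if "q \<in> \<rat> \<inter> {0..1}" for q
    proof (rule X_past)
      show "0 \<le> u + q * (s - u)" using True that by auto
      show "u + q * (s - u) \<le> s" using True that mult_right_mono[of q 1 "s - u"] by auto
    qed
    then have "{\<omega>\<in>space (past s). \<forall>n::nat. \<exists>q\<in>\<rat> \<inter> {0..1}. X (u + q * (s - u)) \<omega> < 1 / real (Suc n)} \<in> sets (past s)"
      by (intro sets.sets_Collect_countable_All sets.sets_Collect_countable_Ex' countable_unit_rats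
          borel_measurable_less measurable_const) simp_all
    moreover have "{\<omega>\<in>space (past s). u \<le> gs s \<omega>} = {\<omega>\<in>space (past s). \<forall>n::nat. \<exists>q\<in>\<rat> \<inter> {0..1}. X (u + q * (s - u)) \<omega> < 1 / real (Suc n)}"
      using True by (auto simp: gs_ge_iff)
    ultimately show ?thesis by simp
  qed
qed

lemma gs_joint: "(\<lambda>p. gs (fst p) (snd p)) \<in> borel_measurable (borel \<Otimes>\<^sub>M M)"
proof (rule borel_measurableI_ge)
  fix u
  let ?S = "borel \<Otimes>\<^sub>M M"
  show "{p\<in>space ?S. u \<le> gs (fst p) (snd p)} \<in> sets ?S"
  proof (cases "0 < u")
    case False
    have "u \<le> gs s \<omega>" for s \<omega> using last_zero_before_nonneg[of s "\<lambda>t. X t \<omega>"] False by linarith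
    then show ?thesis by simp
  next
    case True
    have m: "(\<lambda>p. X (max 0 (u + q * (fst p - u))) (snd p)) \<in> borel_measurable ?S" for q
    proof -
      have "(\<lambda>p. (u + q * (fst p - u), snd p)) \<in> measurable ?S ?S" by measurable
      from measurable_compose[OF this X_joint] show ?thesis by simp
    qed
    have "{p\<in>space ?S. u \<le> fst p \<and> (\<forall>n::nat. \<exists>q\<in>\<rat> \<inter> {0..1}. X (max 0 (u + q * (fst p - u))) (snd p) < 1 / real (Suc n))} \<in> sets ?S"
    proof (rule sets.sets_Collect_conj)
      show "{p\<in>space ?S. u \<le> fst p} \<in> sets ?S" by measurable
      show "{p\<in>space ?S. \<forall>n::nat. \<exists>q\<in>\<rat> \<inter> {0..1}. X (max 0 (u + q * (fst p - u))) (snd p) < 1 / real (Suc n)} \<in> sets ?S"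
        by (intro sets.sets_Collect_countable_All sets.sets_Collect_countable_Ex' countable_unit_rats
          borel_measurable_less measurable_const m) simp_all
    qed
    moreover have "{p\<in>space ?S. u \<le> gs (fst p) (snd p)} =
      {p\<in>space ?S. u \<le> fst p \<and> (\<forall>n::nat. \<exists>q\<in>\<rat> \<inter> {0..1}. X (max 0 (u + q * (fst p - u))) (snd p) < 1 / real (Suc n))}"
    proof (rule Collect_cong, rule conj_cong[OF refl])
      fix p :: "real \<times> 'a" assume "p \<in> space ?S"
      then have w: "snd p \<in> space M" by (auto simp: space_pair_measure)
      show "u \<le> gs (fst p) (snd p) \<longleftrightarrow> u \<le> fst p \<and> (\<forall>n::nat. \<exists>q\<in>\<rat> \<inter> {0..1}. X (max 0 (u + q * (fst p - u))) (snd p) < 1 / real (Suc n))"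
        unfolding gs_ge_iff[OF w True]
      proof (rule conj_cong[OF refl], rule all_cong1, rule bex_cong[OF refl])
        fix n :: nat and q :: real assume "u \<le> fst p" "q \<in> \<rat> \<inter> {0..1}"
        then have "max 0 (u + q * (fst p - u)) = u + q * (fst p - u)" using True by simp
        then show "(X (u + q * (fst p - u)) (snd p) < 1 / real (Suc n)) = (X (max 0 (u + q * (fst p - u))) (snd p) < 1 / real (Suc n))"
          by simp
      qed
    qed
    ultimately show ?thesis by simp
  qed
qed

text \<open>\<open>last_zero\<close> of \<open>x + z\<close>, written with rational thresholds and
  rational sampling times so that it is jointly measurable on the path space; on the sampled paths
  of the process the two agree (\<open>path_last_zero_future\<close>).\<close>

definition path_last_zero :: "real \<Rightarrow> (real \<Rightarrow> real) \<Rightarrow> real" where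
  "path_last_zero x z = enn2real (SUP u\<in>\<rat> \<inter> {0<..}.
     if \<forall>n::nat. \<exists>q\<in>rat_times. u \<le> q \<and> x + z q < 1 / real (Suc n) then ennreal u else 0)"

lemma path_last_zero_measurable: "(\<lambda>p. path_last_zero (fst p) (snd p)) \<in> borel_measurable (borel \<Otimes>\<^sub>M paths)"
proof -
  have c: "countable (\<rat> \<inter> {0<..} :: real set)" by (rule countable_subset[OF Int_lower1]) (rule countable_rat)
  have z: "(\<lambda>p. snd p q) \<in> borel_measurable (borel \<Otimes>\<^sub>M paths)" if "q \<in> rat_times" for q
    by (rule measurable_compose[OF measurable_snd measurable_component_singleton[OF that]])
  have P: "{p\<in>space (borel \<Otimes>\<^sub>M paths). \<forall>n::nat. \<exists>q\<in>rat_times. u \<le> q \<and> fst p + snd p q < 1 / real (Suc n)} \<in> sets (borel \<Otimes>\<^sub>M paths)" for u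
    by (intro sets.sets_Collect_countable_All sets.sets_Collect_countable_Ex' countable_rat_times sets.sets_Collect_conj sets.sets_Collect_const
        borel_measurable_less borel_measurable_add measurable_const z measurable_fst) simp_all
  show ?thesis unfolding path_last_zero_def
    by (rule borel_measurable_enn2real) (intro borel_measurable_SUP c measurable_If measurable_const P; simp)
qed

lemma path_last_zero_future:
  assumes w: "\<omega> \<in> space M" and s: "0 \<le> s"
  shows "path_last_zero x (future s \<omega>) = last_zero (\<lambda>t. x + (X (s + t) \<omega> - X s \<omega>))"
proof -
  let ?L = "last_zero (\<lambda>t. x + (X (s + t) \<omega> - X s \<omega>))"
  note gp = good_path_shift[OF good[OF w] s]
  have c: "(\<forall>n::nat. \<exists>q\<in>rat_times. u \<le> q \<and> x + future s \<omega> q < 1 / real (Suc n)) \<longleftrightarrow> u \<le> ?L" if u: "0 < u" for u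
  proof -
    have "u \<le> ?L \<longleftrightarrow> (\<exists>t\<ge>u. X (s + t) \<omega> - X s \<omega> \<le> - x)"
      unfolding last_zero_ge_iff[OF gp u] by (simp add: add.commute le_diff_eq flip: le_diff_eq) (auto simp: algebra_simps)
    also have "\<dots> \<longleftrightarrow> (\<forall>n::nat. \<exists>q\<in>\<rat>. u \<le> q \<and> X (s + q) \<omega> - X s \<omega> < - x + 1 / real (Suc n))"
      using u by (intro good_path_visit_iff[OF gp]) simp
    also have "\<dots> \<longleftrightarrow> (\<forall>n::nat. \<exists>q\<in>rat_times. u \<le> q \<and> x + future s \<omega> q < 1 / real (Suc n))"
    proof (rule all_cong1)
      fix n :: nat
      show "(\<exists>q\<in>\<rat>. u \<le> q \<and> X (s + q) \<omega> - X s \<omega> < - x + 1 / real (Suc n)) \<longleftrightarrow> (\<exists>q\<in>rat_times. u \<le> q \<and> x + future s \<omega> q < 1 / real (Suc n))"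
      proof
        assume "\<exists>q\<in>\<rat>. u \<le> q \<and> X (s + q) \<omega> - X s \<omega> < - x + 1 / real (Suc n)"
        then obtain q where "q \<in> \<rat>" "u \<le> q" "X (s + q) \<omega> - X s \<omega> < - x + 1 / real (Suc n)" by blast
        then show "\<exists>q\<in>rat_times. u \<le> q \<and> x + future s \<omega> q < 1 / real (Suc n)"
          using u by (intro bexI[of _ q]) (auto simp: future_def rat_times_def)
      next
        assume "\<exists>q\<in>rat_times. u \<le> q \<and> x + future s \<omega> q < 1 / real (Suc n)"
        then obtain q where "q \<in> rat_times" "u \<le> q" "x + future s \<omega> q < 1 / real (Suc n)" by blast
        then show "\<exists>q\<in>\<rat>. u \<le> q \<and> X (s + q) \<omega> - X s \<omega> < - x + 1 / real (Suc n)"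
          by (intro bexI[of _ q]) (auto simp: future_def rat_times_def)
      qed
    qed
    finally show ?thesis by simp
  qed
  have "(SUP u\<in>\<rat> \<inter> {0<..}. if \<forall>n::nat. \<exists>q\<in>rat_times. u \<le> q \<and> x + future s \<omega> q < 1 / real (Suc n) then ennreal u else 0)
    = (SUP u\<in>\<rat> \<inter> {0<..}. if u \<le> ?L then ennreal u else 0)"
    using c by (intro SUP_cong) auto
  also have "\<dots> = ennreal ?L"
  proof (rule antisym)
    show "(SUP u\<in>\<rat> \<inter> {0<..}. if u \<le> ?L then ennreal u else 0) \<le> ennreal ?L"
      by (intro SUP_least) (auto intro: ennreal_leI)
    show "ennreal ?L \<le> (SUP u\<in>\<rat> \<inter> {0<..}. if u \<le> ?L then ennreal u else 0)"
    proof (rule le_SUP_iff[THEN iffD2], intro allI impI)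
      fix y assume y: "y < ennreal ?L"
      then obtain r where r: "y = ennreal r" "0 \<le> r" by (cases y) auto
      then have "r < ?L" using y by (simp add: ennreal_less_iff)
      then obtain q where q: "q \<in> \<rat>" "r < q" "q < ?L" using Rats_dense_in_real by blast
      then show "\<exists>u\<in>\<rat> \<inter> {0<..}. y < (if u \<le> ?L then ennreal u else 0)"
        using r by (intro bexI[of _ q]) (auto simp: ennreal_less_iff)
    qed
  qed
  finally show ?thesis unfolding path_last_zero_def by (simp add: last_zero_nonneg)
qed

lemma last_zero_split:
  assumes w: "\<omega> \<in> space M" and s: "0 \<le> s"
  shows "last_zero (\<lambda>t. X t \<omega>) = (if 0 < path_last_zero (X s \<omega>) (future s \<omega>) then s + path_last_zero (X s \<omega>) (future s \<omega>) else gs s \<omega>)"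
  using last_zero_decompose[OF good[OF w] s] path_last_zero_future[OF w s, of "X s \<omega>"] by (simp add: Let_def)

lemma path_last_zero_future_0: "\<omega> \<in> space M \<Longrightarrow> path_last_zero x (future 0 \<omega>) = last_zero (\<lambda>t. x + X t \<omega>)"
  using path_last_zero_future[of \<omega> 0 x] X0[of \<omega>] by simp

lemma path_last_zero_nonneg: "0 \<le> path_last_zero x z" by (simp add: path_last_zero_def)

lemma survival_path_last_zero: "survival x = prob {\<omega>\<in>space M. path_last_zero x (future 0 \<omega>) = 0}"
proof -
  have "(\<not> (\<exists>t>0. x + X t \<omega> \<le> 0)) \<longleftrightarrow> path_last_zero x (future 0 \<omega>) = 0" if w: "\<omega> \<in> space M" for \<omega>
    using last_zero_pos_iff[OF good[OF w], of x] path_last_zero_future_0[OF w, of x] last_zero_nonneg[of "\<lambda>t. x + X t \<omega>"]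
    by (metis less_eq_real_def less_irrefl)
  then show ?thesis unfolding survival_def by (intro arg_cong[where f = prob] Collect_cong conj_cong) auto
qed

end

section \<open>Conditional expectation of the payoff derivative\<close>

text \<open>With truncated subtraction both sides are \<open>max p n\<close>, also for infinite
  arguments.\<close>

lemma ennreal_minus_add_eq: "(p - n) + n = p + (n - p)" for p n :: ennreal
  by (auto simp: diff_add_self_ennreal add_diff_self_ennreal)

lemma e2ennreal_diff:
  assumes "n < (\<infinity>::ennreal)"
  shows "e2ennreal (enn2ereal p - enn2ereal n) = p - n" "e2ennreal (- (enn2ereal p - enn2ereal n)) = n - p"
proof -
  obtain r where r: "n = ennreal r" "0 \<le> r" using assms by (cases n) auto
  have "e2ennreal (enn2ereal p - enn2ereal n) = p - n \<and> e2ennreal (- (enn2ereal p - enn2ereal n)) = n - p"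
  proof (cases p)
    case (real s)
    then show ?thesis using r by (simp add: ennreal_minus)
  next
    case top
    then show ?thesis using r by (simp add: e2ennreal_neg)
  qed
  then show "e2ennreal (enn2ereal p - enn2ereal n) = p - n" "e2ennreal (- (enn2ereal p - enn2ereal n)) = n - p" by auto
qed

text \<open>The decomposition need not be the canonical one: \<open>p\<close> and \<open>n\<close>
  may overlap. The parts of \<open>F\<close> are the truncated differences, and adding the integral
  of \<open>n\<close> back yields an identity from which it can be cancelled, being finite.\<close>

lemma ext_integral_diff:
  fixes p n :: "'b \<Rightarrow> ennreal"
  assumes p: "p \<in> borel_measurable N" and n: "n \<in> borel_measurable N"
    and fin: "(\<integral>\<^sup>+x. n x \<partial>N) < \<infinity>"
    and F: "AE x in N. F x = enn2ereal (p x) - enn2ereal (n x)"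
  shows "ext_integral N F = enn2ereal (\<integral>\<^sup>+x. p x \<partial>N) - enn2ereal (\<integral>\<^sup>+x. n x \<partial>N)"
proof -
  have nf: "AE x in N. n x < \<infinity>" using nn_integral_PInf_AE[OF n] fin by (auto simp: less_top)
  let ?A = "\<integral>\<^sup>+x. p x - n x \<partial>N" and ?B = "\<integral>\<^sup>+x. n x - p x \<partial>N"
  have A: "(\<integral>\<^sup>+x. e2ennreal (F x) \<partial>N) = ?A"
    by (rule nn_integral_cong_AE) (use F nf in \<open>eventually_elim, simp add: e2ennreal_diff\<close>)
  have B: "(\<integral>\<^sup>+x. e2ennreal (- F x) \<partial>N) = ?B"
    by (rule nn_integral_cong_AE) (use F nf in \<open>eventually_elim, simp only: e2ennreal_diff\<close>)
  have Bf: "?B < \<infinity>"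
  proof (rule le_less_trans[OF _ fin], rule nn_integral_mono)
    show "n x - p x \<le> n x" for x by (rule diff_le_self_ennreal)
  qed
  have eq: "?A + (\<integral>\<^sup>+x. n x \<partial>N) = (\<integral>\<^sup>+x. p x \<partial>N) + ?B"
  proof -
    have "?A + (\<integral>\<^sup>+x. n x \<partial>N) = (\<integral>\<^sup>+x. (p x - n x) + n x \<partial>N)"
      by (rule nn_integral_add[symmetric]) (use p n in auto)
    also have "\<dots> = (\<integral>\<^sup>+x. p x + (n x - p x) \<partial>N)"
      by (rule nn_integral_cong) (rule ennreal_minus_add_eq)
    also have "\<dots> = (\<integral>\<^sup>+x. p x \<partial>N) + ?B"
      by (rule nn_integral_add) (use p n in auto)
    finally show ?thesis .
  qed
  obtain b where b: "?B = ennreal b" "0 \<le> b" using Bf by (cases ?B) auto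
  obtain m where m: "(\<integral>\<^sup>+x. n x \<partial>N) = ennreal m" "0 \<le> m" using fin by (cases "\<integral>\<^sup>+x. n x \<partial>N") auto
  have "enn2ereal ?A - enn2ereal ?B = enn2ereal (\<integral>\<^sup>+x. p x \<partial>N) - enn2ereal (\<integral>\<^sup>+x. n x \<partial>N)"
  proof (cases "\<integral>\<^sup>+x. p x \<partial>N")
    case (real q)
    then have "?A + ennreal m = ennreal (q + b)" using eq b m by simp
    then obtain a where a: "?A = ennreal a" "0 \<le> a" by (cases ?A) (auto simp: top_add)
    then have "ennreal (a + m) = ennreal (q + b)" using \<open>?A + ennreal m = ennreal (q + b)\<close> m by simp
    then have "a + m = q + b" using a m b real by (subst (asm) ennreal_inj) auto
    then show ?thesis using a b m real by simp
  next
    case top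
    then have "?A = \<top>" using eq b m by (simp add: top_add)
    then show ?thesis using top b m by simp
  qed
  then show ?thesis unfolding ext_integral_def A B .
qed

text \<open>The weight \<open>v\<close> is nonnegative, so \<open>a * v\<close> splits by the sign
  of \<open>a\<close>. The factors \<open>1\<close> and \<open>- 1\<close> match the sign argument
  of \<open>kernel_part\<close> literally.\<close>

lemma ereal_parts_add:
  fixes a v :: real and p n :: ennreal
  assumes v: "0 \<le> v" and n: "n < \<infinity>"
  shows "ereal (a * v) + (enn2ereal p - enn2ereal n) =
    enn2ereal (ennreal (1 * a) * ennreal v + p) - enn2ereal (ennreal (- 1 * a) * ennreal v + n)"
proof -
  obtain m where m: "n = ennreal m" "0 \<le> m" using n by (cases n) auto
  have 1: "ennreal (1 * a) * ennreal v = ennreal (max 0 a * v)" "0 \<le> max 0 a * v"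
    using v by (auto simp: max_def ennreal_mult ennreal_neg)
  have 2: "ennreal (- 1 * a) * ennreal v = ennreal (max 0 (- a) * v)" "0 \<le> max 0 (- a) * v"
    using v by (auto simp: max_def ennreal_mult ennreal_neg)
  have 3: "max 0 a * v - max 0 (- a) * v = a * v" by (simp add: max_def)
  have 4: "ennreal (max 0 (- a) * v) + ennreal m = ennreal (max 0 (- a) * v + m)"
    using 2(2) m(2) by simp
  show ?thesis
  proof (cases p)
    case (real q)
    have 5: "ennreal (max 0 a * v) + ennreal q = ennreal (max 0 a * v + q)"
      using 1(2) real by simp
    have 6: "0 \<le> max 0 a * v + q" "0 \<le> max 0 (- a) * v + m" using 1(2) 2(2) m(2) real by auto
    show ?thesis unfolding 1(1) 2(1) m(1) real 4 5 using 3 6 m(2) real by (simp add: enn2ereal_ennreal)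
  next
    case top
    have 6: "0 \<le> max 0 (- a) * v + m" using 2(2) m(2) by auto
    show ?thesis unfolding 1(1) 2(1) m(1) top 4 using 6 m(2) by (simp add: enn2ereal_ennreal)
  qed
qed

context regular_process begin

context
  fixes d :: "real \<Rightarrow> real \<Rightarrow> real"
  assumes d: "convex_payoff d"
begin

interpretation convex_payoff d by (rule d)

abbreviation g :: "'a \<Rightarrow> real" where "g \<omega> \<equiv> last_zero (\<lambda>t. X t \<omega>)"

text \<open>The sign \<open>\<sigma> = 1\<close> or \<open>\<sigma> = - 1\<close> selects the positive or the negative part of the derivative.\<close>

definition tail_part :: "real \<Rightarrow> real \<Rightarrow> real \<Rightarrow> ennreal" where
  "tail_part \<sigma> s x = (\<integral>\<^sup>+\<omega>. ennreal (\<sigma> * dx s (path_last_zero x (future 0 \<omega>) + s)) * indicator {0<..} (path_last_zero x (future 0 \<omega>)) \<partial>M)"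

text \<open>The first summand is the event of no visit after \<open>s\<close>, on which the last
  zero is \<open>gs s\<close>; the second covers a later visit. \<open>survival\<close> stands for
  the scale-function factor of \<open>G_kernel\<close>.\<close>

definition kernel_part :: "real \<Rightarrow> real \<Rightarrow> 'a \<Rightarrow> ennreal" where
  "kernel_part \<sigma> s \<omega> = ennreal (\<sigma> * dx s (gs s \<omega>)) * ennreal (survival (X s \<omega>)) + tail_part \<sigma> s (X s \<omega>)"

lemma g_measurable: "g \<in> borel_measurable M"
proof -
  have "(\<lambda>\<omega>. path_last_zero 0 (future 0 \<omega>)) \<in> borel_measurable M"
  proof -
    have "(\<lambda>\<omega>. (0, future 0 \<omega>)) \<in> measurable M (borel \<Otimes>\<^sub>M paths)" by measurable
    from measurable_compose[OF this path_last_zero_measurable] show ?thesis by simp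
  qed
  then show ?thesis by (rule measurable_cong[THEN iffD1, rotated]) (simp add: path_last_zero_future_0)
qed

lemma path_last_zero_joint_measurable: "(\<lambda>q. path_last_zero (fst q) (future 0 (snd q))) \<in> borel_measurable (borel \<Otimes>\<^sub>M M)"
proof -
  have "(\<lambda>q. (fst q, future 0 (snd q))) \<in> measurable (borel \<Otimes>\<^sub>M M) (borel \<Otimes>\<^sub>M paths)" by measurable
  from measurable_compose[OF this path_last_zero_measurable] show ?thesis by simp
qed

lemma tail_part_measurable: "(\<lambda>q. tail_part \<sigma> (fst q) (snd q)) \<in> borel_measurable (borel \<Otimes>\<^sub>M borel)"
proof -
  let ?N = "(borel \<Otimes>\<^sub>M borel) \<Otimes>\<^sub>M M"
  have "(\<lambda>q. (snd (fst q), snd q)) \<in> measurable ?N (borel \<Otimes>\<^sub>M M)" by measurable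
  from measurable_compose[OF this path_last_zero_joint_measurable]
  have L[measurable]: "(\<lambda>q. path_last_zero (snd (fst q)) (future 0 (snd q))) \<in> borel_measurable ?N" by simp
  have "(\<lambda>q. (fst (fst q), path_last_zero (snd (fst q)) (future 0 (snd q)) + fst (fst q))) \<in> measurable ?N (borel \<Otimes>\<^sub>M borel)" by measurable
  from measurable_compose[OF this dx_measurable]
  have [measurable]: "(\<lambda>q. dx (fst (fst q)) (path_last_zero (snd (fst q)) (future 0 (snd q)) + fst (fst q))) \<in> borel_measurable ?N" by simp
  have "(\<lambda>q. ennreal (\<sigma> * dx (fst (fst q)) (path_last_zero (snd (fst q)) (future 0 (snd q)) + fst (fst q))) * indicator {0<..} (path_last_zero (snd (fst q)) (future 0 (snd q)))) \<in> borel_measurable ?N"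
    by measurable
  from borel_measurable_nn_integral_fst[OF this] show ?thesis by (simp add: tail_part_def)
qed

lemma survival_measurable: "survival \<in> borel_measurable borel"
proof -
  have [measurable]: "(\<lambda>q. path_last_zero (fst q) (future 0 (snd q))) \<in> borel_measurable (borel \<Otimes>\<^sub>M M)" by (rule path_last_zero_joint_measurable)
  have "(\<lambda>q. indicator {0} (path_last_zero (fst q) (future 0 (snd q))) :: ennreal) \<in> borel_measurable (borel \<Otimes>\<^sub>M M)" by measurable
  from borel_measurable_nn_integral_fst[OF this]
  have m: "(\<lambda>x. \<integral>\<^sup>+\<omega>. indicator {0} (path_last_zero x (future 0 \<omega>)) \<partial>M) \<in> borel_measurable borel" by simp
  have "(\<integral>\<^sup>+\<omega>. indicator {0} (path_last_zero x (future 0 \<omega>)) \<partial>M) = ennreal (survival x)" for x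
  proof -
    have Lx: "(\<lambda>\<omega>. path_last_zero x (future 0 \<omega>)) \<in> borel_measurable M"
      using measurable_compose[OF measurable_Pair1' path_last_zero_joint_measurable, of x] by simp
    have "(\<integral>\<^sup>+\<omega>. indicator {0} (path_last_zero x (future 0 \<omega>)) \<partial>M) = (\<integral>\<^sup>+\<omega>. indicator {\<omega>\<in>space M. path_last_zero x (future 0 \<omega>) = 0} \<omega> \<partial>M)"
      by (rule nn_integral_cong) (simp add: indicator_def)
    also have "\<dots> = emeasure M {\<omega>\<in>space M. path_last_zero x (future 0 \<omega>) = 0}"
      by (rule nn_integral_indicator) (use Lx in measurable)
    finally show ?thesis by (simp add: survival_path_last_zero emeasure_eq_measure)
  qed
  moreover have "enn2real (ennreal (survival x)) = survival x" for x by (rule enn2real_ennreal) (simp add: survival_def)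
  ultimately have "(\<lambda>x. enn2real (\<integral>\<^sup>+\<omega>. indicator {0} (path_last_zero x (future 0 \<omega>)) \<partial>M)) = survival" by (intro ext) (simp only:)
  then show ?thesis using borel_measurable_enn2real[OF m] by simp
qed

lemma kernel_part_measurable:
  "(\<lambda>p. indicator {0<..} (fst p) * kernel_part \<sigma> (fst p) (snd p)) \<in> borel_measurable (borel \<Otimes>\<^sub>M M)"
proof -
  have [measurable]: "(\<lambda>p. X (max 0 (fst p)) (snd p)) \<in> borel_measurable (borel \<Otimes>\<^sub>M M)" by (rule X_joint)
  have [measurable]: "(\<lambda>p. gs (fst p) (snd p)) \<in> borel_measurable (borel \<Otimes>\<^sub>M M)" by (rule gs_joint)
  have "(\<lambda>p. (fst p, gs (fst p) (snd p))) \<in> measurable (borel \<Otimes>\<^sub>M M) (borel \<Otimes>\<^sub>M borel)" by measurable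
  from measurable_compose[OF this dx_measurable]
  have [measurable]: "(\<lambda>p. dx (fst p) (gs (fst p) (snd p))) \<in> borel_measurable (borel \<Otimes>\<^sub>M M)" by simp
  have "(\<lambda>p. (fst p, X (max 0 (fst p)) (snd p))) \<in> measurable (borel \<Otimes>\<^sub>M M) (borel \<Otimes>\<^sub>M borel)" by measurable
  from measurable_compose[OF this tail_part_measurable]
  have [measurable]: "(\<lambda>p. tail_part \<sigma> (fst p) (X (max 0 (fst p)) (snd p))) \<in> borel_measurable (borel \<Otimes>\<^sub>M M)" by simp
  have [measurable]: "(\<lambda>p. survival (X (max 0 (fst p)) (snd p))) \<in> borel_measurable (borel \<Otimes>\<^sub>M M)"
    by (rule measurable_compose[OF _ survival_measurable]) measurable
  have eq: "(\<lambda>p. indicator {0<..} (fst p) * kernel_part \<sigma> (fst p) (snd p)) = (\<lambda>p. indicator {0<..} (fst p) *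
     (ennreal (\<sigma> * dx (fst p) (gs (fst p) (snd p))) * ennreal (survival (X (max 0 (fst p)) (snd p))) + tail_part \<sigma> (fst p) (X (max 0 (fst p)) (snd p))))"
    by (intro ext) (auto simp: kernel_part_def indicator_def)
  show ?thesis unfolding eq by measurable
qed

text \<open>\<open>last_zero_split\<close> expresses \<open>g\<close> through \<open>gs s\<close>
  and \<open>X s\<close>, known at time \<open>s\<close>, and the independent future. Integrating
  the future out separates \<open>?l = 0\<close>, which has probability
  \<open>survival (X s \<omega>)\<close>, from \<open>?l > 0\<close>; the indicator of the past
  event \<open>A\<close> is a constant factor.\<close>

lemma markov_kernel:
  assumes s: "0 < s" and A: "A \<in> sets (past s)"
  shows "(\<integral>\<^sup>+\<omega>. ennreal (\<sigma> * dx s (g \<omega>)) * indicator A \<omega> \<partial>M) = (\<integral>\<^sup>+\<omega>. kernel_part \<sigma> s \<omega> * indicator A \<omega> \<partial>M)"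
proof -
  have s0: "0 \<le> s" using s by simp
  let ?P = "past s \<Otimes>\<^sub>M paths"
  let ?L = "\<lambda>p. path_last_zero (X s (fst p)) (snd p)"
  define H where "H p = ennreal (\<sigma> * dx s (if 0 < ?L p then s + ?L p else gs s (fst p))) * indicator A (fst p)" for p
  have [measurable]: "X s \<in> borel_measurable (past s)" by (rule X_past) (use s in auto)
  have [measurable]: "gs s \<in> borel_measurable (past s)" by (rule gs_past)
  have [measurable]: "A \<in> sets (past s)" by (rule A)
  have "(\<lambda>p. (X s (fst p), snd p)) \<in> measurable ?P (borel \<Otimes>\<^sub>M paths)" by measurable
  from measurable_compose[OF this path_last_zero_measurable]
  have [measurable]: "?L \<in> borel_measurable ?P" by simp
  have ds: "dx s \<in> borel_measurable borel"
    using measurable_compose[OF measurable_Pair1' dx_measurable, of s] by simp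
  have "(\<lambda>p. dx s (if 0 < ?L p then s + ?L p else gs s (fst p))) \<in> borel_measurable ?P"
    by (rule measurable_compose[OF _ ds]) measurable
  then have Hm: "H \<in> borel_measurable ?P" unfolding H_def by measurable
  have "(\<integral>\<^sup>+\<omega>. ennreal (\<sigma> * dx s (g \<omega>)) * indicator A \<omega> \<partial>M) = (\<integral>\<^sup>+\<omega>. H (\<omega>, future s \<omega>) \<partial>M)"
    by (rule nn_integral_cong) (simp add: H_def last_zero_split[OF _ s0])
  also have "\<dots> = (\<integral>\<^sup>+\<omega>. (\<integral>\<^sup>+\<omega>'. H (\<omega>, future 0 \<omega>') \<partial>M) \<partial>M)"
    by (rule markov_nn_integral[OF s0 Hm])
  also have "\<dots> = (\<integral>\<^sup>+\<omega>. kernel_part \<sigma> s \<omega> * indicator A \<omega> \<partial>M)"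
  proof (rule nn_integral_cong)
    fix \<omega>
    let ?l = "\<lambda>\<omega>'. path_last_zero (X s \<omega>) (future 0 \<omega>')"
    have l[measurable]: "?l \<in> borel_measurable M"
      using measurable_compose[OF measurable_Pair1' path_last_zero_joint_measurable, of "X s \<omega>"] by simp
    have dl[measurable]: "(\<lambda>\<omega>'. dx s (?l \<omega>' + s)) \<in> borel_measurable M"
      by (rule measurable_compose[OF _ ds]) measurable
    have "(\<integral>\<^sup>+\<omega>'. H (\<omega>, future 0 \<omega>') \<partial>M) = (\<integral>\<^sup>+\<omega>'. (ennreal (\<sigma> * dx s (gs s \<omega>)) * indicator {\<omega>'\<in>space M. ?l \<omega>' = 0} \<omega>' +
       ennreal (\<sigma> * dx s (?l \<omega>' + s)) * indicator {0<..} (?l \<omega>')) * indicator A \<omega> \<partial>M)"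
    proof (rule nn_integral_cong)
      fix \<omega>' assume "\<omega>' \<in> space M"
      then show "H (\<omega>, future 0 \<omega>') = (ennreal (\<sigma> * dx s (gs s \<omega>)) * indicator {\<omega>'\<in>space M. ?l \<omega>' = 0} \<omega>' +
       ennreal (\<sigma> * dx s (?l \<omega>' + s)) * indicator {0<..} (?l \<omega>')) * indicator A \<omega>"
        using path_last_zero_nonneg[of "X s \<omega>" "future 0 \<omega>'"] by (cases "?l \<omega>' = 0") (auto simp: H_def add.commute)
    qed
    also have "\<dots> = (\<integral>\<^sup>+\<omega>'. ennreal (\<sigma> * dx s (gs s \<omega>)) * indicator {\<omega>'\<in>space M. ?l \<omega>' = 0} \<omega>' +
       ennreal (\<sigma> * dx s (?l \<omega>' + s)) * indicator {0<..} (?l \<omega>') \<partial>M) * indicator A \<omega>"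
      by (rule nn_integral_multc) measurable
    also have "(\<integral>\<^sup>+\<omega>'. ennreal (\<sigma> * dx s (gs s \<omega>)) * indicator {\<omega>'\<in>space M. ?l \<omega>' = 0} \<omega>' +
       ennreal (\<sigma> * dx s (?l \<omega>' + s)) * indicator {0<..} (?l \<omega>') \<partial>M) =
       (\<integral>\<^sup>+\<omega>'. ennreal (\<sigma> * dx s (gs s \<omega>)) * indicator {\<omega>'\<in>space M. ?l \<omega>' = 0} \<omega>' \<partial>M) + tail_part \<sigma> s (X s \<omega>)"
      unfolding tail_part_def by (rule nn_integral_add) measurable
    also have "(\<integral>\<^sup>+\<omega>'. ennreal (\<sigma> * dx s (gs s \<omega>)) * indicator {\<omega>'\<in>space M. ?l \<omega>' = 0} \<omega>' \<partial>M) = ennreal (\<sigma> * dx s (gs s \<omega>)) * ennreal (survival (X s \<omega>))"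
    proof -
      have "{\<omega>'\<in>space M. ?l \<omega>' = 0} \<in> events" by measurable
      then show ?thesis by (simp add: nn_integral_cmult_indicator survival_path_last_zero emeasure_eq_measure)
    qed
    finally show "(\<integral>\<^sup>+\<omega>'. H (\<omega>, future 0 \<omega>') \<partial>M) = kernel_part \<sigma> s \<omega> * indicator A \<omega>"
      by (simp add: kernel_part_def)
  qed
  finally show ?thesis .
qed

text \<open>Finiteness of the negative tail makes \<open>ext_integral_diff\<close> applicable to the
  expectation in the kernel, and \<open>survival_eq_scale\<close> with
  \<open>right_deriv_exponent\<close> turns the other term into \<open>dx\<close> times a
  probability, which splits by sign.\<close>

lemma G_kernel_eq:
  assumes W: "is_scale_function (laplace_exponent M X) W" and s: "0 < s"
    and fin: "tail_part (- 1) s (X s \<omega>) < \<infinity>"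
  shows "G_kernel M X W d (gs s \<omega>) s (X s \<omega>) = enn2ereal (kernel_part 1 s \<omega>) - enn2ereal (kernel_part (- 1) s \<omega>)"
proof -
  let ?x = "X s \<omega>"
  let ?f = "\<lambda>\<sigma> \<omega>'. ennreal (\<sigma> * dx s (path_last_zero ?x (future 0 \<omega>') + s)) * indicator {0<..} (path_last_zero ?x (future 0 \<omega>'))"
  have l[measurable]: "(\<lambda>\<omega>'. path_last_zero ?x (future 0 \<omega>')) \<in> borel_measurable M"
    using measurable_compose[OF measurable_Pair1' path_last_zero_joint_measurable, of ?x] by simp
  have ds: "dx s \<in> borel_measurable borel"
    using measurable_compose[OF measurable_Pair1' dx_measurable, of s] by simp
  have [measurable]: "(\<lambda>\<omega>'. dx s (path_last_zero ?x (future 0 \<omega>') + s)) \<in> borel_measurable M"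
    by (rule measurable_compose[OF _ ds]) measurable
  have split: "ereal r = enn2ereal (ennreal (1 * r)) - enn2ereal (ennreal (- 1 * r))" for r :: real
    by (cases "0 \<le> r") (auto simp: ennreal_neg enn2ereal_ennreal zero_ennreal.rep_eq)
  have rd: "right_deriv (\<lambda>t. d t \<gamma>) s = dx s \<gamma>" if "0 \<le> \<gamma>" for \<gamma>
    using s that by (simp add: dx_def)
  have "ext_integral M (\<lambda>\<omega>'. let g = last_zero (\<lambda>t. ?x + X t \<omega>') in ereal (right_deriv (\<lambda>t. d t (g + s)) s * of_bool (g > 0))) =
    enn2ereal (tail_part 1 s ?x) - enn2ereal (tail_part (- 1) s ?x)"
    unfolding tail_part_def
  proof (rule ext_integral_diff)
    show "?f 1 \<in> borel_measurable M" "?f (- 1) \<in> borel_measurable M" by measurable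
    show "(\<integral>\<^sup>+\<omega>'. ?f (- 1) \<omega>' \<partial>M) < \<infinity>" using fin by (simp add: tail_part_def)
    show "AE \<omega>' in M. (let g = last_zero (\<lambda>t. ?x + X t \<omega>') in ereal (right_deriv (\<lambda>t. d t (g + s)) s * of_bool (g > 0))) =
      enn2ereal (?f 1 \<omega>') - enn2ereal (?f (- 1) \<omega>')"
    proof (rule AE_I2)
      fix \<omega>' assume w: "\<omega>' \<in> space M"
      have nn: "0 \<le> path_last_zero ?x (future 0 \<omega>') + s" using path_last_zero_nonneg[of ?x "future 0 \<omega>'"] s by simp
      show "(let g = last_zero (\<lambda>t. ?x + X t \<omega>') in ereal (right_deriv (\<lambda>t. d t (g + s)) s * of_bool (g > 0))) =
        enn2ereal (?f 1 \<omega>') - enn2ereal (?f (- 1) \<omega>')"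
        unfolding path_last_zero_future_0[OF w, symmetric] Let_def rd[OF nn]
        using split[of "dx s (path_last_zero ?x (future 0 \<omega>') + s)"]
        by (cases "0 < path_last_zero ?x (future 0 \<omega>')") (simp_all add: zero_ennreal.rep_eq)
    qed
  qed
  moreover have "right_deriv (\<lambda>t. d t (gs s \<omega>)) s * right_deriv (laplace_exponent M X) 0 * W ?x = dx s (gs s \<omega>) * survival ?x"
    using rd[OF last_zero_before_nonneg] survival_eq_scale[OF W] right_deriv_exponent by (simp add: mult.assoc)
  ultimately have G: "G_kernel M X W d (gs s \<omega>) s ?x = ereal (dx s (gs s \<omega>) * survival ?x) + (enn2ereal (tail_part 1 s ?x) - enn2ereal (tail_part (- 1) s ?x))"
    by (simp add: G_kernel_def)
  show ?thesis unfolding G kernel_part_def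
    by (rule ereal_parts_add) (use fin in \<open>simp_all add: survival_def\<close>)
qed

end
end

lemma ext_integral_cong_AE: "AE x in N. F x = G x \<Longrightarrow> ext_integral N F = ext_integral N G"
  unfolding ext_integral_def
  by (intro arg_cong2[where f = "\<lambda>a b. enn2ereal a - enn2ereal b"] nn_integral_cong_AE) (auto elim: eventually_mono)

section \<open>Stopping times and the interchange of expectation and time integral\<close>

context regular_process begin

text \<open>The index \<open>s\<close> itself occurs in the intersection that makes the filtration
  right-continuous, because it exceeds \<open>r\<close>.\<close>

lemma augmented_filtration_past:
  assumes "r < s" shows "augmented_filtration M X r \<subseteq> sets (past s)"
  unfolding augmented_filtration_def sets_past by (rule INT_lower) (use assms in simp)

text \<open>The complement is the countable union of the events \<open>\<tau> \<le> r\<close> over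
  rational \<open>r < s\<close>, and each of them is known strictly before \<open>s\<close>.\<close>

lemma stopping_time_ge_past:
  assumes \<tau>: "levy_stopping_time M X \<tau>" and s: "0 < s"
  shows "{\<omega>\<in>space M. ennreal s \<le> \<tau> \<omega>} \<in> sets (past s)"
proof -
  let ?R = "\<rat> \<inter> {0..<s}"
  have c: "countable ?R" by (rule countable_subset[OF Int_lower1]) (rule countable_rat)
  have m: "{\<omega>\<in>space M. \<tau> \<omega> \<le> ennreal r} \<in> sets (past s)" if "r \<in> ?R" for r
    using \<tau> that augmented_filtration_past[of r s] by (auto simp: levy_stopping_time_def)
  have eq: "{\<omega>\<in>space M. ennreal s \<le> \<tau> \<omega>} = space (past s) - (\<Union>r\<in>?R. {\<omega>\<in>space M. \<tau> \<omega> \<le> ennreal r})"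
  proof (rule set_eqI)
    fix \<omega>
    have "\<tau> \<omega> < ennreal s \<longleftrightarrow> (\<exists>r\<in>?R. \<tau> \<omega> \<le> ennreal r)"
    proof
      assume a: "\<tau> \<omega> < ennreal s"
      then obtain t where t: "\<tau> \<omega> = ennreal t" "0 \<le> t" by (cases "\<tau> \<omega>") auto
      then have "t < s" using a by (simp add: ennreal_less_iff)
      then obtain r where "r \<in> \<rat>" "t < r" "r < s" using Rats_dense_in_real by blast
      then show "\<exists>r\<in>?R. \<tau> \<omega> \<le> ennreal r" using t by (intro bexI[of _ r]) (auto intro: ennreal_leI)
    next
      assume "\<exists>r\<in>?R. \<tau> \<omega> \<le> ennreal r"
      then obtain r where r: "r \<in> ?R" "\<tau> \<omega> \<le> ennreal r" by blast
      then have "ennreal r < ennreal s" by (simp add: ennreal_less_iff)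
      then show "\<tau> \<omega> < ennreal s" using r(2) by simp
    qed
    then show "\<omega> \<in> {\<omega>\<in>space M. ennreal s \<le> \<tau> \<omega>} \<longleftrightarrow> \<omega> \<in> space (past s) - (\<Union>r\<in>?R. {\<omega>\<in>space M. \<tau> \<omega> \<le> ennreal r})"
      by (auto simp: not_less[symmetric])
  qed
  show ?thesis unfolding eq using c m by (intro sets.Diff sets.top sets.countable_UN') auto
qed

lemma stopping_time_measurable:
  assumes \<tau>: "levy_stopping_time M X \<tau>"
  shows "\<tau> \<in> borel_measurable M"
proof (rule borel_measurableI_le)
  fix y
  show "{\<omega>\<in>space M. \<tau> \<omega> \<le> y} \<in> events"
  proof (cases y)
    case (real t)
    then have "{\<omega>\<in>space M. \<tau> \<omega> \<le> y} \<in> augmented_filtration M X t" using \<tau> by (simp add: levy_stopping_time_def)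
    then show ?thesis using augmented_filtration_past[of t "t + 1"] sets_past_subset by auto
  qed simp
qed

context
  fixes d :: "real \<Rightarrow> real \<Rightarrow> real" and W :: "real \<Rightarrow> real" and \<tau> :: "'a \<Rightarrow> ennreal"
  assumes d: "convex_payoff d"
    and W: "is_scale_function (laplace_exponent M X) W"
    and \<tau>: "levy_stopping_time M X \<tau>"
    and fin: "(\<integral>\<^sup>+\<omega>. ennreal (d 0 (g \<omega>)) \<partial>M) < \<infinity>"
begin

interpretation convex_payoff d by (rule d)

abbreviation before :: "real \<Rightarrow> 'a \<Rightarrow> ennreal" where
  "before s \<omega> \<equiv> indicator {s. 0 < s \<and> ennreal s \<le> \<tau> \<omega>} s"

lemma lborel_pair: "borel_measurable (lborel \<Otimes>\<^sub>M M) = borel_measurable (borel \<Otimes>\<^sub>M M)"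
  by (rule measurable_cong_sets[OF sets_pair_measure_cong[OF sets_lborel refl] refl])

lemma before_measurable: "(\<lambda>p. before (fst p) (snd p)) \<in> borel_measurable (borel \<Otimes>\<^sub>M M)"
proof -
  note [measurable] = stopping_time_measurable[OF \<tau>]
  have "{p\<in>space (borel \<Otimes>\<^sub>M M). 0 < fst p \<and> ennreal (fst p) \<le> \<tau> (snd p)} \<in> sets (borel \<Otimes>\<^sub>M M)" by measurable
  then have "indicator {p\<in>space (borel \<Otimes>\<^sub>M M). 0 < fst p \<and> ennreal (fst p) \<le> \<tau> (snd p)} \<in> borel_measurable (borel \<Otimes>\<^sub>M M)"
    by (rule borel_measurable_indicator)
  then show ?thesis
    by (rule measurable_cong[THEN iffD1, rotated]) (simp add: indicator_def)
qed

lemma dx_g_measurable: "(\<lambda>p. ennreal (\<sigma> * dx (fst p) (g (snd p))) * before (fst p) (snd p)) \<in> borel_measurable (borel \<Otimes>\<^sub>M M)"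
proof -
  note [measurable] = g_measurable[OF d] before_measurable
  have "(\<lambda>p. (fst p, g (snd p))) \<in> measurable (borel \<Otimes>\<^sub>M M) (borel \<Otimes>\<^sub>M borel)" by measurable
  from measurable_compose[OF this dx_measurable]
  have [measurable]: "(\<lambda>p. dx (fst p) (g (snd p))) \<in> borel_measurable (borel \<Otimes>\<^sub>M M)" by simp
  show ?thesis by measurable
qed

lemma kernel_before_measurable: "(\<lambda>p. kernel_part d \<sigma> (fst p) (snd p) * before (fst p) (snd p)) \<in> borel_measurable (borel \<Otimes>\<^sub>M M)"
proof -
  note [measurable] = kernel_part_measurable[OF d, of \<sigma>] before_measurable
  have "(\<lambda>p. (indicator {0<..} (fst p) * kernel_part d \<sigma> (fst p) (snd p)) * before (fst p) (snd p)) \<in> borel_measurable (borel \<Otimes>\<^sub>M M)"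
    by measurable
  then show ?thesis by (rule measurable_cong[THEN iffD1, rotated]) (simp add: indicator_def)
qed

lemma inner_measurable:
  fixes f :: "real \<times> 'a \<Rightarrow> ennreal"
  assumes f: "f \<in> borel_measurable (borel \<Otimes>\<^sub>M M)"
  shows "(\<lambda>\<omega>. \<integral>\<^sup>+s. f (s, \<omega>) \<partial>lborel) \<in> borel_measurable M"
proof -
  have "f \<in> borel_measurable (lborel \<Otimes>\<^sub>M M)" using f by (simp only: lborel_pair)
  from measurable_pair_swap[OF this]
  have "(\<lambda>(\<omega>, s). f (s, \<omega>)) \<in> borel_measurable (M \<Otimes>\<^sub>M lborel)" .
  from lborel.borel_measurable_nn_integral[OF this] show ?thesis .
qed

lemma fubini:
  fixes f :: "real \<times> 'a \<Rightarrow> ennreal"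
  assumes f: "f \<in> borel_measurable (borel \<Otimes>\<^sub>M M)"
  shows "(\<integral>\<^sup>+\<omega>. (\<integral>\<^sup>+s. f (s, \<omega>) \<partial>lborel) \<partial>M) = (\<integral>\<^sup>+s. (\<integral>\<^sup>+\<omega>. f (s, \<omega>) \<partial>M) \<partial>lborel)"
proof -
  interpret L: pair_sigma_finite lborel M by unfold_locales
  have "f \<in> borel_measurable (lborel \<Otimes>\<^sub>M M)" using f by (simp only: lborel_pair)
  then have "case_prod (\<lambda>s \<omega>. f (s, \<omega>)) \<in> borel_measurable (lborel \<Otimes>\<^sub>M M)" by simp
  then show ?thesis by (rule L.Fubini')
qed

text \<open>Tonelli moves the expectation inside; at a fixed time \<open>s\<close> the event
  \<open>s \<le> \<tau>\<close> belongs to \<open>past s\<close>, so \<open>markov_kernel\<close>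
  applies, and Tonelli moves the expectation back out.\<close>

lemma expected_parts:
  "(\<integral>\<^sup>+\<omega>. (\<integral>\<^sup>+s. ennreal (\<sigma> * dx s (g \<omega>)) * before s \<omega> \<partial>lborel) \<partial>M) =
   (\<integral>\<^sup>+\<omega>. (\<integral>\<^sup>+s. kernel_part d \<sigma> s \<omega> * before s \<omega> \<partial>lborel) \<partial>M)"
proof -
  have "(\<integral>\<^sup>+\<omega>. (\<integral>\<^sup>+s. ennreal (\<sigma> * dx s (g \<omega>)) * before s \<omega> \<partial>lborel) \<partial>M) =
    (\<integral>\<^sup>+s. (\<integral>\<^sup>+\<omega>. ennreal (\<sigma> * dx s (g \<omega>)) * before s \<omega> \<partial>M) \<partial>lborel)"
    using fubini[OF dx_g_measurable[of \<sigma>]] by simp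
  also have "\<dots> = (\<integral>\<^sup>+s. (\<integral>\<^sup>+\<omega>. kernel_part d \<sigma> s \<omega> * before s \<omega> \<partial>M) \<partial>lborel)"
  proof (rule nn_integral_cong)
    fix s :: real
    show "(\<integral>\<^sup>+\<omega>. ennreal (\<sigma> * dx s (g \<omega>)) * before s \<omega> \<partial>M) = (\<integral>\<^sup>+\<omega>. kernel_part d \<sigma> s \<omega> * before s \<omega> \<partial>M)"
    proof (cases "0 < s")
      case True
      let ?A = "{\<omega>\<in>space M. ennreal s \<le> \<tau> \<omega>}"
      have b: "before s \<omega> = indicator ?A \<omega>" if "\<omega> \<in> space M" for \<omega>
        using that True by (simp add: indicator_def)
      have "(\<integral>\<^sup>+\<omega>. ennreal (\<sigma> * dx s (g \<omega>)) * before s \<omega> \<partial>M) = (\<integral>\<^sup>+\<omega>. ennreal (\<sigma> * dx s (g \<omega>)) * indicator ?A \<omega> \<partial>M)"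
        by (rule nn_integral_cong) (simp only: b)
      also have "\<dots> = (\<integral>\<^sup>+\<omega>. kernel_part d \<sigma> s \<omega> * indicator ?A \<omega> \<partial>M)"
        by (rule markov_kernel[OF d True stopping_time_ge_past[OF \<tau> True]])
      also have "\<dots> = (\<integral>\<^sup>+\<omega>. kernel_part d \<sigma> s \<omega> * before s \<omega> \<partial>M)"
        by (rule nn_integral_cong) (simp only: b)
      finally show ?thesis .
    qed simp
  qed
  also have "\<dots> = (\<integral>\<^sup>+\<omega>. (\<integral>\<^sup>+s. kernel_part d \<sigma> s \<omega> * before s \<omega> \<partial>lborel) \<partial>M)"
    using fubini[OF kernel_before_measurable[of \<sigma>]] by simp
  finally show ?thesis .
qed

lemma stopped_value_parts:
  "stopped_value d (\<tau> \<omega>) (g \<omega>) =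
    enn2ereal (ennreal (d 0 (g \<omega>)) + (\<integral>\<^sup>+s. ennreal (1 * dx s (g \<omega>)) * before s \<omega> \<partial>lborel)) -
    enn2ereal (\<integral>\<^sup>+s. ennreal (- 1 * dx s (g \<omega>)) * before s \<omega> \<partial>lborel)"
  "(\<integral>\<^sup>+s. ennreal (- 1 * dx s (g \<omega>)) * before s \<omega> \<partial>lborel) \<le> ennreal (d 0 (g \<omega>))"
proof -
  let ?A = "{s. 0 < s \<and> ennreal s \<le> \<tau> \<omega>}"
  have dx: "dx s (g \<omega>) = right_deriv (\<lambda>t. d t (g \<omega>)) s" if "s \<in> ?A" for s
    using that last_zero_nonneg[of "\<lambda>t. X t \<omega>"] by (simp add: dx_def)
  have 1: "(\<integral>\<^sup>+s. ennreal (1 * dx s (g \<omega>)) * before s \<omega> \<partial>lborel) = (\<integral>\<^sup>+s. ennreal (right_deriv (\<lambda>t. d t (g \<omega>)) s) * indicator ?A s \<partial>lborel)"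
  proof (rule nn_integral_cong)
    fix s
    show "ennreal (1 * dx s (g \<omega>)) * before s \<omega> = ennreal (right_deriv (\<lambda>t. d t (g \<omega>)) s) * indicator ?A s"
      using dx[of s] by (cases "s \<in> ?A") simp_all
  qed
  have 2: "(\<integral>\<^sup>+s. ennreal (- 1 * dx s (g \<omega>)) * before s \<omega> \<partial>lborel) = (\<integral>\<^sup>+s. ennreal (- right_deriv (\<lambda>t. d t (g \<omega>)) s) * indicator ?A s \<partial>lborel)"
  proof (rule nn_integral_cong)
    fix s
    show "ennreal (- 1 * dx s (g \<omega>)) * before s \<omega> = ennreal (- right_deriv (\<lambda>t. d t (g \<omega>)) s) * indicator ?A s"
      using dx[of s] by (cases "s \<in> ?A") simp_all
  qed
  have c: "convex_right_continuous (\<lambda>t. d t (g \<omega>))" by (rule section_convex[OF last_zero_nonneg])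
  show "stopped_value d (\<tau> \<omega>) (g \<omega>) =
    enn2ereal (ennreal (d 0 (g \<omega>)) + (\<integral>\<^sup>+s. ennreal (1 * dx s (g \<omega>)) * before s \<omega> \<partial>lborel)) -
    enn2ereal (\<integral>\<^sup>+s. ennreal (- 1 * dx s (g \<omega>)) * before s \<omega> \<partial>lborel)"
    unfolding 1 2 by (rule stopped_value_eq(1)[where d = d and \<gamma> = "g \<omega>" and T = "\<tau> \<omega>", OF c])
  show "(\<integral>\<^sup>+s. ennreal (- 1 * dx s (g \<omega>)) * before s \<omega> \<partial>lborel) \<le> ennreal (d 0 (g \<omega>))"
    unfolding 2 by (rule stopped_value_eq(2)[where d = d and \<gamma> = "g \<omega>" and T = "\<tau> \<omega>", OF c])
qed

text \<open>The decomposition of the kernel can fail at \<open>s = 0\<close> and where the negative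
  part is infinite. The first is a single point, the second a null set by the finiteness assumed in
  \<open>f\<close>.\<close>

lemma kernel_integral:
  assumes w: "\<omega> \<in> space M" and f: "(\<integral>\<^sup>+s. kernel_part d (- 1) s \<omega> * before s \<omega> \<partial>lborel) < \<infinity>"
  shows "ext_integral (restrict_space lborel {s. 0 \<le> s \<and> ennreal s \<le> \<tau> \<omega>}) (\<lambda>s. G_kernel M X W d (gs s \<omega>) s (X s \<omega>)) =
    enn2ereal (\<integral>\<^sup>+s. kernel_part d 1 s \<omega> * before s \<omega> \<partial>lborel) - enn2ereal (\<integral>\<^sup>+s. kernel_part d (- 1) s \<omega> * before s \<omega> \<partial>lborel)"
proof -
  let ?S = "{s. 0 \<le> s \<and> ennreal s \<le> \<tau> \<omega>}"
  let ?R = "restrict_space lborel ?S"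
  have S: "?S \<inter> space lborel \<in> sets lborel"
  proof -
    have "{s\<in>space borel. 0 \<le> s \<and> ennreal s \<le> \<tau> \<omega>} \<in> sets borel" by measurable
    then show ?thesis by simp
  qed
  let ?k = "\<lambda>\<sigma> s. indicator {0<..} s * kernel_part d \<sigma> s \<omega>"
  have km: "?k \<sigma> \<in> borel_measurable borel" for \<sigma>
    using measurable_compose[OF measurable_Pair2'[OF w] kernel_part_measurable[OF d]] by simp
  then have kR: "?k \<sigma> \<in> borel_measurable ?R" for \<sigma> by (intro measurable_restrict_space1) simp
  have kI: "(\<integral>\<^sup>+s. ?k \<sigma> s \<partial>?R) = (\<integral>\<^sup>+s. kernel_part d \<sigma> s \<omega> * before s \<omega> \<partial>lborel)" for \<sigma>
    unfolding nn_integral_restrict_space[OF S]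
    by (rule nn_integral_cong) (simp add: indicator_def)
  have ae: "AE s in lborel. s \<in> ?S \<longrightarrow> 0 < s \<and> kernel_part d (- 1) s \<omega> < \<infinity>"
  proof -
    have "(\<lambda>s. kernel_part d (- 1) s \<omega> * before s \<omega>) \<in> borel_measurable lborel"
      using measurable_compose[OF measurable_Pair2'[OF w] kernel_before_measurable] by simp
    from nn_integral_PInf_AE[OF this] f
    have "AE s in lborel. kernel_part d (- 1) s \<omega> * before s \<omega> \<noteq> \<infinity>" by (simp add: less_top)
    then show ?thesis using AE_lborel_singleton[of 0]
      by eventually_elim (auto simp: indicator_def less_top split: if_splits)
  qed
  have "ext_integral ?R (\<lambda>s. G_kernel M X W d (gs s \<omega>) s (X s \<omega>)) = enn2ereal (\<integral>\<^sup>+s. ?k 1 s \<partial>?R) - enn2ereal (\<integral>\<^sup>+s. ?k (- 1) s \<partial>?R)"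
  proof (rule ext_integral_diff[OF kR kR])
    show "(\<integral>\<^sup>+s. ?k (- 1) s \<partial>?R) < \<infinity>" using f by (simp only: kI)
    show "AE s in ?R. G_kernel M X W d (gs s \<omega>) s (X s \<omega>) = enn2ereal (?k 1 s) - enn2ereal (?k (- 1) s)"
      unfolding AE_restrict_space_iff[OF S] using ae
    proof eventually_elim
      case (elim s)
      show ?case
      proof
        assume "s \<in> ?S"
        then have s: "0 < s" and k: "kernel_part d (- 1) s \<omega> < \<infinity>" using elim by auto
        have "tail_part d (- 1) s (X s \<omega>) \<le> kernel_part d (- 1) s \<omega>"
          unfolding kernel_part_def[OF d] by (rule add_increasing) simp_all
        then have "tail_part d (- 1) s (X s \<omega>) < \<infinity>" using k by (rule le_less_trans)
        from G_kernel_eq[OF d W s this] s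
        show "G_kernel M X W d (gs s \<omega>) s (X s \<omega>) = enn2ereal (?k 1 s) - enn2ereal (?k (- 1) s)" by simp
      qed
    qed
  qed
  then show ?thesis by (simp only: kI)
qed

text \<open>Pathwise the negative part is at most \<open>d 0 (g \<omega>)\<close>, hence its
  expectation is finite; \<open>expected_parts\<close> carries this finiteness over to the kernel,
  so \<open>ext_integral_diff\<close> can be applied on both sides.\<close>

theorem stopped_expectation:
  "ext_integral M (\<lambda>\<omega>. stopped_value d (\<tau> \<omega>) (g \<omega>)) =
    ext_integral M (\<lambda>\<omega>.
      ext_integral (restrict_space lborel {s. 0 \<le> s \<and> ennreal s \<le> \<tau> \<omega>}) (\<lambda>s. G_kernel M X W d (gs s \<omega>) s (X s \<omega>))
      + ereal (d 0 (g \<omega>)))"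
proof -
  let ?D = "\<lambda>\<omega>. ennreal (d 0 (g \<omega>))"
  let ?P = "\<lambda>\<sigma> \<omega>. \<integral>\<^sup>+s. ennreal (\<sigma> * dx s (g \<omega>)) * before s \<omega> \<partial>lborel"
  let ?K = "\<lambda>\<sigma> \<omega>. \<integral>\<^sup>+s. kernel_part d \<sigma> s \<omega> * before s \<omega> \<partial>lborel"
  have D: "?D \<in> borel_measurable M"
  proof -
    have "(\<lambda>\<omega>. d 0 (max 0 (g \<omega>))) \<in> borel_measurable M"
      by (rule measurable_compose[OF g_measurable[OF d] section_measurable]) simp
    then show ?thesis by (simp add: last_zero_nonneg max_absorb2)
  qed
  have P: "?P \<sigma> \<in> borel_measurable M" for \<sigma> using inner_measurable[OF dx_g_measurable[of \<sigma>]] by simp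
  have K: "?K \<sigma> \<in> borel_measurable M" for \<sigma> using inner_measurable[OF kernel_before_measurable[of \<sigma>]] by simp
  have "(\<integral>\<^sup>+\<omega>. ?P (- 1) \<omega> \<partial>M) \<le> (\<integral>\<^sup>+\<omega>. ?D \<omega> \<partial>M)"
    by (rule nn_integral_mono) (rule stopped_value_parts(2))
  then have Pf: "(\<integral>\<^sup>+\<omega>. ?P (- 1) \<omega> \<partial>M) < \<infinity>" using fin by (rule le_less_trans)
  then have Kf: "(\<integral>\<^sup>+\<omega>. ?K (- 1) \<omega> \<partial>M) < \<infinity>" by (simp only: expected_parts)
  have "ext_integral M (\<lambda>\<omega>. stopped_value d (\<tau> \<omega>) (g \<omega>)) =
    enn2ereal (\<integral>\<^sup>+\<omega>. ?D \<omega> + ?P 1 \<omega> \<partial>M) - enn2ereal (\<integral>\<^sup>+\<omega>. ?P (- 1) \<omega> \<partial>M)"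
    by (rule ext_integral_diff[OF borel_measurable_add[OF D P] P Pf]) (intro AE_I2 stopped_value_parts(1))
  also have "(\<integral>\<^sup>+\<omega>. ?D \<omega> + ?P 1 \<omega> \<partial>M) = (\<integral>\<^sup>+\<omega>. ?D \<omega> + ?K 1 \<omega> \<partial>M)"
    unfolding nn_integral_add[OF D P] nn_integral_add[OF D K] expected_parts ..
  also have "(\<integral>\<^sup>+\<omega>. ?P (- 1) \<omega> \<partial>M) = (\<integral>\<^sup>+\<omega>. ?K (- 1) \<omega> \<partial>M)" by (rule expected_parts)
  also have "enn2ereal (\<integral>\<^sup>+\<omega>. ?D \<omega> + ?K 1 \<omega> \<partial>M) - enn2ereal (\<integral>\<^sup>+\<omega>. ?K (- 1) \<omega> \<partial>M) =
    ext_integral M (\<lambda>\<omega>.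
      ext_integral (restrict_space lborel {s. 0 \<le> s \<and> ennreal s \<le> \<tau> \<omega>}) (\<lambda>s. G_kernel M X W d (gs s \<omega>) s (X s \<omega>))
      + ereal (d 0 (g \<omega>)))"
  proof (rule ext_integral_diff[symmetric, OF borel_measurable_add[OF D K] K Kf])
    have "AE \<omega> in M. ?K (- 1) \<omega> < \<infinity>" using nn_integral_PInf_AE[OF K] Kf by (auto simp: less_top)
    then show "AE \<omega> in M. ext_integral (restrict_space lborel {s. 0 \<le> s \<and> ennreal s \<le> \<tau> \<omega>}) (\<lambda>s. G_kernel M X W d (gs s \<omega>) s (X s \<omega>))
      + ereal (d 0 (g \<omega>)) = enn2ereal (?D \<omega> + ?K 1 \<omega>) - enn2ereal (?K (- 1) \<omega>)"
      using AE_space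
    proof eventually_elim
      case (elim \<omega>)
      have d0: "0 \<le> d 0 (g \<omega>)" by (rule d_nonneg) (simp_all add: last_zero_nonneg)
      \<comment> \<open>The initial payoff enters as \<open>a\<close> with weight
        \<open>v = 1\<close>; being nonnegative, it adds 0 to the negative part.\<close>
      have "ereal (d 0 (g \<omega>) * 1) + (enn2ereal (?K 1 \<omega>) - enn2ereal (?K (- 1) \<omega>)) =
        enn2ereal (ennreal (1 * d 0 (g \<omega>)) * ennreal 1 + ?K 1 \<omega>) - enn2ereal (ennreal (- 1 * d 0 (g \<omega>)) * ennreal 1 + ?K (- 1) \<omega>)"
        by (rule ereal_parts_add[OF _ elim(1)]) simp
      then show ?case unfolding kernel_integral[OF elim(2,1)] using d0 by (simp add: ennreal_neg add.commute)
    qed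
  qed
  finally show ?thesis .
qed

end
end

section \<open>The general process\<close>

lemma good_path_ident: "good_path (\<lambda>t. t)"
  by (auto simp: good_path_def intro: filterlim_ident tendsto_ident_at)

text \<open>Replacing the paths on a null set by \<open>t \<mapsto> t\<close> makes all path properties hold surely.\<close>

lemma regular_version:
  fixes X :: "real \<Rightarrow> 'a \<Rightarrow> real"
  assumes X: "spectrally_negative_levy_process M X" and drifts: "drifts_to_infinity M X"
  obtains N where "N \<in> null_sets M" "regular_process M (\<lambda>t \<omega>. if \<omega> \<in> N then t else X t \<omega>)"
proof -
  interpret spectrally_negative_levy_process M X by (rule X)
  have "AE \<omega> in M. good_path (\<lambda>t. X t \<omega>)"
    using start_zero right_continuous_paths left_limits no_positive_jumps drifts[unfolded drifts_to_infinity_def]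
  proof eventually_elim
    case (elim \<omega>)
    have "\<exists>l\<ge>X t \<omega>. ((\<lambda>s. X s \<omega>) \<longlongrightarrow> l) (at_left t)" if t: "t > 0" for t
    proof -
      obtain l where l: "((\<lambda>s. X s \<omega>) \<longlongrightarrow> l) (at_left t)" using elim(3) t by blast
      have "Lim (at_left t) (\<lambda>s. X s \<omega>) = l" by (rule tendsto_Lim[OF _ l]) (simp add: trivial_limit_at_left_real)
      then show ?thesis using elim(4) t l by auto
    qed
    then show ?case using elim by (simp add: good_path_def)
  qed
  then obtain N where N: "{\<omega>\<in>space M. \<not> good_path (\<lambda>t. X t \<omega>)} \<subseteq> N" "emeasure M N = 0" "N \<in> sets M"
    by (rule AE_E)
  have null: "N \<in> null_sets M" using N by (intro null_setsI)
  let ?Y = "\<lambda>t \<omega>. if \<omega> \<in> N then t else X t \<omega>"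
  have [measurable]: "N \<in> sets M" by (rule N(3))
  have Ym: "?Y t \<in> borel_measurable M" if "0 \<le> t" for t
    using random_variable_X[OF that] by measurable
  have ae: "AE \<omega> in M. \<forall>t. ?Y t \<omega> = X t \<omega>" using AE_not_in[OF null] by eventually_elim simp
  have "regular_process M ?Y"
  proof
    show "?Y t \<in> borel_measurable M" if "0 \<le> t" for t by (rule Ym[OF that])
    show "good_path (\<lambda>t. ?Y t \<omega>)" if "\<omega> \<in> space M" for \<omega>
      using N(1) that good_path_ident by (cases "\<omega> \<in> N") auto
    fix s t :: real assume st: "0 \<le> s" "s \<le> t"
    have "distr M borel (\<lambda>\<omega>. ?Y t \<omega> - ?Y s \<omega>) = distr M borel (\<lambda>\<omega>. X t \<omega> - X s \<omega>)"
      by (rule distr_cong_AE) (use ae st in \<open>auto intro!: borel_measurable_diff Ym random_variable_X elim!: eventually_mono\<close>)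
    also have "\<dots> = distr M borel (X (t - s))" by (rule stationary_increments[OF st])
    also have "\<dots> = distr M borel (?Y (t - s))"
      by (rule distr_cong_AE) (use ae st in \<open>auto intro!: Ym random_variable_X elim!: eventually_mono\<close>)
    finally show "distr M borel (\<lambda>\<omega>. ?Y t \<omega> - ?Y s \<omega>) = distr M borel (?Y (t - s))" .
  next
    fix t :: "nat \<Rightarrow> real" and n assume t: "0 \<le> t 0" "mono t"
    have t0: "0 \<le> t i" for i using t monoD[OF t(2), of 0 i] by simp
    let ?DY = "\<lambda>i \<omega>. ?Y (t (Suc i)) \<omega> - ?Y (t i) \<omega>" and ?DX = "\<lambda>i \<omega>. X (t (Suc i)) \<omega> - X (t i) \<omega>"
    have mY: "?DY i \<in> borel_measurable M" and mX: "?DX i \<in> borel_measurable M" for i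
      using t0 by (intro borel_measurable_diff Ym random_variable_X; simp)+
    show "indep_vars (\<lambda>_. borel) ?DY {..<n}"
    \<comment> \<open>The characterization of independence by a product law requires a nonempty
      index set.\<close>
    proof (cases "n = 0")
      case True
      then show ?thesis by (simp add: indep_vars_def2 indep_sets_def)
    next
      case False
      then have ne: "{..<n} \<noteq> {}" by auto
      have "distr M (\<Pi>\<^sub>M i\<in>{..<n}. borel) (\<lambda>x. \<lambda>i\<in>{..<n}. ?DY i x) = distr M (\<Pi>\<^sub>M i\<in>{..<n}. borel) (\<lambda>x. \<lambda>i\<in>{..<n}. ?DX i x)"
        by (rule distr_cong_AE) (use ae mX mY in \<open>auto intro!: measurable_restrict elim!: eventually_mono\<close>)
      also have "\<dots> = (\<Pi>\<^sub>M i\<in>{..<n}. distr M borel (?DX i))"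
        by (rule indep_vars_iff_distr_eq_PiM'[OF ne mX, THEN iffD1]) (rule independent_increments[OF t])
      also have "\<dots> = (\<Pi>\<^sub>M i\<in>{..<n}. distr M borel (?DY i))"
      proof (rule PiM_cong[OF refl])
        fix i
        show "distr M borel (?DX i) = distr M borel (?DY i)"
          by (rule distr_cong_AE) (use ae mX mY in \<open>auto elim!: eventually_mono\<close>)
      qed
      finally show ?thesis by (rule indep_vars_iff_distr_eq_PiM'[OF ne mY, THEN iffD2])
    qed
  qed
  with null show ?thesis by (rule that)
qed

theorem lemma4p6:
  fixes M :: "'a measure" and X :: "real \<Rightarrow> 'a \<Rightarrow> real"
    and W :: "real \<Rightarrow> real" and d :: "real \<Rightarrow> real \<Rightarrow> real"
    and g :: "'a \<Rightarrow> real" and \<tau> :: "'a \<Rightarrow> ennreal"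
  assumes "spectrally_negative_levy_process M X"
    and "drifts_to_infinity M X"
    and "is_scale_function (laplace_exponent M X) W"
    and g_def: "g = (\<lambda>\<omega>. last_zero (\<lambda>t. X t \<omega>))"
    and d_nonneg: "\<And>t \<gamma>. 0 \<le> t \<Longrightarrow> 0 \<le> \<gamma> \<Longrightarrow> 0 \<le> d t \<gamma>"
    and d_convex: "convex_on ({0..} \<times> {0..}) (\<lambda>(t, \<gamma>). d t \<gamma>)"
    and d_right_continuous_at_0: "\<And>\<gamma>. 0 \<le> \<gamma> \<Longrightarrow> ((\<lambda>t. d t \<gamma>) \<longlongrightarrow> d 0 \<gamma>) (at_right 0)"
    and "ext_integral M (\<lambda>\<omega>. ereal (d 0 (g \<omega>))) < \<infinity>"
    and "levy_stopping_time M X \<tau>"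
  shows "ext_integral M (\<lambda>\<omega>. stopped_value d (\<tau> \<omega>) (g \<omega>)) =
    ext_integral M (\<lambda>\<omega>.
      ext_integral (restrict_space lborel {s. 0 \<le> s \<and> ennreal s \<le> \<tau> \<omega>})
        (\<lambda>s. G_kernel M X W d (last_zero_before s (\<lambda>t. X t \<omega>)) s (X s \<omega>))
      + ereal (d 0 (g \<omega>)))"
proof -
  obtain N where null: "N \<in> null_sets M"
    and reg: "regular_process M (\<lambda>t \<omega>. if \<omega> \<in> N then t else X t \<omega>)"
    by (rule regular_version[OF assms(1,2)])
  define Y where "Y t \<omega> = (if \<omega> \<in> N then t else X t \<omega>)" for t \<omega>
  interpret Y: regular_process M Y using reg unfolding Y_def .
  interpret L: spectrally_negative_levy_process M X by (rule assms(1))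
  have ae: "AE \<omega> in M. \<forall>t. Y t \<omega> = X t \<omega>"
    using AE_not_in[OF null] by eventually_elim (simp add: Y_def)
  have lap: "laplace_exponent M X = laplace_exponent M Y"
  proof
    fix \<beta>
    have "(\<integral>\<omega>. exp (\<beta> * X 1 \<omega>) \<partial>M) = (\<integral>\<omega>. exp (\<beta> * Y 1 \<omega>) \<partial>M)"
    proof (rule integral_cong_AE)
      have [measurable]: "X 1 \<in> borel_measurable M" "Y 1 \<in> borel_measurable M"
        using L.random_variable_X[of 1] Y.rv[of 1] by simp_all
      show "(\<lambda>\<omega>. exp (\<beta> * X 1 \<omega>)) \<in> borel_measurable M" "(\<lambda>\<omega>. exp (\<beta> * Y 1 \<omega>)) \<in> borel_measurable M"
        by measurable
      show "AE \<omega> in M. exp (\<beta> * X 1 \<omega>) = exp (\<beta> * Y 1 \<omega>)" using ae by eventually_elim simp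
    qed
    then show "laplace_exponent M X \<beta> = laplace_exponent M Y \<beta>" by (simp add: laplace_exponent_def)
  qed
  have ker: "G_kernel M X W d = G_kernel M Y W d"
  proof (intro ext)
    fix \<gamma> s x
    have "ext_integral M (\<lambda>\<omega>. let g = last_zero (\<lambda>t. x + X t \<omega>) in ereal (right_deriv (\<lambda>t. d t (g + s)) s * of_bool (g > 0))) =
      ext_integral M (\<lambda>\<omega>. let g = last_zero (\<lambda>t. x + Y t \<omega>) in ereal (right_deriv (\<lambda>t. d t (g + s)) s * of_bool (g > 0)))"
      by (rule ext_integral_cong_AE) (use ae in \<open>eventually_elim, simp\<close>)
    then show "G_kernel M X W d \<gamma> s x = G_kernel M Y W d \<gamma> s x" unfolding G_kernel_def lap by simp
  qed
  \<comment> \<open>\<open>X\<close> and \<open>Y\<close> agree off \<open>N\<close>. The event is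
    that of \<open>Y\<close> outside \<open>N\<close> plus a subset of \<open>N\<close> that is
    itself measurable and null, and null sets belong to \<open>past\<close>.\<close>
  have X_past: "X s -` B \<inter> space M \<in> sets (Y.past u)" if sB: "0 \<le> s" "s \<le> u" "B \<in> sets borel" for s u B
  proof -
    let ?A = "X s -` B \<inter> space M"
    have null_past: "A \<in> sets (Y.past u)" if "A \<in> null_sets M" for A
      using that unfolding Y.sets_past by (intro sigma_sets.Basic UnI2)
    have "?A \<in> sets M" by (rule measurable_sets[OF L.random_variable_X[OF sB(1)] sB(3)])
    then have "N \<inter> ?A \<in> null_sets M" by (rule null_set_Int2[OF null])
    then have 1: "N \<inter> ?A \<in> sets (Y.past u)" by (rule null_past)
    have 2: "Y s -` B \<inter> space M \<in> sets (Y.past u)"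
      using measurable_sets[OF Y.X_past[OF sB(1,2)] sB(3)] by simp
    have "?A = (Y s -` B \<inter> space M - N) \<union> (N \<inter> ?A)" by (auto simp: Y_def)
    then show ?thesis using sets.Un[OF sets.Diff[OF 2 null_past[OF null]] 1] by simp
  qed
  have gen: "sigma_sets (space M) ({X s -` B \<inter> space M | s B. 0 \<le> s \<and> s \<le> u \<and> B \<in> sets borel} \<union> null_sets M) \<subseteq> sets (Y.past u)" for u
  proof -
    have "{X s -` B \<inter> space M | s B. 0 \<le> s \<and> s \<le> u \<and> B \<in> sets borel} \<subseteq> sets (Y.past u)"
    proof
      fix A assume "A \<in> {X s -` B \<inter> space M | s B. 0 \<le> s \<and> s \<le> u \<and> B \<in> sets borel}"
      then obtain s B where "A = X s -` B \<inter> space M" "0 \<le> s" "s \<le> u" "B \<in> sets borel"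
        unfolding mem_Collect_eq by (elim exE conjE) (rule that)
      then show "A \<in> sets (Y.past u)" using X_past by (simp only:)
    qed
    moreover have "null_sets M \<subseteq> sets (Y.past u)" unfolding Y.sets_past by (intro subsetI sigma_sets.Basic UnI2)
    ultimately show ?thesis unfolding Y.space_past[of u, symmetric] by (intro sets.sigma_sets_subset Un_least) simp_all
  qed
  \<comment> \<open>This inclusion is the direction that makes \<open>\<tau>\<close> a stopping time
    of the modified process.\<close>
  have filt: "augmented_filtration M X t \<subseteq> augmented_filtration M Y t" for t
    unfolding augmented_filtration_def Y.sets_past[symmetric] by (rule INT_anti_mono[OF order_refl gen])
  have d: "convex_payoff d"
    by (rule convex_payoff.intro[OF d_nonneg d_convex d_right_continuous_at_0])
  have g: "AE \<omega> in M. g \<omega> = last_zero (\<lambda>t. Y t \<omega>)"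
    using ae by eventually_elim (simp add: g_def)
  have fin: "(\<integral>\<^sup>+\<omega>. ennreal (d 0 (last_zero (\<lambda>t. Y t \<omega>))) \<partial>M) < \<infinity>"
  proof -
    have g0: "0 \<le> g \<omega>" for \<omega> by (simp add: g_def last_zero_nonneg)
    have "e2ennreal (- ereal (d 0 (g \<omega>))) = 0" for \<omega> using d_nonneg[OF order_refl g0[of \<omega>]] by (simp add: ennreal_neg)
    then have "enn2ereal (\<integral>\<^sup>+\<omega>. ennreal (d 0 (g \<omega>)) \<partial>M) < \<infinity>"
      using assms(8) by (simp add: ext_integral_def zero_ennreal.rep_eq)
    then have "(\<integral>\<^sup>+\<omega>. ennreal (d 0 (g \<omega>)) \<partial>M) < \<infinity>" by (auto simp: less_top)
    also have "(\<integral>\<^sup>+\<omega>. ennreal (d 0 (g \<omega>)) \<partial>M) = (\<integral>\<^sup>+\<omega>. ennreal (d 0 (last_zero (\<lambda>t. Y t \<omega>))) \<partial>M)"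
      by (rule nn_integral_cong_AE) (use g in \<open>eventually_elim, simp\<close>)
    finally show ?thesis .
  qed
  have \<tau>: "levy_stopping_time M Y \<tau>" using assms(9) filt by (auto simp: levy_stopping_time_def)
  have "ext_integral M (\<lambda>\<omega>. stopped_value d (\<tau> \<omega>) (g \<omega>)) =
    ext_integral M (\<lambda>\<omega>. stopped_value d (\<tau> \<omega>) (last_zero (\<lambda>t. Y t \<omega>)))"
    by (rule ext_integral_cong_AE) (use g in \<open>eventually_elim, simp\<close>)
  also have "\<dots> = ext_integral M (\<lambda>\<omega>.
      ext_integral (restrict_space lborel {s. 0 \<le> s \<and> ennreal s \<le> \<tau> \<omega>})
        (\<lambda>s. G_kernel M Y W d (last_zero_before s (\<lambda>t. Y t \<omega>)) s (Y s \<omega>))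
      + ereal (d 0 (last_zero (\<lambda>t. Y t \<omega>))))"
    by (rule Y.stopped_expectation[OF d _ \<tau> fin]) (use assms(3) lap in simp)
  also have "\<dots> = ext_integral M (\<lambda>\<omega>.
      ext_integral (restrict_space lborel {s. 0 \<le> s \<and> ennreal s \<le> \<tau> \<omega>})
        (\<lambda>s. G_kernel M X W d (last_zero_before s (\<lambda>t. X t \<omega>)) s (X s \<omega>))
      + ereal (d 0 (g \<omega>)))"
    unfolding ker by (rule ext_integral_cong_AE) (use ae g in \<open>eventually_elim, simp\<close>)
  finally show ?thesis .
qed

end
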